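(* Let $T:X\to X$ be a non-singular piecewise invertible map with respect to the partition $\mathcal P=\{O_h\}_{h\in\mathcal H}$, satisfying uniform expansion, bounded distortion and controlled complexity (all as defined in the context), and suppose $(T,\mathbf m)$ is ergodic. Then there exist a nonempty open set $Z\subset X$ and a refinement $\mathcal P''$ of $\mathcal P$ into open sets (mod $0$) such that $Z$ is a union of elements of $\mathcal P''$, and there exists a map $\tilde\tau:Z\to\mathbb Z^+$, constant on elements of $\mathcal P''$ (contained in $Z$), such that: (a) the map $\tilde G=T^{\tilde\tau}:Z\to Z$, $\tilde G(x)=T^{\tilde\tau(x)}(x)$, is a full-branched Gibbs-Markov map; (b) there exist $\tilde\kappa\in(0,1)$ and a constant $C<\infty$ such that $\mathbf m(\{x\in Z:\tilde\tau(x)>n\})\le C\tilde\kappa^n$ for all $n\in\mathbb N$.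
   Context: **Setting.** $\mathbb R^d$ carries the Euclidean metric $\mathbf d$ and Lebesgue measure $\mathbf m$. For $A\subset\mathbb R^d$, $\operatorname{cl}A$ is the closure, $\partial A=\operatorname{cl}A\cap\operatorname{cl}(\mathbb R^d\setminus A)$, and $\partial_\varepsilon A=\{x\in A:\mathbf d(x,\partial A)<\varepsilon\}$. $X\subset\mathbb R^d$ is a bounded open set with $\sup_{\varepsilon>0}\mathbf m(\partial_\varepsilon X)/\varepsilon<\infty$. $T$ is a non-singular piecewise invertible map on $X$ with respect to a countable partition $\mathcal P=\{O_h\}_{h\in\mathcal H}$: the $O_h$ are pairwise disjoint nonempty open subsets of $X$ with $\mathbf m(X\setminus\bigcup_h O_h)=0$, and each $T|_{O_h}:O_h\to T(O_h)\subset X$ is a homeomorphism onto its image which is non-singular with non-singular inverse (i.e. $(T|_{O_h})_*(\mathbf m|_{O_h})$ is equivalent to $\mathbf m|_{T(O_h)}$). The symbol $h$ also denotes the inverse branch $h:T(O_h)\to O_h$. $\mathcal H^n$ is the set of inverse branches of $T^n$ ($n\in\mathbb N$), with corresponding partition $\mathcal P^n=\{O_h\}_{h\in\mathcal H^n}$ and $h:T^n(O_h)\to O_h$. $Jh=d(\mathbf m\circ h)/d\mathbf m$. Ergodicity of $(T,\mathbf m)$ means that $T^{-1}A=A$ (mod $0$) implies $\mathbf m(A)=0$ or $\mathbf m(X\setminus A)=0$ ($\mathbf m$ is not assumed invariant). **Uniform expansion.** There exist $\varepsilon_1>0$ and $\Lambda\in(0,1)$ such that for every $h\in\mathcal H$,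 $\mathbf d(h(x),h(y))\le\Lambda\,\mathbf d(x,y)$ for all $x,y\in T(O_h)$ with $\mathbf d(x,y)\le\varepsilon_1$. **Bounded distortion.** There exist $\alpha\in(0,1]$, $\tilde D\ge0$ such that for all $h\in\mathcal H$ and $x,y\in T(O_h)$, $Jh(x)\le e^{\tilde D\,\mathbf d(x,y)^\alpha}Jh(y)$. **Controlled complexity.** There exist $n_0\in\mathbb N$, $\varepsilon_2>0$ and $0\le\sigma<\Lambda^{-n_0}-1$ such that for every (nonempty) open set $I\subset X$ with $\operatorname{diam}I\le\varepsilon_2$ and every $0<\varepsilon<\varepsilon_2$, $$\sum_{h\in\mathcal H^{n_0},\ \mathbf m(I\cap O_h)>0}\frac{\mathbf m\big(h(\partial_\varepsilon T^{n_0}(I\cap O_h))\setminus\partial_{\Lambda^{n_0}\varepsilon}I\big)}{\mathbf m(\partial_{\Lambda^{n_0}\varepsilon}I)}\le\sigma;$$ moreover there is $\bar C<\infty$ such that for every integer $1\le r<n_0$, and all such $I$ and $\varepsilon$, $$\sum_{h\in\mathcal H^{r},\ \mathbf m(I\cap O_h)>0}\frac{\mathbf m\big(h(\partial_\varepsilon T^{r}(I\cap O_h))\setminus\partial_{\Lambda^{r}\varepsilon}I\big)}{\mathbf m(\partial_{\Lambda^{r}\varepsilon}I)}\le\bar C.$$ **Partitions and Gibbs-Markov maps.** A refinement of $\mathcal P$ into open sets (mod $0$) is a countable family of pairwise disjoint nonempty open sets, each contained in an element of $\mathcal P$, whose union has full measure in $X$; unions of partition elements are understood mod $0$. Let $Y\subset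 X$ be open and $\mathcal Q$ a countable (mod $0$)-partition of $Y$ into open sets. A map $G:Y\to Y$ (defined a.e.) is Gibbs-Markov with respect to $\mathcal Q$ if: for each $a\in\mathcal Q$, $G:a\to G(a)$ is a non-singular homeomorphism with non-singular inverse $g_a:G(a)\to a$; $G(a)$ is (mod $0$) a union of elements of $\mathcal Q$; $G$ has uniform expansion, i.e. there are $\varepsilon'>0$, $\Lambda'\in(0,1)$ such that for all $a$, $\mathbf d(g_a(x),g_a(y))\le\Lambda'\mathbf d(x,y)$ for $x,y\in G(a)$ with $\mathbf d(x,y)\le\varepsilon'$; and $G$ has bounded distortion, i.e. there are $\alpha'\in(0,1]$, $D'\ge0$ such that for all $a$ and $x,y\in G(a)$, $Jg_a(x)\le e^{D'\mathbf d(x,y)^{\alpha'}}Jg_a(y)$. It is full-branched if $G(a)=Y$ for every $a\in\mathcal Q$. For $\tilde G$, $Y=Z$ and $\mathcal Q$ consists of the elements of $\mathcal P''$ contained in $Z$. *)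

theory Defs
  imports "HOL-Analysis.Analysis"
begin

text \<open>
  The space \<open>'a :: euclidean_space\<close> plays the role of Euclidean space of arbitrary dimension
  \<open>d \<ge> 1\<close>. Maps that are only defined almost everywhere are total functions whose values off the
  relevant partition are irrelevant.
\<close>

definition eq_mod0 :: "'a::euclidean_space set \<Rightarrow> 'a set \<Rightarrow> bool" where
  "eq_mod0 A B \<longleftrightarrow> (A - B) \<union> (B - A) \<in> null_sets lebesgue"

definition union_mod0 :: "'a::euclidean_space set \<Rightarrow> 'a set set \<Rightarrow> bool" where
  "union_mod0 A Q \<longleftrightarrow> (\<exists>F\<subseteq>Q. eq_mod0 A (\<Union>F))"

definition open_partition :: "'a::euclidean_space set \<Rightarrow> 'a set set \<Rightarrow> bool" where
  "open_partition Y Q \<longleftrightarrow>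
     countable Q \<and> disjoint Q \<and> (\<forall>a\<in>Q. open a \<and> a \<noteq> {} \<and> a \<subseteq> Y) \<and>
     Y - \<Union>Q \<in> null_sets lebesgue"

definition open_refinement :: "'a::euclidean_space set \<Rightarrow> 'a set set \<Rightarrow> 'a set set \<Rightarrow> bool" where
  "open_refinement X P P' \<longleftrightarrow> open_partition X P' \<and> (\<forall>a\<in>P'. \<exists>O\<^sub>h\<in>P. a \<subseteq> O\<^sub>h)"

text \<open>
  The collar \<open>{x \<in> A. d(x, \<partial>A) < \<epsilon>}\<close>. As \<open>infdist x {} = 0\<close>, the case of an empty boundary is
  excluded explicitly (the distance to the empty set being infinite).
\<close>
definition collar :: "real \<Rightarrow> 'a::euclidean_space set \<Rightarrow> 'a set" where
  "collar \<epsilon> A = {x \<in> A. frontier A \<noteq> {} \<and> infdist x (frontier A) < \<epsilon>}"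

text \<open>
  If \<open>f\<close> is injective on \<open>S\<close>, with inverse \<open>h\<close> from \<open>f ` S\<close> to \<open>S\<close>, then \<open>pushforward f S\<close> is the
  measure \<open>A \<mapsto> m (S \<inter> f -` A) = m (h ` A)\<close>, i.e. \<open>m \<circ> h\<close>, on the Borel subsets of \<open>f ` S\<close>.
  It is built on \<open>lborel\<close> because homeomorphisms need not be Lebesgue-measurable a priori.
\<close>
definition pushforward :: "('a::euclidean_space \<Rightarrow> 'a) \<Rightarrow> 'a set \<Rightarrow> 'a measure" where
  "pushforward f S = distr (restrict_space lborel S) (restrict_space lborel (f ` S)) f"

definition nonsingular_homeo_on :: "('a::euclidean_space \<Rightarrow> 'a) \<Rightarrow> 'a set \<Rightarrow> bool" where
  "nonsingular_homeo_on f S \<longleftrightarrow>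
     (\<exists>g. homeomorphism S (f ` S) f g) \<and>
     absolutely_continuous (pushforward f S) (restrict_space lborel (f ` S)) \<and>
     absolutely_continuous (restrict_space lborel (f ` S)) (pushforward f S)"

text \<open>\<open>J\<close> is a version of the Radon-Nikodym derivative \<open>d(m \<circ> h)/dm\<close> on \<open>f ` S\<close>.\<close>
definition is_jacobian :: "('a::euclidean_space \<Rightarrow> 'a) \<Rightarrow> 'a set \<Rightarrow> ('a \<Rightarrow> real) \<Rightarrow> bool" where
  "is_jacobian f S J \<longleftrightarrow>
     J \<in> borel_measurable (restrict_space lborel (f ` S)) \<and> (\<forall>x\<in>f ` S. 0 \<le> J x) \<and>
     density (restrict_space lborel (f ` S)) (\<lambda>x. ennreal (J x)) = pushforward f S"

definition uniform_expansion ::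
    "('a::euclidean_space \<Rightarrow> 'a) \<Rightarrow> 'a set set \<Rightarrow> real \<Rightarrow> real \<Rightarrow> bool" where
  "uniform_expansion f Q \<epsilon> \<Lambda> \<longleftrightarrow>
     0 < \<epsilon> \<and> 0 < \<Lambda> \<and> \<Lambda> < 1 \<and>
     (\<forall>a\<in>Q. \<forall>x\<in>f ` a. \<forall>y\<in>f ` a. dist x y \<le> \<epsilon> \<longrightarrow>
        dist (inv_into a f x) (inv_into a f y) \<le> \<Lambda> * dist x y)"

text \<open>
  The Jacobian is only determined almost everywhere; the pointwise inequality is required of some
  version of it. The constants do not depend on the branch.
\<close>
definition bounded_distortion ::
    "('a::euclidean_space \<Rightarrow> 'a) \<Rightarrow> 'a set set \<Rightarrow> real \<Rightarrow> real \<Rightarrow> bool" where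
  "bounded_distortion f Q \<alpha> D \<longleftrightarrow>
     0 < \<alpha> \<and> \<alpha> \<le> 1 \<and> 0 \<le> D \<and>
     (\<forall>a\<in>Q. \<exists>J. is_jacobian f a J \<and>
        (\<forall>x\<in>f ` a. \<forall>y\<in>f ` a. J x \<le> exp (D * dist x y powr \<alpha>) * J y))"

definition piecewise_invertible ::
    "'a::euclidean_space set \<Rightarrow> ('a \<Rightarrow> 'a) \<Rightarrow> 'a set set \<Rightarrow> bool" where
  "piecewise_invertible X T P \<longleftrightarrow>
     open_partition X P \<and> (\<forall>O\<^sub>h\<in>P. T ` O\<^sub>h \<subseteq> X \<and> nonsingular_homeo_on T O\<^sub>h)"

definition ergodic :: "'a::euclidean_space set \<Rightarrow> ('a \<Rightarrow> 'a) \<Rightarrow> bool" where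
  "ergodic X T \<longleftrightarrow>
     (\<forall>A\<in>sets lebesgue. A \<subseteq> X \<longrightarrow> eq_mod0 (T -` A \<inter> X) A \<longrightarrow>
        emeasure lebesgue A = 0 \<or> emeasure lebesgue (X - A) = 0)"

text \<open>
  The partition into domains of the branches of \<open>T ^^ n\<close>. The branch with domain \<open>O\<^sub>h\<close> has inverse
  \<open>inv_into O\<^sub>h (T ^^ n)\<close>, so summing over these domains is summing over the inverse branches.
\<close>
definition iterated_partition ::
    "'a::euclidean_space set \<Rightarrow> ('a \<Rightarrow> 'a) \<Rightarrow> 'a set set \<Rightarrow> nat \<Rightarrow> 'a set set" where
  "iterated_partition X T P n =
     {C. C \<noteq> {} \<and> (\<exists>w. length w = n \<and> set w \<subseteq> P \<and> C = {x \<in> X. \<forall>i<n. (T ^^ i) x \<in> w ! i})}"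

definition complexity ::
    "'a::euclidean_space set \<Rightarrow> ('a \<Rightarrow> 'a) \<Rightarrow> 'a set set \<Rightarrow> real \<Rightarrow> nat \<Rightarrow> 'a set \<Rightarrow> real \<Rightarrow> ennreal"
  where
  "complexity X T P \<Lambda> r I \<epsilon> =
     (\<Sum>\<^sub>\<infinity>O\<^sub>h\<in>{C \<in> iterated_partition X T P r. emeasure lebesgue (I \<inter> C) > 0}.
        emeasure lebesgue
          (inv_into O\<^sub>h (T ^^ r) ` collar \<epsilon> ((T ^^ r) ` (I \<inter> O\<^sub>h)) - collar (\<Lambda> ^ r * \<epsilon>) I)
        / emeasure lebesgue (collar (\<Lambda> ^ r * \<epsilon>) I))"

definition controlled_complexity ::
    "'a::euclidean_space set \<Rightarrow> ('a \<Rightarrow> 'a) \<Rightarrow> 'a set set \<Rightarrow> real \<Rightarrow> nat \<Rightarrow> real \<Rightarrow> real \<Rightarrow> bool"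
  where
  "controlled_complexity X T P \<Lambda> n\<^sub>0 \<epsilon>\<^sub>2 \<sigma> \<longleftrightarrow>
     0 < \<epsilon>\<^sub>2 \<and> 0 \<le> \<sigma> \<and> \<sigma> < inverse (\<Lambda> ^ n\<^sub>0) - 1 \<and>
     (\<forall>I \<epsilon>. open I \<and> I \<noteq> {} \<and> I \<subseteq> X \<and> diameter I \<le> \<epsilon>\<^sub>2 \<and> 0 < \<epsilon> \<and> \<epsilon> < \<epsilon>\<^sub>2 \<longrightarrow>
        complexity X T P \<Lambda> n\<^sub>0 I \<epsilon> \<le> ennreal \<sigma>) \<and>
     (\<exists>Cbar::real. \<forall>r. 1 \<le> r \<and> r < n\<^sub>0 \<longrightarrow>
        (\<forall>I \<epsilon>. open I \<and> I \<noteq> {} \<and> I \<subseteq> X \<and> diameter I \<le> \<epsilon>\<^sub>2 \<and> 0 < \<epsilon> \<and> \<epsilon> < \<epsilon>\<^sub>2 \<longrightarrow>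
           complexity X T P \<Lambda> r I \<epsilon> \<le> ennreal Cbar))"

definition gibbs_markov :: "'a::euclidean_space set \<Rightarrow> 'a set set \<Rightarrow> ('a \<Rightarrow> 'a) \<Rightarrow> bool" where
  "gibbs_markov Y Q G \<longleftrightarrow>
     open Y \<and> open_partition Y Q \<and>
     (\<forall>a\<in>Q. nonsingular_homeo_on G a \<and> G ` a \<subseteq> Y \<and> union_mod0 (G ` a) Q) \<and>
     (\<exists>\<epsilon> \<Lambda>. uniform_expansion G Q \<epsilon> \<Lambda>) \<and>
     (\<exists>\<alpha> D. bounded_distortion G Q \<alpha> D)"

definition full_branched :: "'a set \<Rightarrow> 'a set set \<Rightarrow> ('a \<Rightarrow> 'a) \<Rightarrow> bool" where
  "full_branched Y Q G \<longleftrightarrow> (\<forall>a\<in>Q. G ` a = Y)"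

end

theory Submission
  imports Defs
begin

text \<open>
  Let \<open>U\<close> be an open set on which \<open>T\<^sup>n\<close> is a branch with image of small diameter, and let \<open>\<Z>(U)\<close> be
  the integral over \<open>x \<in> U\<close> of \<open>d(T\<^sup>n x, \<partial>T\<^sup>nU)\<close> to a power in \<open>(-1, 0)\<close>. Bounded distortion and
  controlled complexity make the sum of \<open>\<Z>\<close> over the pieces of \<open>U\<close> contract under \<open>n\<^sub>0\<close> further
  iterates, and recutting the images to small diameter along well-chosen hyperplanes costs only a
  multiple of \<open>m(U)\<close>. By ergodicity all balls of a finite net contain preimages, under branches of
  iterates, of one common small ball. If \<open>T\<^sup>nU\<close> contains a ball of the net, a definite fraction of \<open>U\<close>
  is therefore mapped onto the common ball in bounded time, and removing it raises \<open>\<Z>\<close> by at most a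
  multiple of \<open>m(U)\<close>; otherwise \<open>T\<^sup>nU\<close> is thin and \<open>\<Z>(U)\<close> is large compared with \<open>m(U)\<close>. In both
  cases \<open>m + a\<Z>\<close>, with \<open>a\<close> small, drops by a fixed factor after boundedly many iterates, so the
  mass that has not yet returned decays exponentially.
\<close>

section \<open>Jacobians of non-singular homeomorphisms\<close>

text \<open>Contraction of inverse branches holds only at distances up to
  \<open>\<epsilon>\<^sub>1\<close>, so distortion of iterates is uniform only on small images;
  hence all images are kept at diameter at most \<open>\<delta>\<close>. As \<open>\<delta>\<close>
  shrinks, the distortion factor \<open>K\<close> tends to 1, and the strict bound on
  \<open>\<sigma>\<close> leaves a window
  \<open>1 + K * \<sigma> < r < \<Lambda>^(-n\<^sub>0)\<close> for the weight \<open>r\<close> in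
  \<open>Z\<close>. The lower bound gives contraction; the upper one makes collars of linear volume
  growth have finite total weight.

  New boundary arises in two ways: from hyperplanes, placed by averaging with respect to the mass of
  \<open>U\<close> itself, and from preimages of the common sphere. The latter are images of a
  sphere under a contraction, so counting balls suffices and no smoothness of \<open>T\<close>
  enters.

  The error constant in the iterated inequality has to be uniform in the number of iterates: it
  fixes the thinness threshold, from which follow the net, the common ball, the returned fraction
  \<open>c\<close> and the coefficient \<open>a\<close>; only then is the number of iterates chosen.
  Returned sets are mapped exactly onto the ball from which the process starts, whence full
  branches.\<close>

abbreviation vol :: "'a::euclidean_space set \<Rightarrow> ennreal" where
  "vol \<equiv> emeasure lborel"

abbreviation csum :: "('b \<Rightarrow> ennreal) \<Rightarrow> 'b set \<Rightarrow> ennreal" where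
  "csum f F \<equiv> nn_integral (count_space F) f"

lemma vimage_Int_in_borel:
  assumes "continuous_on S f" "S \<in> sets borel" "A \<in> sets borel"
  shows "S \<inter> f -` A \<in> sets borel"
proof -
  have "f \<in> measurable (restrict_space borel S) borel"
    using assms borel_measurable_continuous_on_restrict by auto
  from measurable_sets[OF this assms(3)] show ?thesis
    using assms by (simp add: space_restrict_space sets_restrict_space_iff Int_commute)
qed

lemma measurable_restrict_lborel_self:
  fixes f :: "'a::euclidean_space \<Rightarrow> 'a"
  assumes "continuous_on S f"
  shows "f \<in> measurable (restrict_space lborel S) (restrict_space lborel (f ` S))"
proof -
  have "f \<in> measurable (restrict_space borel S) borel"
    using assms borel_measurable_continuous_on_restrict by auto
  then have "f \<in> measurable (restrict_space lborel S) lborel"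
    by (simp cong: measurable_cong_sets add: sets_restrict_space)
  then show ?thesis
    by (intro measurable_restrict_space2) (auto simp: space_restrict_space)
qed

lemma sets_restrict_lborel_iff:
  "S \<in> sets borel \<Longrightarrow> A \<in> sets (restrict_space lborel S) \<longleftrightarrow> A \<in> sets borel \<and> A \<subseteq> S"
  by (auto simp: sets_restrict_space_iff)

lemma emeasure_pushforward:
  fixes f :: "'a::euclidean_space \<Rightarrow> 'a"
  assumes "continuous_on S f" "S \<in> sets borel" "f ` S \<in> sets borel" "A \<in> sets borel" "A \<subseteq> f ` S"
  shows "emeasure (pushforward f S) A = vol (S \<inter> f -` A)"
proof -
  have "emeasure (pushforward f S) A = emeasure (restrict_space lborel S) (f -` A \<inter> S)"
    unfolding pushforward_def using assms
    by (subst emeasure_distr)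
      (auto intro: measurable_restrict_lborel_self simp: sets_restrict_lborel_iff space_restrict_space)
  also have "\<dots> = vol (S \<inter> f -` A)"
    using assms by (subst emeasure_restrict_space) (auto simp: Int_commute)
  finally show ?thesis .
qed

lemma sets_pushforward [simp]: "sets (pushforward f S) = sets (restrict_space lborel (f ` S))"
  by (simp add: pushforward_def)

text \<open>The two absolute continuities together say that both measures have the same null sets.
  Spelled out on Borel subsets of the image, this removes restricted spaces from all later
  arguments.\<close>

lemma nonsingular_homeo_on_iff:
  fixes f :: "'a::euclidean_space \<Rightarrow> 'a"
  assumes S: "S \<in> sets borel" "f ` S \<in> sets borel"
  shows "nonsingular_homeo_on f S \<longleftrightarrow> (\<exists>g. homeomorphism S (f ` S) f g) \<and>
    (\<forall>A\<in>sets borel. A \<subseteq> f ` S \<longrightarrow> (vol A = 0 \<longleftrightarrow> vol (S \<inter> f -` A) = 0))"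
proof (cases "\<exists>g. homeomorphism S (f ` S) f g")
  case True
  then have c: "continuous_on S f" by (auto simp: homeomorphism_def)
  have 1: "A \<in> null_sets (pushforward f S) \<longleftrightarrow> A \<in> sets borel \<and> A \<subseteq> f ` S \<and> vol (S \<inter> f -` A) = 0" for A
    using emeasure_pushforward[OF c S] S by (auto simp: null_sets_def sets_restrict_lborel_iff)
  have 2: "A \<in> null_sets (restrict_space lborel (f ` S)) \<longleftrightarrow> A \<in> sets borel \<and> A \<subseteq> f ` S \<and> vol A = 0" for A
    using S by (auto simp: null_sets_def sets_restrict_lborel_iff emeasure_restrict_space)
  have "absolutely_continuous (pushforward f S) (restrict_space lborel (f ` S)) \<and>
      absolutely_continuous (restrict_space lborel (f ` S)) (pushforward f S) \<longleftrightarrow>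
      (\<forall>A. A \<in> null_sets (pushforward f S) \<longleftrightarrow> A \<in> null_sets (restrict_space lborel (f ` S)))"
    unfolding absolutely_continuous_def by blast
  also have "\<dots> \<longleftrightarrow> (\<forall>A\<in>sets borel. A \<subseteq> f ` S \<longrightarrow> (vol A = 0 \<longleftrightarrow> vol (S \<inter> f -` A) = 0))"
    unfolding 1 2 by meson
  finally show ?thesis
    using True by (simp add: nonsingular_homeo_on_def)
next
  case False
  then show ?thesis by (auto simp: nonsingular_homeo_on_def)
qed

lemma is_jacobian_iff:
  fixes f :: "'a::euclidean_space \<Rightarrow> 'a"
  assumes S: "S \<in> sets borel" "f ` S \<in> sets borel" and c: "continuous_on S f"
  shows "is_jacobian f S J \<longleftrightarrow>
    J \<in> borel_measurable (restrict_space borel (f ` S)) \<and> (\<forall>x\<in>f ` S. 0 \<le> J x) \<and>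
    (\<forall>A\<in>sets borel. A \<subseteq> f ` S \<longrightarrow>
       (\<integral>\<^sup>+x. ennreal (J x) * indicator A x \<partial>lborel) = vol (S \<inter> f -` A))"
proof -
  have m: "borel_measurable (restrict_space lborel (f ` S)) = (borel_measurable (restrict_space borel (f ` S)) :: ('a \<Rightarrow> real) set)"
    by (intro measurable_cong_sets) (auto simp: sets_restrict_space)
  show ?thesis
  proof (cases "J \<in> borel_measurable (restrict_space borel (f ` S))")
    case True
    then have JM: "J \<in> borel_measurable (restrict_space lborel (f ` S))" by (simp add: m)
    have *: "emeasure (density (restrict_space lborel (f ` S)) (\<lambda>x. ennreal (J x))) A =
        (\<integral>\<^sup>+x. ennreal (J x) * indicator A x \<partial>lborel)" if "A \<in> sets borel" "A \<subseteq> f ` S" for A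
    proof -
      have "emeasure (density (restrict_space lborel (f ` S)) (\<lambda>x. ennreal (J x))) A =
        (\<integral>\<^sup>+x. ennreal (J x) * indicator A x \<partial>(restrict_space lborel (f ` S)))"
        using that S JM by (intro emeasure_density) (auto simp: sets_restrict_lborel_iff)
      also have "\<dots> = (\<integral>\<^sup>+x. ennreal (J x) * indicator A x * indicator (f ` S) x \<partial>lborel)"
        using S by (intro nn_integral_restrict_space) auto
      also have "\<dots> = (\<integral>\<^sup>+x. ennreal (J x) * indicator A x \<partial>lborel)"
        using that by (intro nn_integral_cong) (auto simp: indicator_def)
      finally show ?thesis .
    qed
    have "density (restrict_space lborel (f ` S)) (\<lambda>x. ennreal (J x)) = pushforward f S \<longleftrightarrow>
      (\<forall>A\<in>sets borel. A \<subseteq> f ` S \<longrightarrow>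
       (\<integral>\<^sup>+x. ennreal (J x) * indicator A x \<partial>lborel) = vol (S \<inter> f -` A))" (is "?l \<longleftrightarrow> ?r")
    proof
      assume ?l
      then show ?r using * emeasure_pushforward[OF c S] by simp
    next
      assume ?r
      then show ?l
        using S * emeasure_pushforward[OF c S]
        by (intro measure_eqI) (auto simp: sets_restrict_lborel_iff)
    qed
    then show ?thesis using True by (simp add: is_jacobian_def m)
  next
    case False
    then show ?thesis by (simp add: is_jacobian_def m)
  qed
qed

text \<open>Change of variables: the image measure under \<open>f\<close> is also the measure with
  density \<open>J\<close>, and both integrals equal the integral of \<open>u \<circ> g\<close>
  against it.\<close>

lemma is_jacobian_nn_integral:
  fixes f :: "'a::euclidean_space \<Rightarrow> 'a"
  assumes S: "S \<in> sets borel" "f ` S \<in> sets borel" and h: "homeomorphism S (f ` S) f g"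
    and J: "is_jacobian f S J" and u: "u \<in> borel_measurable (restrict_space borel S)"
  shows "(\<integral>\<^sup>+x. u x * indicator S x \<partial>lborel) = (\<integral>\<^sup>+y. ennreal (J y) * u (g y) * indicator (f ` S) y \<partial>lborel)"
proof -
  have c: "continuous_on S f" "continuous_on (f ` S) g" and gf: "\<And>x. x \<in> S \<Longrightarrow> g (f x) = x"
    and fg: "\<And>x. x \<in> S \<Longrightarrow> g (f x) \<in> S"
    using h by (auto simp: homeomorphism_def)
  have eqb: "measurable (restrict_space lborel B) N = measurable (restrict_space borel B) N" for B :: "'a set" and N :: "'c measure"
    by (intro measurable_cong_sets) (auto simp: sets_restrict_space)
  have g: "g \<in> measurable (restrict_space borel (f ` S)) (restrict_space borel S)"
    using borel_measurable_continuous_on_restrict[OF c(2)] fg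
    by (intro measurable_restrict_space2) (auto simp: space_restrict_space)
  have ug: "(\<lambda>y. u (g y)) \<in> borel_measurable (restrict_space lborel (f ` S))"
    unfolding eqb using measurable_compose[OF g u] .
  have JM: "J \<in> borel_measurable (restrict_space lborel (f ` S))" using J by (simp add: is_jacobian_def)
  have "(\<integral>\<^sup>+x. u x * indicator S x \<partial>lborel) = (\<integral>\<^sup>+x. u x \<partial>restrict_space lborel S)"
    using S by (simp add: nn_integral_restrict_space)
  also have "\<dots> = (\<integral>\<^sup>+x. u (g (f x)) \<partial>restrict_space lborel S)"
    by (intro nn_integral_cong) (simp add: gf space_restrict_space)
  also have "\<dots> = (\<integral>\<^sup>+y. u (g y) \<partial>pushforward f S)"
    unfolding pushforward_def using ug
    by (subst nn_integral_distr) (auto intro: measurable_restrict_lborel_self[OF c(1)])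
  also have "\<dots> = (\<integral>\<^sup>+y. u (g y) \<partial>density (restrict_space lborel (f ` S)) (\<lambda>x. ennreal (J x)))"
    using J by (simp add: is_jacobian_def)
  also have "\<dots> = (\<integral>\<^sup>+y. ennreal (J y) * u (g y) \<partial>restrict_space lborel (f ` S))"
    using JM ug by (intro nn_integral_density) auto
  also have "\<dots> = (\<integral>\<^sup>+y. ennreal (J y) * u (g y) * indicator (f ` S) y \<partial>lborel)"
    using S by (simp add: nn_integral_restrict_space)
  finally show ?thesis .
qed

lemma is_jacobian_subset:
  fixes f :: "'a::euclidean_space \<Rightarrow> 'a"
  assumes S: "S \<in> sets borel" "f ` S \<in> sets borel" "V \<in> sets borel" "f ` V \<in> sets borel" "V \<subseteq> S"
    and h: "continuous_on S f" "inj_on f S"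
    and J: "is_jacobian f S J"
  shows "is_jacobian f V J"
proof -
  have cV: "continuous_on V f" using h(1) S(5) continuous_on_subset by blast
  have sub: "f ` V \<subseteq> f ` S" using S(5) by auto
  note JJ = J[unfolded is_jacobian_iff[OF S(1,2) h(1)]]
  have "J \<in> borel_measurable (restrict_space borel (f ` V))"
    using JJ measurable_restrict_mono[OF _ sub] by blast
  moreover have eq: "V \<inter> f -` A = S \<inter> f -` A" if "A \<subseteq> f ` V" for A
    using that inj_on_image_mem_iff[OF h(2) _ S(5)] S(5) by blast
  moreover have "A \<subseteq> f ` S" if "A \<subseteq> f ` V" for A
    using that sub by blast
  ultimately show ?thesis
    using JJ sub unfolding is_jacobian_iff[OF S(3,4) cV] by (auto simp: S(5)[THEN subsetD])
qed

lemma is_jacobian_compose: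
  fixes f :: "'a::euclidean_space \<Rightarrow> 'a"
  assumes S: "S \<in> sets borel" "f ` S \<in> sets borel" "g ` f ` S \<in> sets borel"
    and hf: "homeomorphism S (f ` S) f f'" and hg: "homeomorphism (f ` S) (g ` f ` S) g g'"
    and J1: "is_jacobian f S J1" and J2: "is_jacobian g (f ` S) J2"
  shows "is_jacobian (g \<circ> f) S (\<lambda>y. J2 y * J1 (g' y))"
proof -
  have cf: "continuous_on S f" and cg: "continuous_on (f ` S) g" and cg': "continuous_on (g ` f ` S) g'"
    and gg: "\<And>x. x \<in> S \<Longrightarrow> g' (g (f x)) = f x"
    using hf hg by (auto simp: homeomorphism_def)
  have cgf: "continuous_on S (g \<circ> f)" using cf cg by (rule continuous_on_compose)
  note JJ1 = J1[unfolded is_jacobian_iff[OF S(1,2) cf]]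
  note JJ2 = J2[unfolded is_jacobian_iff[OF S(2,3) cg]]
  have im: "(g \<circ> f) ` S = g ` f ` S" by auto
  have g'm: "g' \<in> measurable (restrict_space borel (g ` f ` S)) (restrict_space borel (f ` S))"
    using borel_measurable_continuous_on_restrict[OF cg'] gg
    by (intro measurable_restrict_space2) (auto simp: space_restrict_space)
  have m: "(\<lambda>y. J2 y * J1 (g' y)) \<in> borel_measurable (restrict_space borel (g ` f ` S))"
    using JJ2 measurable_compose[OF g'm] JJ1 by (intro borel_measurable_times) auto
  have nn: "\<forall>x\<in>g ` f ` S. 0 \<le> J2 x * J1 (g' x)"
    using JJ1 JJ2 gg by (auto intro!: mult_nonneg_nonneg)
  have "(\<integral>\<^sup>+x. ennreal (J2 x * J1 (g' x)) * indicator A x \<partial>lborel) = vol (S \<inter> (g \<circ> f) -` A)"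
    if A: "A \<in> sets borel" "A \<subseteq> g ` f ` S" for A
  proof -
    let ?B = "f ` S \<inter> g -` A"
    have B: "?B \<in> sets borel" using vimage_Int_in_borel[OF cg S(2) A(1)] .
    have "S \<inter> (g \<circ> f) -` A = S \<inter> f -` ?B" by auto
    then have "vol (S \<inter> (g \<circ> f) -` A) = (\<integral>\<^sup>+x. ennreal (J1 x) * indicator ?B x \<partial>lborel)"
      using JJ1 B by auto
    also have "\<dots> = (\<integral>\<^sup>+x. (ennreal (J1 x) * indicator ?B x) * indicator (f ` S) x \<partial>lborel)"
      by (intro nn_integral_cong) (auto simp: indicator_def)
    also have "\<dots> = (\<integral>\<^sup>+y. ennreal (J2 y) * (ennreal (J1 (g' y)) * indicator ?B (g' y)) * indicator (g ` f ` S) y \<partial>lborel)"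
    proof (rule is_jacobian_nn_integral[OF S(2,3) hg J2])
      have "indicator ?B \<in> borel_measurable (restrict_space borel (f ` S))"
        using B by (intro borel_measurable_indicator) (auto simp: sets_restrict_space_iff S)
      then show "(\<lambda>x. ennreal (J1 x) * indicator ?B x) \<in> borel_measurable (restrict_space borel (f ` S))"
        using JJ1 by (intro borel_measurable_times_ennreal) auto
    qed
    also have "\<dots> = (\<integral>\<^sup>+x. ennreal (J2 x * J1 (g' x)) * indicator A x \<partial>lborel)"
    proof (intro nn_integral_cong)
      fix y
      show "ennreal (J2 y) * (ennreal (J1 (g' y)) * indicator ?B (g' y)) * indicator (g ` f ` S) y
        = ennreal (J2 y * J1 (g' y)) * indicator A y"
      proof (cases "y \<in> g ` f ` S")
        case True
        then obtain x where "x \<in> S" "y = g (f x)" by auto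
        then show ?thesis using gg JJ1 JJ2 by (auto simp: indicator_def ennreal_mult)
      qed (use A in \<open>auto simp: indicator_def\<close>)
    qed
    finally show ?thesis by simp
  qed
  then show ?thesis
    unfolding is_jacobian_iff[OF S(1) _ cgf, unfolded im, OF S(3)] using m nn by auto
qed

lemma is_jacobian_id:
  fixes S :: "'a::euclidean_space set"
  assumes "S \<in> sets borel"
  shows "is_jacobian (\<lambda>x. x) S (\<lambda>_. 1)"
proof -
  have "S \<inter> (\<lambda>x. x) -` A = A" if "A \<subseteq> S" for A using that by auto
  then show ?thesis using assms is_jacobian_iff[of S "\<lambda>x. x" "\<lambda>_. 1"] by simp
qed

lemma nonsingular_homeo_on_compose:
  fixes f :: "'a::euclidean_space \<Rightarrow> 'a"
  assumes S: "S \<in> sets borel" "f ` S \<in> sets borel" "g ` f ` S \<in> sets borel"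
    and f: "nonsingular_homeo_on f S" and g: "nonsingular_homeo_on g (f ` S)"
  shows "nonsingular_homeo_on (g \<circ> f) S"
proof -
  obtain f' where hf: "homeomorphism S (f ` S) f f'" using f by (auto simp: nonsingular_homeo_on_def)
  obtain g' where hg: "homeomorphism (f ` S) (g ` f ` S) g g'" using g by (auto simp: nonsingular_homeo_on_def)
  have cg: "continuous_on (f ` S) g" using hg by (auto simp: homeomorphism_def)
  have im: "(g \<circ> f) ` S = g ` f ` S" by auto
  note F = f[unfolded nonsingular_homeo_on_iff[OF S(1,2)]]
  note G = g[unfolded nonsingular_homeo_on_iff[OF S(2,3)]]
  have "vol A = 0 \<longleftrightarrow> vol (S \<inter> (g \<circ> f) -` A) = 0"
    if A: "A \<in> sets borel" "A \<subseteq> g ` f ` S" for A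
  proof -
    have e: "S \<inter> (g \<circ> f) -` A = S \<inter> f -` (f ` S \<inter> g -` A)" by auto
    show ?thesis unfolding e using F G A vimage_Int_in_borel[OF cg S(2) A(1)] by (metis Int_lower1)
  qed
  then show ?thesis
    using homeomorphism_compose[OF hf hg]
    unfolding nonsingular_homeo_on_iff[of S "g \<circ> f", unfolded im, OF S(1,3)] by blast
qed

lemma nonsingular_homeo_on_subset:
  fixes f :: "'a::euclidean_space \<Rightarrow> 'a"
  assumes S: "S \<in> sets borel" "f ` S \<in> sets borel" "V \<in> sets borel" "f ` V \<in> sets borel" "V \<subseteq> S"
    and f: "nonsingular_homeo_on f S"
  shows "nonsingular_homeo_on f V"
proof -
  obtain f' where hf: "homeomorphism S (f ` S) f f'" using f by (auto simp: nonsingular_homeo_on_def)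
  have sub: "f ` V \<subseteq> f ` S" using S(5) by auto
  have hV: "homeomorphism V (f ` V) f f'" using homeomorphism_of_subsets[OF hf S(5) subset_refl refl] .
  have "inj_on f S" using hf by (metis homeomorphism_def inj_onI)
  then have eq: "V \<inter> f -` A = S \<inter> f -` A" if "A \<subseteq> f ` V" for A
    using that inj_on_image_mem_iff[OF _ _ S(5)] S(5) by blast
  moreover have "A \<subseteq> f ` S" if "A \<subseteq> f ` V" for A
    using that sub by blast
  ultimately show ?thesis
    using f[unfolded nonsingular_homeo_on_iff[OF S(1,2)]] hV
    unfolding nonsingular_homeo_on_iff[OF S(3,4)] by auto
qed

section \<open>Branches of iterates\<close>

locale piecewise_expanding =
  fixes X :: "'a::euclidean_space set" and T :: "'a \<Rightarrow> 'a" and P :: "'a set set"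
    and \<epsilon>\<^sub>1 \<Lambda> \<alpha> D :: real
  assumes open_X: "open X" and bounded_X: "bounded X"
    and invertible: "piecewise_invertible X T P"
    and expansion: "uniform_expansion T P \<epsilon>\<^sub>1 \<Lambda>"
    and distortion: "bounded_distortion T P \<alpha> D"
begin

lemma constants: "0 < \<epsilon>\<^sub>1" "0 < \<Lambda>" "\<Lambda> < 1" "0 < \<alpha>" "\<alpha> \<le> 1" "0 \<le> D"
  using expansion distortion by (auto simp: uniform_expansion_def bounded_distortion_def)

lemma partition_P: "open_partition X P"
  using invertible by (simp add: piecewise_invertible_def)

lemma branch:
  assumes "B \<in> P"
  shows "open B" "B \<subseteq> X" "T ` B \<subseteq> X" "nonsingular_homeo_on T B"
  using assms invertible by (auto simp: piecewise_invertible_def open_partition_def)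

text \<open>Any open subset of the domain of a branch qualifies, not just the full domain, because
  domains are later cut by hyperplanes and by the removal of returned sets.\<close>

definition cyl :: "nat \<Rightarrow> 'a set \<Rightarrow> bool" where
  "cyl n U \<longleftrightarrow> open U \<and> U \<subseteq> X \<and> (\<forall>i<n. \<exists>B\<in>P. (T ^^ i) ` U \<subseteq> B)"

lemma cyl_0: "open U \<Longrightarrow> U \<subseteq> X \<Longrightarrow> cyl 0 U"
  by (simp add: cyl_def)

lemma cyl_open: "cyl n U \<Longrightarrow> open U"
  by (simp add: cyl_def)

lemma cyl_X: "cyl n U \<Longrightarrow> U \<subseteq> X"
  by (simp add: cyl_def)

lemma cyl_subset: "cyl n U \<Longrightarrow> open V \<Longrightarrow> V \<subseteq> U \<Longrightarrow> cyl n V"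
  unfolding cyl_def by (meson image_mono order_trans)

lemma cyl_Suc: "cyl (Suc n) U \<longleftrightarrow> cyl n U \<and> (\<exists>B\<in>P. (T ^^ n) ` U \<subseteq> B)"
  by (auto simp: cyl_def less_Suc_eq)

lemma homeomorphism_on_imp:
  fixes f :: "'a \<Rightarrow> 'a"
  assumes "nonsingular_homeo_on f S" "open S"
  shows "continuous_on S f" "inj_on f S" "open (f ` S)" "\<exists>g. homeomorphism S (f ` S) f g"
proof -
  show 1: "\<exists>g. homeomorphism S (f ` S) f g" using assms by (auto simp: nonsingular_homeo_on_def)
  then show c: "continuous_on S f" by (auto simp: homeomorphism_def)
  from 1 show i: "inj_on f S" by (metis homeomorphism_def inj_onI)
  show "open (f ` S)" using invariance_of_domain[OF c assms(2) i] .
qed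

text \<open>The sum of the geometric series \<open>D * (\<Lambda> powr \<alpha>)^i\<close>: going
  back \<open>i\<close> steps shrinks distances by \<open>\<Lambda>^i\<close>.\<close>

definition Dinf :: real where "Dinf = D / (1 - \<Lambda> powr \<alpha>)"

lemma Lam_powr: "\<Lambda> powr \<alpha> < 1"
  using constants powr_less_mono2[of \<alpha> \<Lambda> 1] by simp

lemma D_inf: "0 \<le> Dinf" "D + Dinf * \<Lambda> powr \<alpha> = Dinf"
  using constants Lam_powr by (auto simp: Dinf_def field_simps)

lemma branch_contraction:
  assumes "B \<in> P" "x \<in> B" "y \<in> B" "dist (T x) (T y) \<le> \<epsilon>\<^sub>1"
  shows "dist x y \<le> \<Lambda> * dist (T x) (T y)"
proof -
  have "inj_on T B" using homeomorphism_on_imp branch assms by blast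
  then show ?thesis
    using expansion assms unfolding uniform_expansion_def by (metis image_eqI inv_into_f_f)
qed

text \<open>One induction for all four facts, as each step needs the others: contraction keeps the
  intermediate distances below \<open>\<epsilon>\<^sub>1\<close>, and their geometric decay keeps
  the accumulated distortion below \<open>Dinf\<close>.\<close>

lemma cyl_jacobian_aux:
  assumes "cyl n U"
  shows "nonsingular_homeo_on (T ^^ n) U \<and> (T ^^ n) ` U \<subseteq> X \<and>
    (\<forall>x\<in>U. \<forall>y\<in>U. dist ((T ^^ n) x) ((T ^^ n) y) \<le> \<epsilon>\<^sub>1 \<longrightarrow>
        dist x y \<le> \<Lambda> ^ n * dist ((T ^^ n) x) ((T ^^ n) y)) \<and>
    (\<exists>J. is_jacobian (T ^^ n) U J \<and> (\<forall>x\<in>(T ^^ n) ` U. \<forall>y\<in>(T ^^ n) ` U.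
        dist x y \<le> \<epsilon>\<^sub>1 \<longrightarrow> J x \<le> exp (Dinf * dist x y powr \<alpha>) * J y))"
  using assms
proof (induction n)
  case 0
  have o: "open U" "U \<subseteq> X" using 0 by (auto simp: cyl_def)
  have h: "homeomorphism U U (\<lambda>x. x) (\<lambda>x. x)" by (simp add: homeomorphism_def)
  have "nonsingular_homeo_on (\<lambda>x. x) U"
    unfolding nonsingular_homeo_on_iff[of U "\<lambda>x. x", unfolded image_ident, OF borel_open[OF o(1)] borel_open[OF o(1)]]
  proof (intro conjI ballI impI)
    show "\<exists>g. homeomorphism U U (\<lambda>x. x) g" by (intro exI[of _ "\<lambda>x. x"] h)
  qed (simp add: inf.absorb2)
  moreover have "is_jacobian (\<lambda>x. x) U (\<lambda>_. 1)"
    using is_jacobian_id[of U] o by simp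
  moreover have "1 \<le> exp (Dinf * dist x y powr \<alpha>) * 1" for x y :: 'a
    using D_inf by simp
  ultimately show ?case using o by (auto simp: id_def)
next
  case (Suc n)
  then obtain B where B: "B \<in> P" "(T ^^ n) ` U \<subseteq> B" and c: "cyl n U" by (auto simp: cyl_Suc)
  let ?W = "(T ^^ n) ` U"
  from Suc.IH[OF c] obtain J where
    nU: "nonsingular_homeo_on (T ^^ n) U" and
    dU: "\<And>x y. x \<in> U \<Longrightarrow> y \<in> U \<Longrightarrow> dist ((T ^^ n) x) ((T ^^ n) y) \<le> \<epsilon>\<^sub>1 \<Longrightarrow>
        dist x y \<le> \<Lambda> ^ n * dist ((T ^^ n) x) ((T ^^ n) y)" and
    J: "is_jacobian (T ^^ n) U J" "\<And>x y. x \<in> ?W \<Longrightarrow> y \<in> ?W \<Longrightarrow> dist x y \<le> \<epsilon>\<^sub>1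
        \<Longrightarrow> J x \<le> exp (Dinf * dist x y powr \<alpha>) * J y"
    by (elim conjE exE) (simp only: Ball_def)
  have oU: "open U" using c by (simp add: cyl_def)
  note hU = homeomorphism_on_imp[OF nU oU]
  have oB: "open B" and nB: "nonsingular_homeo_on T B" and TB: "T ` B \<subseteq> X" using branch[OF B(1)] by auto
  note hB = homeomorphism_on_imp[OF nB oB]
  have oTW: "open (T ` ?W)"
    using invariance_of_domain[of ?W T] hU hB B(2) by (metis continuous_on_subset inj_on_subset)
  have nW: "nonsingular_homeo_on T ?W"
    using nonsingular_homeo_on_subset[of B T ?W] oB hB(3) hU(3) oTW B(2) nB by auto
  note hW = homeomorphism_on_imp[OF nW hU(3)]
  obtain J\<^sub>B where JB: "is_jacobian T B J\<^sub>B"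
    "\<And>x y. x \<in> T ` B \<Longrightarrow> y \<in> T ` B \<Longrightarrow> J\<^sub>B x \<le> exp (D * dist x y powr \<alpha>) * J\<^sub>B y"
    using distortion B(1) unfolding bounded_distortion_def by meson
  have JW: "is_jacobian T ?W J\<^sub>B"
    using is_jacobian_subset[of B T ?W J\<^sub>B] oB hB hU(3) oTW B(2) JB by auto
  obtain f' where f': "homeomorphism U ?W (T ^^ n) f'" using hU by auto
  obtain g where g: "homeomorphism ?W (T ` ?W) T g" using hW by auto
  have eq: "T ^^ Suc n = T \<circ> T ^^ n" by simp
  have im: "(T ^^ Suc n) ` U = T ` ?W" by auto
  have g1: "g z \<in> ?W" "T (g z) = z" if "z \<in> T ` ?W" for z
    using g that unfolding homeomorphism_def by blast+
  have R1: "nonsingular_homeo_on (T ^^ Suc n) U"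
    unfolding eq using nonsingular_homeo_on_compose[of U "T ^^ n" T] oU hU(3) oTW nU nW by auto
  have R2: "(T ^^ Suc n) ` U \<subseteq> X" using TB B(2) by auto
  have R3: "dist x y \<le> \<Lambda> ^ Suc n * dist ((T ^^ Suc n) x) ((T ^^ Suc n) y)"
    if xy: "x \<in> U" "y \<in> U" "dist ((T ^^ Suc n) x) ((T ^^ Suc n) y) \<le> \<epsilon>\<^sub>1" for x y
  proof -
    let ?d = "dist ((T ^^ Suc n) x) ((T ^^ Suc n) y)"
    have 1: "dist ((T ^^ n) x) ((T ^^ n) y) \<le> \<Lambda> * ?d"
      using branch_contraction[OF B(1), of "(T ^^ n) x" "(T ^^ n) y"] xy B(2) by auto
    \<comment> \<open>The intermediate distance is again at most \<open>\<epsilon>\<^sub>1\<close>,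
      which is what the induction hypothesis for contraction asks for.\<close>
    also have "\<dots> \<le> ?d" using constants by (simp add: mult_left_le_one_le)
    finally have "dist x y \<le> \<Lambda> ^ n * dist ((T ^^ n) x) ((T ^^ n) y)"
      using dU[of x y] xy by linarith
    also have "\<dots> \<le> \<Lambda> ^ n * (\<Lambda> * ?d)"
      using 1 constants by (intro mult_left_mono) auto
    finally show ?thesis by (simp add: ac_simps)
  qed
  have R4: "is_jacobian (T ^^ Suc n) U (\<lambda>y. J\<^sub>B y * J (g y))"
    unfolding eq using oU hU(3) oTW by (intro is_jacobian_compose[OF _ _ _ f' g J(1) JW]) auto
  have R5: "J\<^sub>B x * J (g x) \<le> exp (Dinf * dist x y powr \<alpha>) * (J\<^sub>B y * J (g y))"
    if xy: "x \<in> T ` ?W" "y \<in> T ` ?W" "dist x y \<le> \<epsilon>\<^sub>1" for x y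
  proof -
    have nn: "0 \<le> J (g y)" "0 \<le> J (g x)" "0 \<le> J\<^sub>B x" "0 \<le> J\<^sub>B y"
      using J(1) JW g1(1)[OF xy(1)] g1(1)[OF xy(2)] xy unfolding is_jacobian_def by blast+
    have d: "dist (g x) (g y) \<le> \<Lambda> * dist x y"
      using branch_contraction[OF B(1), of "g x" "g y"] g1 xy B(2) by auto
    also have "\<dots> \<le> dist x y" using constants by (simp add: mult_left_le_one_le)
    finally have d1: "dist (g x) (g y) \<le> \<epsilon>\<^sub>1" using xy by linarith
    have "dist (g x) (g y) powr \<alpha> \<le> (\<Lambda> * dist x y) powr \<alpha>"
      using d constants by (intro powr_mono2) auto
    also have "\<dots> = \<Lambda> powr \<alpha> * dist x y powr \<alpha>" using constants by (simp add: powr_mult)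
    finally have p: "Dinf * dist (g x) (g y) powr \<alpha> \<le> Dinf * (\<Lambda> powr \<alpha> * dist x y powr \<alpha>)"
      using D_inf by (intro mult_left_mono) auto
    have "J\<^sub>B x * J (g x) \<le> (exp (D * dist x y powr \<alpha>) * J\<^sub>B y) * (exp (Dinf * dist (g x) (g y) powr \<alpha>) * J (g y))"
    proof (intro mult_mono)
      have TBsub: "T ` ?W \<subseteq> T ` B" using B(2) by (rule image_mono)
      show "J\<^sub>B x \<le> exp (D * dist x y powr \<alpha>) * J\<^sub>B y" using JB(2) xy TBsub by blast
      show "J (g x) \<le> exp (Dinf * dist (g x) (g y) powr \<alpha>) * J (g y)"
        by (rule J(2)[OF g1(1)[OF xy(1)] g1(1)[OF xy(2)] d1])
    qed (use nn in auto)
    also have "\<dots> = exp (D * dist x y powr \<alpha> + Dinf * dist (g x) (g y) powr \<alpha>) * (J\<^sub>B y * J (g y))"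
      by (simp add: exp_add ac_simps)
    also have "\<dots> \<le> exp (D * dist x y powr \<alpha> + Dinf * (\<Lambda> powr \<alpha> * dist x y powr \<alpha>)) * (J\<^sub>B y * J (g y))"
      using p nn by (intro mult_right_mono) auto
    \<comment> \<open>The fixed point equation
      \<open>D + Dinf * \<Lambda> powr \<alpha> = Dinf\<close> closes the induction.\<close>
    also have "D * dist x y powr \<alpha> + Dinf * (\<Lambda> powr \<alpha> * dist x y powr \<alpha>) = (D + Dinf * \<Lambda> powr \<alpha>) * dist x y powr \<alpha>"
      by (simp add: algebra_simps)
    finally show ?thesis unfolding D_inf(2) .
  qed
  show ?case
    using R1 R2 R3 R4 R5[folded im] by (intro conjI ballI impI exI[of _ "\<lambda>y. J\<^sub>B y * J (g y)"])
qed

lemma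
  assumes "cyl n U"
  shows cyl_nonsingular: "nonsingular_homeo_on (T ^^ n) U"
    and cyl_image_X: "(T ^^ n) ` U \<subseteq> X"
    and cyl_contraction: "\<And>x y. x \<in> U \<Longrightarrow> y \<in> U \<Longrightarrow> dist ((T ^^ n) x) ((T ^^ n) y) \<le> \<epsilon>\<^sub>1 \<Longrightarrow>
        dist x y \<le> \<Lambda> ^ n * dist ((T ^^ n) x) ((T ^^ n) y)"
    and cyl_jacobian: "\<exists>J. is_jacobian (T ^^ n) U J \<and> (\<forall>x\<in>(T ^^ n) ` U. \<forall>y\<in>(T ^^ n) ` U.
        dist x y \<le> \<epsilon>\<^sub>1 \<longrightarrow> J x \<le> exp (Dinf * dist x y powr \<alpha>) * J y)"
    and cyl_continuous: "continuous_on U (T ^^ n)"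
    and cyl_inj: "inj_on (T ^^ n) U"
    and cyl_open_image: "open ((T ^^ n) ` U)"
proof -
  note * = cyl_jacobian_aux[OF assms]
  show ns: "nonsingular_homeo_on (T ^^ n) U" using * by (rule conjunct1)
  show "(T ^^ n) ` U \<subseteq> X" using * by (elim conjE)
  show "dist x y \<le> \<Lambda> ^ n * dist ((T ^^ n) x) ((T ^^ n) y)"
    if "x \<in> U" "y \<in> U" "dist ((T ^^ n) x) ((T ^^ n) y) \<le> \<epsilon>\<^sub>1" for x y
    using *[THEN conjunct2, THEN conjunct2, THEN conjunct1] that by blast
  show "\<exists>J. is_jacobian (T ^^ n) U J \<and> (\<forall>x\<in>(T ^^ n) ` U. \<forall>y\<in>(T ^^ n) ` U.
        dist x y \<le> \<epsilon>\<^sub>1 \<longrightarrow> J x \<le> exp (Dinf * dist x y powr \<alpha>) * J y)"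
    using * by (elim conjE)
  show "continuous_on U (T ^^ n)" "inj_on (T ^^ n) U" "open ((T ^^ n) ` U)"
    using homeomorphism_on_imp(1-3)[OF ns cyl_open[OF assms]] .
qed

lemma cyl_add:
  assumes "cyl m U" "cyl n ((T ^^ m) ` U)"
  shows "cyl (m + n) U"
  unfolding cyl_def
proof (intro conjI allI impI)
  fix i assume i: "i < m + n"
  show "\<exists>B\<in>P. (T ^^ i) ` U \<subseteq> B"
  proof (cases "i < m")
    case False
    then have "(T ^^ i) ` U = (T ^^ (i - m)) ` (T ^^ m) ` U"
      using funpow_add[of "i - m" m T] by (simp add: image_comp)
    then show ?thesis using assms(2) i False unfolding cyl_def by (metis add.commute less_diff_conv2 not_less)
  qed (use assms in \<open>auto simp: cyl_def\<close>)
qed (use assms in \<open>auto simp: cyl_def\<close>)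

section \<open>Pulling sets back along branches\<close>

lemma pull_open: "cyl n U \<Longrightarrow> open A \<Longrightarrow> open (U \<inter> (T ^^ n) -` A)"
  by (rule continuous_open_preimage[OF cyl_continuous cyl_open])

lemma pull_borel: "cyl n U \<Longrightarrow> A \<in> sets borel \<Longrightarrow> U \<inter> (T ^^ n) -` A \<in> sets borel"
  by (rule vimage_Int_in_borel[OF cyl_continuous borel_open[OF cyl_open]])

lemma pull_image: "A \<subseteq> (T ^^ n) ` U \<Longrightarrow> (T ^^ n) ` (U \<inter> (T ^^ n) -` A) = A"
  by blast

lemma pull_null:
  assumes "cyl n U" "A \<in> sets borel" "vol A = 0"
  shows "vol (U \<inter> (T ^^ n) -` A) = 0"
proof -
  have o: "open U" "open ((T ^^ n) ` U)" using cyl_open cyl_open_image assms by auto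
  have s: "(T ^^ n) ` U \<inter> A \<in> sets borel" using o assms by auto
  have "vol ((T ^^ n) ` U \<inter> A) = 0"
    using assms emeasure_mono[of "(T ^^ n) ` U \<inter> A" A lborel] by auto
  then have "vol (U \<inter> (T ^^ n) -` ((T ^^ n) ` U \<inter> A)) = 0"
    using cyl_nonsingular[OF assms(1), unfolded nonsingular_homeo_on_iff[OF borel_open[OF o(1)] borel_open[OF o(2)]]]
      s Int_lower1 by blast
  also have "U \<inter> (T ^^ n) -` ((T ^^ n) ` U \<inter> A) = U \<inter> (T ^^ n) -` A" by auto
  finally show ?thesis .
qed

text \<open>Integrating \<open>J x \<le> K * J y\<close> over \<open>x\<close> in \<open>A\<close>
  and \<open>y\<close> in \<open>B\<close>. The comparison of the proportions of preimages is
  written with products, so that no volume has to be nonzero or finite.\<close>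

lemma distortion_emeasure:
  assumes c: "cyl n U" and d: "diameter ((T ^^ n) ` U) \<le> \<delta>" "\<delta> \<le> \<epsilon>\<^sub>1"
    and A: "A \<in> sets borel" "A \<subseteq> (T ^^ n) ` U" and B: "B \<in> sets borel" "B \<subseteq> (T ^^ n) ` U"
  shows "vol (U \<inter> (T ^^ n) -` A) * vol B \<le>
    ennreal (exp (Dinf * \<delta> powr \<alpha>)) * vol A * vol (U \<inter> (T ^^ n) -` B)"
proof -
  let ?I = "(T ^^ n) ` U" and ?K = "exp (Dinf * \<delta> powr \<alpha>)"
  obtain J where J: "is_jacobian (T ^^ n) U J" "\<And>x y. x \<in> ?I \<Longrightarrow> y \<in> ?I \<Longrightarrow>
        dist x y \<le> \<epsilon>\<^sub>1 \<Longrightarrow> J x \<le> exp (Dinf * dist x y powr \<alpha>) * J y"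
    using cyl_jacobian[OF c] by blast
  have o: "U \<in> sets borel" "?I \<in> sets borel" using cyl_open cyl_open_image c by auto
  have bI: "bounded ?I" using cyl_image_X[OF c] bounded_X bounded_subset by blast
  note JJ = J(1)[unfolded is_jacobian_iff[OF o cyl_continuous[OF c]]]
  have le: "J x \<le> ?K * J y" if "x \<in> ?I" "y \<in> ?I" for x y
  proof -
    have dd: "dist x y \<le> \<delta>" using diameter_bounded_bound[OF bI that] d by linarith
    have "J x \<le> exp (Dinf * dist x y powr \<alpha>) * J y" using J(2)[OF that] dd d by linarith
    also have "\<dots> \<le> ?K * J y"
      using dd D_inf constants JJ that by (intro mult_right_mono) (auto intro!: mult_left_mono powr_mono2)
    finally show ?thesis .
  qed
  have JB: "(\<lambda>x. ennreal (J x) * indicator C x) \<in> borel_measurable lborel"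
    if "C \<in> sets borel" "C \<subseteq> ?I" for C
  proof -
    have "(\<lambda>x. ennreal (J x) * indicator ?I x) \<in> borel_measurable borel"
      using JJ o borel_measurable_restrict_space_iff_ennreal[of ?I borel "\<lambda>x. ennreal (J x)"] by auto
    then have "(\<lambda>x. ennreal (J x) * indicator ?I x * indicator C x) \<in> borel_measurable lborel"
      using that by auto
    also have "(\<lambda>x. ennreal (J x) * indicator ?I x * indicator C x) = (\<lambda>x. ennreal (J x) * indicator C x)"
      using that by (auto simp: indicator_def fun_eq_iff)
    finally show ?thesis .
  qed
  have eqA: "vol (U \<inter> (T ^^ n) -` A) = (\<integral>\<^sup>+x. ennreal (J x) * indicator A x \<partial>lborel)"
    and eqB: "vol (U \<inter> (T ^^ n) -` B) = (\<integral>\<^sup>+y. ennreal (J y) * indicator B y \<partial>lborel)"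
    using JJ A B by auto
  have "vol (U \<inter> (T ^^ n) -` A) * vol B =
     (\<integral>\<^sup>+x. ennreal (J x) * indicator A x * vol B \<partial>lborel)"
    unfolding eqA using JB[OF A] by (intro nn_integral_multc[symmetric]) auto
  also have "\<dots> \<le> (\<integral>\<^sup>+x. ennreal ?K * vol (U \<inter> (T ^^ n) -` B) * indicator A x \<partial>lborel)"
  proof (intro nn_integral_mono)
    fix x
    show "ennreal (J x) * indicator A x * vol B \<le> ennreal ?K * vol (U \<inter> (T ^^ n) -` B) * indicator A x"
    proof (cases "x \<in> A")
      case True
      have "ennreal (J x) * vol B = (\<integral>\<^sup>+y. ennreal (J x) * indicator B y \<partial>lborel)"
        using B by (subst nn_integral_cmult_indicator) auto
      also have "\<dots> \<le> (\<integral>\<^sup>+y. ennreal ?K * (ennreal (J y) * indicator B y) \<partial>lborel)"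
      proof (intro nn_integral_mono)
        fix y
        show "ennreal (J x) * indicator B y \<le> ennreal ?K * (ennreal (J y) * indicator B y)"
          using le[of x y] True A B JJ
          by (cases "y \<in> B") (auto simp: ennreal_mult[symmetric] subset_iff intro!: ennreal_leI)
      qed
      also have "\<dots> = ennreal ?K * vol (U \<inter> (T ^^ n) -` B)"
        unfolding eqB using JB[OF B] by (intro nn_integral_cmult) auto
      finally show ?thesis using True by simp
    qed simp
  qed
  also have "\<dots> = ennreal ?K * vol A * vol (U \<inter> (T ^^ n) -` B)"
    using A by (subst nn_integral_cmult_indicator) (auto simp: ac_simps)
  finally show ?thesis .
qed

end

section \<open>Measure estimates\<close>

text \<open>Countable additivity of the measure with density \<open>f\<close> with respect to
  counting measure.\<close>

lemma nn_integral_count_space_UN: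
  fixes f :: "'b \<Rightarrow> ennreal"
  assumes "countable F" "disjoint_family_on G F"
  shows "csum f (\<Union>U\<in>F. G U) = (\<integral>\<^sup>+U. csum f (G U) \<partial>count_space F)"
proof -
  let ?M = "density (count_space UNIV) f"
  have *: "emeasure ?M A = csum f A" for A
    by (subst emeasure_density) (auto simp: nn_integral_count_space_indicator)
  show ?thesis
    using emeasure_UN_countable[of F G ?M] assms by (simp add: *)
qed

text \<open>Connects the infinite sum in \<open>complexity\<close> with integrals over counting
  measure, which are used for all families below: partial sums along an enumeration are finite
  subsums.\<close>

lemma nn_integral_count_space_le_infsum:
  fixes f :: "'b \<Rightarrow> ennreal"
  assumes "countable A"
  shows "csum f A \<le> infsum f A"
proof (cases "finite A")
  case True
  then show ?thesis by (simp add: nn_integral_count_space_finite)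
next
  case False
  let ?g = "from_nat_into A"
  have bij: "bij_betw ?g UNIV A" using assms False by (rule bij_betw_from_nat_into)
  have "csum f A = (\<integral>\<^sup>+n. f (?g n) \<partial>count_space UNIV)"
    using nn_integral_bij_count_space[OF bij, of f] by simp
  also have "\<dots> = (\<Sum>n. f (?g n))" by (rule nn_integral_count_space_nat)
  also have "\<dots> \<le> infsum f A"
  proof (rule suminf_le_const)
    fix n
    have "(\<Sum>i<n. f (?g i)) = sum f (?g ` {..<n})"
      using bij by (subst sum.reindex) (auto simp: bij_betw_def inj_on_def)
    also have "\<dots> \<le> infsum f A"
      using bij by (subst nonneg_infsum_complete) (auto simp: bij_betw_def intro!: SUP_upper)
    finally show "(\<Sum>i<n. f (?g i)) \<le> infsum f A" .
  qed simp
  finally show ?thesis .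
qed

text \<open>Averaging over the level \<open>s\<close>. Each point \<open>x\<close> is within
  \<open>e k\<close> of the levels in an interval of length \<open>2 * e k\<close>, so by Fubini the
  integral of the weighted sum is at most \<open>B * vol U\<close>, and the levels cannot all exceed
  the mean. Nothing but measurability of \<open>f\<close> is used; the \<open>+ 1\<close> leaves
  room for a strict inequality.\<close>

lemma ex_level_small_mass:
  fixes f :: "'a::euclidean_space \<Rightarrow> real" and e w :: "nat \<Rightarrow> real"
  assumes f: "f \<in> borel_measurable borel" and U: "U \<in> sets borel" "vol U < \<infinity>"
    and d: "0 < d" and e: "\<And>k. 0 \<le> e k" and B: "0 \<le> B" "(\<Sum>k. ennreal (w k) * ennreal (2 * e k)) \<le> ennreal B"
  shows "\<exists>s\<in>{c..c + d}. (\<Sum>k. ennreal (w k) * vol {x \<in> U. \<bar>f x - s\<bar> < e k})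
    \<le> ennreal ((B + 1) / d) * vol U"
proof (rule ccontr)
  let ?g = "\<lambda>s. \<Sum>k. ennreal (w k) * vol {x \<in> U. \<bar>f x - s\<bar> < e k}"
  let ?A = "\<lambda>k s. {x \<in> U. \<bar>f x - s\<bar> < e k}"
  assume "\<not> ?thesis"
  then have gt: "\<And>s. s \<in> {c..c + d} \<Longrightarrow> ennreal ((B + 1) / d) * vol U < ?g s" by (auto simp: not_le)
  note [measurable] = f U(1)
  have sA: "?A k s \<in> sets borel" for k s by measurable
  \<comment> \<open>If \<open>U\<close> is null then every level is good, against the
    assumption.\<close>
  have pos: "0 < vol U"
  proof (rule ccontr)
    assume "\<not> ?thesis"
    then have z: "vol U = 0" by (simp add: not_less)
    have "vol (?A k c) \<le> 0" for k
      unfolding z[symmetric] using U by (intro emeasure_mono) auto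
    then have "?g c = 0" by simp
    then show False using gt[of c] d by simp
  qed
  have mA: "(\<lambda>s. vol (?A k s)) \<in> borel_measurable borel" for k
  proof -
    have "{p \<in> space (borel \<Otimes>\<^sub>M lborel). snd p \<in> U \<and> \<bar>f (snd p) - fst p\<bar> < e k} \<in> sets (borel \<Otimes>\<^sub>M lborel)"
      by measurable
    from lborel.measurable_emeasure_Pair[OF this]
    show ?thesis by (simp add: space_pair_measure vimage_def)
  qed
  have int: "(\<integral>\<^sup>+s. vol (?A k s) \<partial>lborel) = ennreal (2 * e k) * vol U" for k
  proof -
    have "(\<integral>\<^sup>+s. vol (?A k s) \<partial>lborel) = (\<integral>\<^sup>+s. (\<integral>\<^sup>+x. indicator (?A k s) x \<partial>lborel) \<partial>lborel)"
      using sA by simp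
    also have "\<dots> = (\<integral>\<^sup>+x. (\<integral>\<^sup>+s. indicator (?A k s) x \<partial>lborel) \<partial>lborel)"
    proof (rule pair_sigma_finite.Fubini'[symmetric])
      show "pair_sigma_finite (lborel :: real measure) (lborel :: 'a measure)" ..
      have "{p \<in> space (lborel \<Otimes>\<^sub>M lborel). snd p \<in> U \<and> \<bar>f (snd p) - fst p\<bar> < e k} \<in> sets (lborel \<Otimes>\<^sub>M lborel)"
        by measurable
      then have "indicator {p \<in> space (lborel \<Otimes>\<^sub>M lborel). snd p \<in> U \<and> \<bar>f (snd p) - fst p\<bar> < e k}
        \<in> borel_measurable (lborel \<Otimes>\<^sub>M lborel)" by (rule borel_measurable_indicator)
      also have "indicator {p \<in> space (lborel \<Otimes>\<^sub>M lborel). snd p \<in> U \<and> \<bar>f (snd p) - fst p\<bar> < e k}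
        = (\<lambda>(s, x). indicator (?A k s) x)"
        by (auto simp: fun_eq_iff indicator_def space_pair_measure)
      finally show "(\<lambda>(s, x). indicator (?A k s) x) \<in> borel_measurable (lborel \<Otimes>\<^sub>M lborel)" .
    qed
    also have "\<dots> = (\<integral>\<^sup>+x. ennreal (2 * e k) * indicator U x \<partial>lborel)"
    proof (intro nn_integral_cong)
      fix x
      have "(\<integral>\<^sup>+s. indicator (?A k s) x \<partial>lborel) = (\<integral>\<^sup>+s. indicator {f x - e k<..<f x + e k} s * indicator U x \<partial>lborel)"
        by (intro nn_integral_cong) (auto simp: indicator_def)
      also have "\<dots> = vol {f x - e k<..<f x + e k} * indicator U x"
        by (subst nn_integral_multc) auto
      also have "\<dots> = ennreal (2 * e k) * indicator U x" using e[of k] by simp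
      finally show "(\<integral>\<^sup>+s. indicator (?A k s) x \<partial>lborel) = ennreal (2 * e k) * indicator U x" .
    qed
    also have "\<dots> = ennreal (2 * e k) * vol U"
      using U by (subst nn_integral_cmult_indicator) auto
    finally show ?thesis .
  qed
  \<comment> \<open>Integrating the assumed lower bound over the interval of length \<open>d\<close>
    gives \<open>B + 1\<close>, against the upper bound \<open>B\<close> from Fubini.\<close>
  have "ennreal (B + 1) * vol U = ennreal ((B + 1) / d) * vol U * ennreal d"
    using d B by (simp add: ennreal_mult[symmetric] mult.assoc mult.commute[of "vol U"])
      (simp add: mult.assoc[symmetric] ennreal_mult[symmetric])
  also have "\<dots> = (\<integral>\<^sup>+s. ennreal ((B + 1) / d) * vol U * indicator {c..c + d} s \<partial>lborel)"
    using d by (subst nn_integral_cmult_indicator) auto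
  also have "\<dots> \<le> (\<integral>\<^sup>+s. ?g s \<partial>lborel)"
    using gt by (intro nn_integral_mono) (auto simp: indicator_def less_imp_le)
  also have "\<dots> = (\<Sum>k. (\<integral>\<^sup>+s. ennreal (w k) * vol (?A k s) \<partial>lborel))"
    using mA by (intro nn_integral_suminf) auto
  also have "\<dots> = (\<Sum>k. ennreal (w k) * (ennreal (2 * e k) * vol U))"
    using mA by (subst nn_integral_cmult) (auto simp: int)
  also have "\<dots> = (\<Sum>k. ennreal (w k) * ennreal (2 * e k)) * vol U"
    by (subst ennreal_suminf_multc[symmetric]) (simp add: mult.assoc)
  also have "\<dots> \<le> ennreal B * vol U" using B by (intro mult_right_mono) auto
  finally have "ennreal (B + 1) * vol U \<le> ennreal B * vol U" .
  moreover obtain u where "vol U = ennreal u" "u > 0"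
    using U pos by (cases "vol U") auto
  ultimately have "ennreal ((B + 1) * u) \<le> ennreal (B * u)" "u > 0"
    using B by (simp_all only: ennreal_mult)
  then show False using B by (simp add: distrib_right)
qed

section \<open>Volumes of neighbourhoods of spheres and of their nonexpansive images\<close>

lemma power_diff_le:
  fixes a b M :: real
  assumes "0 \<le> b" "b \<le> a" "a \<le> M" "1 \<le> M"
  shows "a ^ n - b ^ n \<le> real n * M ^ n * (a - b)"
proof (induction n)
  case (Suc n)
  have "a ^ Suc n - b ^ Suc n = a * (a ^ n - b ^ n) + b ^ n * (a - b)" by (simp add: algebra_simps)
  also have "\<dots> \<le> M * (real n * M ^ n * (a - b)) + M ^ Suc n * (a - b)"
  proof (intro add_mono mult_mono mult_right_mono)
    have "b ^ n \<le> M ^ n" using assms by (intro power_mono) auto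
    also have "\<dots> \<le> M ^ Suc n" using assms by (intro power_increasing) auto
    finally show "b ^ n \<le> M ^ Suc n" .
    show "0 \<le> a ^ n - b ^ n" using assms by (simp add: power_mono)
  qed (use assms Suc in auto)
  finally show ?case by (simp add: algebra_simps)
qed simp

lemma open_infdist_less: "open {y. infdist y K < e}"
  by (intro open_Collect_less continuous_intros)

text \<open>The neighbourhood lies in a shell between the radii \<open>R - e\<close> and
  \<open>R + e\<close>, whose volume is a difference of powers; \<open>M\<close> bounds the radii
  uniformly for \<open>e \<le> e0\<close>.\<close>

lemma sphere_nbhd_linear:
  fixes z :: "'a::euclidean_space"
  assumes "0 < R" "0 < e0"
  shows "\<exists>C\<ge>0. \<forall>e. 0 < e \<and> e \<le> e0 \<longrightarrow> vol {y. infdist y (sphere z R) < e} \<le> ennreal (C * e)"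
proof -
  define M where "M = max 1 (R + e0)"
  define v where "v = unit_ball_vol (real DIM('a))"
  let ?d = "DIM('a)"
  have v: "0 \<le> v" by (simp add: v_def)
  have "vol {y. infdist y (sphere z R) < e} \<le> ennreal ((2 * v * real ?d * M ^ ?d) * e)"
    if e: "0 < e" "e \<le> e0" for e
  proof -
    define a where "a = R + e"
    \<comment> \<open>The inner radius is cut off at 0, since \<open>e\<close> may exceed
      \<open>R\<close>.\<close>
    define b where "b = max 0 (R - e)"
    have ab: "0 \<le> b" "b \<le> a" "a \<le> M" "1 \<le> M" "a - b \<le> 2 * e" using e assms by (auto simp: a_def b_def M_def)
    have "{y. infdist y (sphere z R) < e} \<subseteq> ball z a - ball z b"
    proof clarify
      fix y assume "infdist y (sphere z R) < e"
      moreover have ne: "sphere z R \<noteq> {}" using assms by simp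
      moreover obtain p where "p \<in> sphere z R" "infdist y (sphere z R) = dist y p"
        using infdist_attains_inf[OF closed_sphere ne] by metis
      ultimately have p: "p \<in> sphere z R" "dist y p < e" by simp_all
      then have "dist z p = R" by simp
      then have "dist z y < a" "\<not> dist z y < b"
        using p dist_triangle[of z y p] dist_triangle[of z p y]
        using zero_le_dist[of z y] e(1) unfolding a_def b_def dist_commute[of y] by linarith+
      then show "y \<in> ball z a - ball z b" by simp
    qed
    then have "vol {y. infdist y (sphere z R) < e} \<le> vol (ball z a - ball z b)"
      by (intro emeasure_mono) auto
    also have "\<dots> = vol (ball z a) - vol (ball z b)"
      using ab emeasure_bounded_finite[of "ball z b"] by (intro emeasure_Diff) (auto simp: subset_ball)
    also have "\<dots> = ennreal (v * a ^ ?d) - ennreal (v * b ^ ?d)"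
      using ab by (simp add: emeasure_ball v_def)
    also have "\<dots> = ennreal (v * (a ^ ?d - b ^ ?d))"
      using ab v by (simp add: ennreal_minus right_diff_distrib)
    also have "\<dots> \<le> ennreal ((2 * v * real ?d * M ^ ?d) * e)"
    proof (rule ennreal_leI)
      have "v * (a ^ ?d - b ^ ?d) \<le> v * (real ?d * M ^ ?d * (a - b))"
        using ab v power_diff_le by (intro mult_left_mono) auto
      also have "\<dots> \<le> v * (real ?d * M ^ ?d * (2 * e))"
        using ab v by (intro mult_left_mono) auto
      finally show "v * (a ^ ?d - b ^ ?d) \<le> 2 * v * real ?d * M ^ ?d * e" by (simp add: ac_simps)
    qed
    finally show ?thesis .
  qed
  moreover have "0 \<le> 2 * v * real ?d * M ^ ?d" using v by (simp add: M_def)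
  ultimately show ?thesis by blast
qed

lemma nonexpansive_continuous_on:
  assumes "\<And>x y. x \<in> K \<Longrightarrow> y \<in> K \<Longrightarrow> dist (h x) (h y) \<le> dist x y"
  shows "continuous_on K h"
  unfolding continuous_on_iff
proof (intro ballI allI impI)
  fix x e' assume "x \<in> K" "0 < (e' :: real)"
  then show "\<exists>d>0. \<forall>x'\<in>K. dist x' x < d \<longrightarrow> dist (h x') (h x) < e'"
    by (intro exI[of _ e']) (auto intro: le_less_trans[OF assms])
qed

text \<open>A maximal \<open>e\<close>-separated subset of \<open>K\<close> has boundedly many points by volume, and its image
  is \<open>e\<close>-dense in the image of \<open>K\<close>.\<close>

lemma lipschitz_image_nbhd:
  fixes h :: "'a::euclidean_space \<Rightarrow> 'a"
  assumes K: "compact K" "K \<noteq> {}" and e: "0 < e" and C: "0 \<le> C"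
    and nb: "vol {y. infdist y K < e} \<le> ennreal C"
    and lip: "\<And>x y. x \<in> K \<Longrightarrow> y \<in> K \<Longrightarrow> dist (h x) (h y) \<le> dist x y"
  shows "vol {y. infdist y (h ` K) < e} \<le> ennreal (4 ^ DIM('a) * C)"
proof -
  define v where "v = unit_ball_vol (real DIM('a)) * (e / 2) ^ DIM('a)"
  have v: "0 < v" using e by (simp add: v_def)
  have vb: "vol (ball c (e / 2)) = ennreal v" for c :: 'a
    using e by (simp add: emeasure_ball v_def)
  \<comment> \<open>The factor \<open>4 ^ DIM('a)\<close> is the volume ratio between the covering
    balls of radius \<open>2 * e\<close> and the packing balls of radius
    \<open>e / 2\<close>.\<close>
  have vb4: "vol (ball c (2 * e)) = ennreal (4 ^ DIM('a) * v)" for c :: 'a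
  proof -
    have "(2 * e) ^ n = 4 ^ n * (e / 2) ^ n" for n by (subst power_mult_distrib[symmetric]) simp
    then show ?thesis using e by (simp add: emeasure_ball v_def mult.left_commute)
  qed
  define sep where "sep S \<longleftrightarrow> finite S \<and> S \<subseteq> K \<and> (\<forall>x\<in>S. \<forall>y\<in>S. x \<noteq> y \<longrightarrow> e \<le> dist x y)" for S
  have card: "real (card S) * v \<le> C" if "sep S" for S
  proof -
    have S: "finite S" "S \<subseteq> K" using that by (auto simp: sep_def)
    have "disjoint_family_on (\<lambda>s. ball s (e / 2)) S"
      unfolding disjoint_family_on_def
    proof (intro ballI impI)
      fix x y assume "x \<in> S" "y \<in> S" "x \<noteq> y"
      then have "e \<le> dist x y" using that by (auto simp: sep_def)
      then show "ball x (e / 2) \<inter> ball y (e / 2) = {}"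
        by (intro disjoint_ballI) simp
    qed
    then have "vol (\<Union>s\<in>S. ball s (e / 2)) = (\<Sum>s\<in>S. vol (ball s (e / 2)))"
      using S by (intro sum_emeasure[symmetric]) auto
    also have "\<dots> = ennreal (real (card S) * v)" using v by (simp add: vb ennreal_mult flip: ennreal_of_nat_eq_real_of_nat)
    finally have "ennreal (real (card S) * v) = vol (\<Union>s\<in>S. ball s (e / 2))" by simp
    also have "\<dots> \<le> vol {y. infdist y K < e}"
    proof (intro emeasure_mono subsetI)
      fix y assume "y \<in> (\<Union>s\<in>S. ball s (e / 2))"
      then obtain s where "s \<in> K" "dist y s < e / 2" using S by (auto simp: dist_commute)
      then have "infdist y K < e" using infdist_le[of s K y] e by linarith
      then show "y \<in> {y. infdist y K < e}" by simp
    qed (simp add: open_infdist_less)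
    also have "\<dots> \<le> ennreal C" by (rule nb)
    finally show ?thesis using C by simp
  qed
  have "card S < nat \<lceil>C / v\<rceil> + 1" if "sep S" for S
  proof -
    have "real (card S) \<le> C / v" using card[OF that] v by (simp add: pos_le_divide_eq)
    then show ?thesis by linarith
  qed
  moreover have "sep {}" by (simp add: sep_def)
  ultimately obtain S where S: "sep S" "\<And>S'. sep S' \<Longrightarrow> card S' \<le> card S"
    using ex_has_greatest_nat[of sep "{}" card "nat \<lceil>C / v\<rceil> + 1"] by blast
  have fS: "finite S" "S \<subseteq> K" using S by (auto simp: sep_def)
  \<comment> \<open>A point violating this could be added to \<open>S\<close>, against maximality of
    its cardinality.\<close>
  have dense: "\<exists>s\<in>S. dist x s < e" if "x \<in> K" for x
  proof (rule ccontr)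
    assume "\<not> ?thesis"
    then have a: "\<And>s. s \<in> S \<Longrightarrow> e \<le> dist x s" by (auto simp: not_less)
    then have "x \<notin> S" using e by force
    moreover have "sep (insert x S)" using S(1) a that by (auto simp: sep_def dist_commute)
    ultimately show False using S(2)[of "insert x S"] fS by simp
  qed
  have ch: "closed (h ` K)" "h ` K \<noteq> {}"
  proof -
    have "continuous_on K h" using lip by (rule nonexpansive_continuous_on)
    then show "closed (h ` K)" using K by (simp add: compact_continuous_image compact_imp_closed)
  qed (use K in auto)
  have "{y. infdist y (h ` K) < e} \<subseteq> (\<Union>s\<in>S. ball (h s) (2 * e))"
  proof clarify
    fix y assume "infdist y (h ` K) < e"
    moreover obtain q where "q \<in> h ` K" "infdist y (h ` K) = dist y q"
      using infdist_attains_inf[OF ch] by metis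
    ultimately obtain x where x: "x \<in> K" "dist y (h x) < e" by auto
    then obtain s where s: "s \<in> S" "dist x s < e" using dense by blast
    have "dist (h x) (h s) \<le> dist x s" using lip x s fS by blast
    then have "dist (h s) y < 2 * e"
      using x s dist_triangle[of "h s" y "h x"] by (simp add: dist_commute)
    then show "y \<in> (\<Union>s\<in>S. ball (h s) (2 * e))" using s by auto
  qed
  then have "vol {y. infdist y (h ` K) < e} \<le> vol (\<Union>s\<in>S. ball (h s) (2 * e))"
    by (intro emeasure_mono) (auto intro!: borel_open open_UN)
  also have "\<dots> \<le> (\<Sum>s\<in>S. vol (ball (h s) (2 * e)))"
    using fS by (intro emeasure_subadditive_finite) auto
  also have "\<dots> = ennreal (real (card S) * (4 ^ DIM('a) * v))"
    using v by (simp add: vb4 ennreal_mult flip: ennreal_of_nat_eq_real_of_nat)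
  also have "\<dots> \<le> ennreal (4 ^ DIM('a) * C)"
    using card[OF S(1)] by (intro ennreal_leI) (simp add: mult.left_commute)
  finally show ?thesis .
qed

section \<open>Iterated partitions and refinements\<close>

lemma open_collar: "open A \<Longrightarrow> open (collar e A)"
proof -
  assume "open A"
  moreover have "collar e A = (if frontier A = {} then {} else A \<inter> {x. infdist x (frontier A) < e})"
    by (auto simp: collar_def)
  ultimately show ?thesis using open_infdist_less by auto
qed

lemma borel_Diff_open: "open A \<Longrightarrow> open B \<Longrightarrow> A - B \<in> sets borel"
  by simp

lemma emeasure_lebesgue_borel: "A \<in> sets borel \<Longrightarrow> emeasure lebesgue A = vol A"
  by simp

lemma emeasure_open_pos:
  fixes A :: "'a::euclidean_space set"
  assumes "open A" "A \<noteq> {}"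
  shows "0 < vol A"
proof -
  obtain x e where "0 < e" "ball x e \<subseteq> A" using assms by (metis openE all_not_in_conv)
  then have "vol (ball x e) \<le> vol A" using assms by (intro emeasure_mono) auto
  moreover have "0 < vol (ball x e)" using \<open>0 < e\<close> by (simp add: emeasure_ball)
  ultimately show ?thesis by simp
qed

context piecewise_expanding
begin

abbreviation "IP \<equiv> iterated_partition X T P"

lemma IP_cyl:
  assumes "C \<in> IP n"
  shows "cyl n C"
proof -
  obtain w where w: "length w = n" "set w \<subseteq> P" "C = {x \<in> X. \<forall>i<n. (T ^^ i) x \<in> w ! i}"
    using assms by (auto simp: iterated_partition_def)
  have "cyl m {x \<in> X. \<forall>i<m. (T ^^ i) x \<in> w ! i}" if "m \<le> n" for m
    using that
  proof (induction m)
    case 0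
    then show ?case using open_X by (simp add: cyl_0)
  next
    case (Suc m)
    let ?V = "{x \<in> X. \<forall>i<m. (T ^^ i) x \<in> w ! i}"
    have c: "cyl m ?V" using Suc by simp
    have eq: "{x \<in> X. \<forall>i<Suc m. (T ^^ i) x \<in> w ! i} = ?V \<inter> (T ^^ m) -` (w ! m)"
      by (auto simp: less_Suc_eq)
    have B: "w ! m \<in> P" using w Suc.prems by (simp add: subset_iff)
    then have "open (?V \<inter> (T ^^ m) -` (w ! m))" using branch(1) c by (intro pull_open) auto
    then have "cyl m (?V \<inter> (T ^^ m) -` (w ! m))" by (intro cyl_subset[OF c]) auto
    then show ?case unfolding eq cyl_Suc using B by blast
  qed
  then show ?thesis using w by simp
qed

lemma P_disjoint: "B \<in> P \<Longrightarrow> B' \<in> P \<Longrightarrow> x \<in> B \<Longrightarrow> x \<in> B' \<Longrightarrow> B = B'"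
  using partition_P by (auto simp: open_partition_def disjoint_def)

lemma IP_disjoint:
  assumes "C \<in> IP n" "C' \<in> IP n" "x \<in> C" "x \<in> C'"
  shows "C = C'"
proof -
  obtain w where w: "length w = n" "set w \<subseteq> P" "C = {x \<in> X. \<forall>i<n. (T ^^ i) x \<in> w ! i}"
    using assms by (auto simp: iterated_partition_def)
  obtain w' where w': "length w' = n" "set w' \<subseteq> P" "C' = {x \<in> X. \<forall>i<n. (T ^^ i) x \<in> w' ! i}"
    using assms by (auto simp: iterated_partition_def)
  have "w ! i = w' ! i" if "i < n" for i
    using w w' assms that by (intro P_disjoint[of _ _ "(T ^^ i) x"]) auto
  then have "w = w'" using w w' by (intro nth_equalityI) auto
  then show ?thesis using w w' by simp
qed

lemma IP_countable: "countable (IP n)"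
proof -
  have "IP n \<subseteq> (\<lambda>w. {x \<in> X. \<forall>i<n. (T ^^ i) x \<in> w ! i}) ` lists P"
    by (auto simp: iterated_partition_def)
  moreover have "countable (lists P)" using partition_P by (auto simp: open_partition_def)
  ultimately show ?thesis by (rule countable_subset[OF _ countable_image])
qed

lemma IP_Union: "\<Union>(IP n) = {x \<in> X. \<forall>i<n. (T ^^ i) x \<in> \<Union>P}"
proof (intro equalityI subsetI)
  fix x assume "x \<in> {x \<in> X. \<forall>i<n. (T ^^ i) x \<in> \<Union>P}"
  then have x: "x \<in> X" "\<forall>i. \<exists>B. i < n \<longrightarrow> B \<in> P \<and> (T ^^ i) x \<in> B" by auto
  then obtain B where B: "\<And>i. i < n \<Longrightarrow> B i \<in> P \<and> (T ^^ i) x \<in> B i" by metis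
  define w where "w = map B [0..<n]"
  define C where "C = {x \<in> X. \<forall>i<n. (T ^^ i) x \<in> w ! i}"
  have w: "length w = n" "set w \<subseteq> P" using B by (simp_all add: w_def image_subset_iff)
  have xC: "x \<in> C" using x(1) B by (simp add: C_def w_def)
  then have "C \<noteq> {}" by blast
  then have "C \<in> IP n"
    unfolding iterated_partition_def
    by (intro CollectI conjI exI[of _ w] w C_def)
  then show "x \<in> \<Union>(IP n)" using xC by (rule UnionI)
next
  fix x assume "x \<in> \<Union>(IP n)"
  then show "x \<in> {x \<in> X. \<forall>i<n. (T ^^ i) x \<in> \<Union>P}"
    by (auto simp: iterated_partition_def subset_iff)
qed

lemma P_Union_borel: "X - \<Union>P \<in> sets borel" and P_cover: "vol (X - \<Union>P) = 0"
proof -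
  have "open (\<Union>P)" using branch(1) by auto
  then show 1: "X - \<Union>P \<in> sets borel" using open_X by auto
  have "X - \<Union>P \<in> null_sets lebesgue" using partition_P by (simp add: open_partition_def)
  then show "vol (X - \<Union>P) = 0"
    using 1 emeasure_lebesgue_borel[OF 1] by (simp add: null_sets_def)
qed

lemma IP_open_Union: "open (\<Union>(IP n))"
  using IP_cyl cyl_open by blast

text \<open>The points newly lost have \<open>(T ^^ n) x\<close> in the null set
  \<open>X - \<Union>P\<close>, and non-singularity pulls this set back to a null set along each of
  the countably many branches.\<close>

lemma IP_cover: "vol (X - \<Union>(IP n)) = 0"
proof (induction n)
  case 0
  show ?case unfolding IP_Union by simp
next
  case (Suc n)
  let ?N = "\<Union>C\<in>IP n. C \<inter> (T ^^ n) -` (X - \<Union>P)"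
  have sub: "X - \<Union>(IP (Suc n)) \<subseteq> (X - \<Union>(IP n)) \<union> ?N"
  proof
    fix x assume x: "x \<in> X - \<Union>(IP (Suc n))"
    show "x \<in> (X - \<Union>(IP n)) \<union> ?N"
    proof (cases "x \<in> \<Union>(IP n)")
      case True
      then obtain C where C: "C \<in> IP n" "x \<in> C" by blast
      then have "(T ^^ n) x \<in> X" using cyl_image_X[OF IP_cyl] by blast
      moreover have "(T ^^ n) x \<notin> \<Union>P" using x True unfolding IP_Union by (auto simp: less_Suc_eq)
      ultimately show ?thesis using C by blast
    qed (use x in blast)
  qed
  have "X - \<Union>(IP n) \<in> null_sets lborel"
    using Suc IP_open_Union open_X by (auto simp: null_sets_def)
  moreover have "?N \<in> null_sets lborel"
  proof (intro null_sets_UN' IP_countable null_setsI)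
    fix C assume "C \<in> IP n"
    then have c: "cyl n C" by (rule IP_cyl)
    show "vol (C \<inter> (T ^^ n) -` (X - \<Union>P)) = 0" by (rule pull_null[OF c P_Union_borel P_cover])
    show "C \<inter> (T ^^ n) -` (X - \<Union>P) \<in> sets lborel" using pull_borel[OF c P_Union_borel] by simp
  qed
  ultimately have "(X - \<Union>(IP n)) \<union> ?N \<in> null_sets lborel" by (rule null_sets.Un)
  moreover have "X - \<Union>(IP (Suc n)) \<in> sets lborel" using IP_open_Union open_X by auto
  ultimately have "X - \<Union>(IP (Suc n)) \<in> null_sets lborel" using null_sets_subset sub by blast
  then show ?case by auto
qed

text \<open>The index concerns the members only. With \<open>n\<close> above the order of
  \<open>U\<close> this describes a subdivision into branches of a higher iterate, with equal order
  a mere cutting of \<open>U\<close>.\<close>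

definition refin :: "nat \<Rightarrow> 'a set \<Rightarrow> 'a set set \<Rightarrow> bool" where
  "refin n U F \<longleftrightarrow> countable F \<and> disjoint F \<and> (\<forall>V\<in>F. cyl n V \<and> V \<noteq> {} \<and> V \<subseteq> U) \<and>
     vol (U - \<Union>F) = 0"

lemma refin_self: "cyl n U \<Longrightarrow> U \<noteq> {} \<Longrightarrow> refin n U {U}"
  by (simp add: refin_def)

lemma refinD:
  assumes "refin n U F"
  shows "countable F" "disjoint F" "\<And>V. V \<in> F \<Longrightarrow> cyl n V" "\<And>V. V \<in> F \<Longrightarrow> open V"
    "\<And>V. V \<in> F \<Longrightarrow> V \<noteq> {}" "\<And>V. V \<in> F \<Longrightarrow> V \<subseteq> U" "vol (U - \<Union>F) = 0"
  using assms cyl_open by (auto simp: refin_def)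

lemma refin_bind:
  assumes U: "open U" and F: "refin n U F" and G: "\<And>V. V \<in> F \<Longrightarrow> refin m V (G V)"
  shows "refin m U (\<Union>V\<in>F. G V)"
  unfolding refin_def
proof (intro conjI ballI)
  note f = refinD[OF F] and g = refinD[OF G]
  show "countable (\<Union>V\<in>F. G V)" using f(1) g(1) by (rule countable_UN)
  show "disjoint (\<Union>V\<in>F. G V)"
  proof (rule disjointI)
    fix W W' assume "W \<in> (\<Union>V\<in>F. G V)" "W' \<in> (\<Union>V\<in>F. G V)" and ne: "W \<noteq> W'"
    then obtain V V' where V: "V \<in> F" "W \<in> G V" "V' \<in> F" "W' \<in> G V'" by blast
    show "W \<inter> W' = {}"
    proof (cases "V = V'")
      case True
      then show ?thesis using disjointD[OF g(2)[OF V(1)] V(2)] V ne by blast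
    next
      case False
      then have "V \<inter> V' = {}" using disjointD[OF f(2)] V by blast
      then show ?thesis using g(6)[OF V(1) V(2)] g(6)[OF V(3) V(4)] by blast
    qed
  qed
  have "U - \<Union>F \<in> null_sets lborel"
    using f(4,7) U by (intro null_setsI) (auto intro!: borel_Diff_open)
  moreover have "(\<Union>V\<in>F. V - \<Union>(G V)) \<in> null_sets lborel"
  proof (intro null_sets_UN' f(1) null_setsI)
    fix V assume V: "V \<in> F"
    show "vol (V - \<Union>(G V)) = 0" by (rule g(7)[OF V])
    show "V - \<Union>(G V) \<in> sets lborel" using f(4)[OF V] g(4)[OF V] by (auto intro!: borel_Diff_open)
  qed
  ultimately have "(U - \<Union>F) \<union> (\<Union>V\<in>F. V - \<Union>(G V)) \<in> null_sets lborel" by (rule null_sets.Un)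
  moreover have "U - \<Union>(\<Union>V\<in>F. G V) \<subseteq> (U - \<Union>F) \<union> (\<Union>V\<in>F. V - \<Union>(G V))" by blast
  moreover have "U - \<Union>(\<Union>V\<in>F. G V) \<in> sets lborel"
    using U g(4) by (auto intro!: borel_Diff_open)
  ultimately have "U - \<Union>(\<Union>V\<in>F. G V) \<in> null_sets lborel" using null_sets_subset by blast
  then show "vol (U - \<Union>(\<Union>V\<in>F. G V)) = 0" by auto
next
  fix W assume "W \<in> (\<Union>V\<in>F. G V)"
  then obtain V where V: "V \<in> F" "W \<in> G V" by blast
  note g = refinD[OF G[OF V(1)]]
  show "cyl m W" "W \<noteq> {}" by (rule g(3)[OF V(2)], rule g(5)[OF V(2)])
  show "W \<subseteq> U" using g(6)[OF V(2)] refinD(6)[OF F V(1)] by blast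
qed

text \<open>Disjointness of the families, not of their unions, is at stake; nonemptiness keeps the
  empty set from being a common member.\<close>

lemma disjoint_family_on_refin:
  assumes F: "disjoint F" and G: "\<And>V W. V \<in> F \<Longrightarrow> W \<in> G V \<Longrightarrow> W \<noteq> {} \<and> W \<subseteq> V"
  shows "disjoint_family_on G F"
  unfolding disjoint_family_on_def
proof (intro ballI impI)
  fix V V' assume "V \<in> F" "V' \<in> F" "V \<noteq> V'"
  then have "V \<inter> V' = {}" using F by (auto simp: disjoint_def)
  then show "G V \<inter> G V' = {}" using G[OF \<open>V \<in> F\<close>] G[OF \<open>V' \<in> F\<close>] by blast
qed

lemma sum_refin_le:
  assumes "countable F" "disjoint F" "\<And>V. V \<in> F \<Longrightarrow> open V" "\<And>V. V \<in> F \<Longrightarrow> V \<subseteq> U" "open U"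
  shows "csum vol F \<le> vol (U :: 'a set)"
proof -
  have "disjoint_family_on (\<lambda>V. V) F" using assms(2) by (auto simp: disjoint_family_on_def disjoint_def)
  then have "csum vol F = vol (\<Union>V\<in>F. V)"
    using assms by (subst emeasure_UN_countable) auto
  also have "\<dots> \<le> vol U" using assms by (intro emeasure_mono) auto
  finally show ?thesis .
qed

text \<open>Estimates with an error proportional to volume pass to subdivisions without loss, since
  the volumes of the members add up to at most \<open>vol U\<close>.\<close>

lemma sum_bind_le:
  fixes f g :: "'a set \<Rightarrow> ennreal"
  assumes F: "refin n U F" and G: "\<And>V. V \<in> F \<Longrightarrow> refin m V (G V)" and U: "open U"
    and le: "\<And>V. V \<in> F \<Longrightarrow> csum f (G V) \<le> A * g V + C * vol V"
  shows "csum f (\<Union>V\<in>F. G V) \<le> A * csum g F + C * vol U"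
proof -
  note f = refinD[OF F]
  have "csum f (\<Union>V\<in>F. G V) = (\<integral>\<^sup>+V. csum f (G V) \<partial>count_space F)"
    by (intro nn_integral_count_space_UN f(1) disjoint_family_on_refin[OF f(2)])
      (use refinD(5,6)[OF G] in blast)
  also have "\<dots> \<le> (\<integral>\<^sup>+V. A * g V + C * vol V \<partial>count_space F)"
    using le by (intro nn_integral_mono) simp
  also have "\<dots> = A * csum g F + C * csum vol F"
    by (simp add: nn_integral_add nn_integral_cmult)
  also have "\<dots> \<le> A * csum g F + C * vol U"
    using sum_refin_le[OF f(1,2,4,6) U] by (intro add_left_mono mult_left_mono) auto
  finally show ?thesis .
qed

end

section \<open>Growth of the boundary functional\<close>

text \<open>The distance to the closed frontier of \<open>J\<close> is attained, either at an old
  boundary point or on the newly created part \<open>W\<close>.\<close>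

lemma collar_subset:
  assumes "J \<subseteq> I" "frontier J \<subseteq> frontier I \<union> W" "y \<in> collar e J"
  shows "y \<in> collar e I \<or> (\<exists>q\<in>W. dist y q < e)"
proof -
  have y: "y \<in> J" "frontier J \<noteq> {}" "infdist y (frontier J) < e" using assms(3) by (auto simp: collar_def)
  obtain q where q: "q \<in> frontier J" "infdist y (frontier J) = dist y q"
    using infdist_attains_inf[OF frontier_closed y(2)] by metis
  show ?thesis
  proof (cases "q \<in> W")
    case False
    then have "q \<in> frontier I" using q assms(2) by blast
    then have "infdist y (frontier I) < e" "frontier I \<noteq> {}" using infdist_le[of q "frontier I" y] q y by auto
    then show ?thesis using y assms(1) by (auto simp: collar_def)
  qed (use q y in auto)
qed

text \<open>\<open>A\<close> records the sign pattern of the cell: on which side of each hyperplane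
  it lies. On the closure the inequalities become weak, and off the hyperplanes weak and strict ones
  agree.\<close>

lemma frontier_cell:
  fixes I :: "'a::euclidean_space set" and L A :: "('a \<times> 'i) set" and s :: "'a \<times> 'i \<Rightarrow> real"
  assumes "open I" "finite L"
  defines "J \<equiv> {y \<in> I. \<forall>p\<in>L. if p \<in> A then s p < y \<bullet> fst p else y \<bullet> fst p < s p}"
  shows "frontier J \<subseteq> frontier I \<union> {q. \<exists>p\<in>L. q \<bullet> fst p = s p}" and "open J"
proof -
  have J: "J = I \<inter> (\<Inter>p\<in>L. {y. if p \<in> A then s p < y \<bullet> fst p else y \<bullet> fst p < s p})"
    by (auto simp: J_def)
  have "open {y. if p \<in> A then s p < y \<bullet> fst p else y \<bullet> fst p < s p}" for p
    by (cases "p \<in> A") (auto intro!: open_Collect_less continuous_intros)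
  then show o: "open J" unfolding J using assms by (intro open_Int open_INT) auto
  have cl: "closed {y. if p \<in> A then s p \<le> y \<bullet> fst p else y \<bullet> fst p \<le> s p}" for p
    by (cases "p \<in> A") (auto intro!: closed_Collect_le continuous_intros)
  have "closure J \<subseteq> (\<Inter>p\<in>L. {y. if p \<in> A then s p \<le> y \<bullet> fst p else y \<bullet> fst p \<le> s p})"
    using cl by (intro closure_minimal closed_INT) (auto simp: J_def less_imp_le split: if_splits)
  show "frontier J \<subseteq> frontier I \<union> {q. \<exists>p\<in>L. q \<bullet> fst p = s p}"
  proof (rule subsetI, rule ccontr)
    fix q assume "q \<in> frontier J" "q \<notin> frontier I \<union> {q. \<exists>p\<in>L. q \<bullet> fst p = s p}"
    then have q: "q \<in> frontier J" "q \<notin> frontier I" and ne: "\<not> (\<exists>p\<in>L. q \<bullet> fst p = s p)" by auto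
    have qc: "q \<in> closure J" "q \<notin> J" using q(1) o by (auto simp: frontier_def interior_open)
    have le: "if p \<in> A then s p \<le> q \<bullet> fst p else q \<bullet> fst p \<le> s p" if "p \<in> L" for p
      using \<open>closure J \<subseteq> _\<close> qc(1) that by blast
    have lt: "if p \<in> A then s p < q \<bullet> fst p else q \<bullet> fst p < s p" if "p \<in> L" for p
      using le[OF that] ne that by (auto simp: less_le split: if_splits)
    have "q \<in> closure I" using qc(1) closure_mono[of J I] by (auto simp: J_def)
    then have "q \<in> I" using q(2) assms(1) by (auto simp: frontier_def interior_open)
    then have "q \<in> J" using lt unfolding J_def by blast
    then show False using qc(2) by simp
  qed
qed

lemma suminf_Suc_le:
  fixes f :: "nat \<Rightarrow> ennreal"
  shows "(\<Sum>k. f (Suc k)) \<le> (\<Sum>k. f k)"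
proof (rule suminf_le_const)
  fix n
  have "(\<Sum>k<n. f (Suc k)) = sum f (Suc ` {..<n})" by (simp add: sum.reindex)
  also have "\<dots> \<le> (\<Sum>k. f k)" by (intro sum_le_suminf) auto
  finally show "(\<Sum>k<n. f (Suc k)) \<le> (\<Sum>k. f k)" .
qed simp

text \<open>\<open>\<delta>\<close> bounds the diameter of images, \<open>\<epsilon>\<close> is the
  largest collar width, and \<open>r\<close> is the factor by which the weight of a collar grows
  when its width shrinks by \<open>\<Lambda> ^ n\<^sub>0\<close>. The last assumption is the window
  for \<open>r\<close>.\<close>

locale growth = piecewise_expanding X T P \<epsilon>\<^sub>1 \<Lambda> \<alpha> D
  for X :: "'a::euclidean_space set" and T :: "'a \<Rightarrow> 'a" and P :: "'a set set"
    and \<epsilon>\<^sub>1 \<Lambda> \<alpha> D :: real +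
  fixes n\<^sub>0 :: nat and \<epsilon>\<^sub>2 \<sigma> r \<delta> \<epsilon> :: real
  assumes complexity: "controlled_complexity X T P \<Lambda> n\<^sub>0 \<epsilon>\<^sub>2 \<sigma>"
    and n0: "0 < n\<^sub>0"
    and delta: "0 < \<delta>" "\<delta> \<le> \<epsilon>\<^sub>1" "\<delta> \<le> \<epsilon>\<^sub>2"
    and eps: "0 < \<epsilon>" "\<epsilon> < \<epsilon>\<^sub>2"
    and rate: "1 + exp (Dinf * \<delta> powr \<alpha>) * \<sigma> < r" "r * \<Lambda> ^ n\<^sub>0 < 1"
begin

abbreviation "K \<equiv> exp (Dinf * \<delta> powr \<alpha>)"

text \<open>The ratio is the contraction of an inverse branch of \<open>T ^^ n\<^sub>0\<close>, so
  that \<open>n\<^sub>0\<close> iterates move a collar by exactly one index.\<close>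

definition scale :: "nat \<Rightarrow> real" where "scale k = \<epsilon> * (\<Lambda> ^ n\<^sub>0) ^ k"

definition edge :: "nat \<Rightarrow> nat \<Rightarrow> 'a set \<Rightarrow> 'a set" where
  "edge k n U = U \<inter> (T ^^ n) -` collar (scale k) ((T ^^ n) ` U)"

text \<open>Up to constants \<open>Z n U\<close> is the integral over \<open>x \<in> U\<close> of a negative power of the distance of
  \<open>T\<^sup>n x\<close> to the boundary of \<open>T\<^sup>n U\<close>. Unlike \<open>sup\<^sub>\<epsilon> m(\<partial>\<^sub>\<epsilon>)/\<epsilon>\<close> it is additive over families, and its
  exponent is less than 1, which makes averages over translated hyperplanes finite.\<close>

definition Z :: "nat \<Rightarrow> 'a set \<Rightarrow> ennreal" where
  "Z n U = (\<Sum>k. ennreal (r ^ k) * vol (edge k n U))"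

definition piece :: "nat \<Rightarrow> 'a set \<Rightarrow> bool" where
  "piece n U \<longleftrightarrow> cyl n U \<and> U \<noteq> {} \<and> diameter ((T ^^ n) ` U) \<le> \<delta>"

lemma sigma: "0 \<le> \<sigma>" and r1: "1 < r"
proof -
  show s: "0 \<le> \<sigma>" using complexity by (simp add: controlled_complexity_def)
  have "0 \<le> K * \<sigma>" using s by simp
  then show "1 < r" using rate by linarith
qed

lemma lam: "0 < \<Lambda> ^ n\<^sub>0" "\<Lambda> ^ n\<^sub>0 < 1"
  using constants n0 by (auto simp: power_less_one_iff)

lemma scale_pos: "0 < scale k" and scale_le: "scale k \<le> \<epsilon>" and scale_Suc: "scale (Suc k) = \<Lambda> ^ n\<^sub>0 * scale k"
  using eps lam by (auto simp: scale_def power_le_one mult_left_le)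

text \<open>Any quantity linear in the collar width has finite total weight: a geometric series with
  ratio \<open>r * \<Lambda> ^ n\<^sub>0 < 1\<close>.\<close>

lemma scale_sum: "(\<Sum>k. ennreal (r ^ k) * ennreal (c * scale k)) = ennreal (c * \<epsilon> / (1 - r * \<Lambda> ^ n\<^sub>0))"
  if "0 \<le> c"
proof -
  let ?q = "r * \<Lambda> ^ n\<^sub>0"
  have q: "0 \<le> ?q" "?q < 1" using r1 lam rate by auto
  have "(\<lambda>k. c * \<epsilon> * ?q ^ k) sums (c * \<epsilon> * (1 / (1 - ?q)))"
    using q by (intro sums_mult geometric_sums) auto
  then have "(\<Sum>k. ennreal (c * \<epsilon> * ?q ^ k)) = ennreal (c * \<epsilon> * (1 / (1 - ?q)))"
    using q eps that by (intro sums_unique[symmetric] sums_ennreal[THEN iffD2]) auto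
  moreover have "ennreal (r ^ k) * ennreal (c * scale k) = ennreal (c * \<epsilon> * ?q ^ k)" for k
    using r1 eps lam that
    by (subst ennreal_mult[symmetric]) (auto simp: scale_def power_mult_distrib ac_simps less_imp_le)
  ultimately show ?thesis by simp
qed

lemma edge_subset: "edge k n U \<subseteq> U" by (auto simp: edge_def)

lemma edge_open: "cyl n U \<Longrightarrow> open (edge k n U)"
  unfolding edge_def by (rule pull_open[OF _ open_collar[OF cyl_open_image]])

lemma image_bounded: "cyl n U \<Longrightarrow> bounded ((T ^^ n) ` U)"
  by (rule bounded_subset[OF bounded_X cyl_image_X])

lemma X_finite: "vol X < \<infinity>"
  using emeasure_bounded_finite[OF bounded_X] by simp

lemma finite_sub_X: "A \<subseteq> X \<Longrightarrow> vol A < \<infinity>"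
  using emeasure_bounded_finite[OF bounded_subset[OF bounded_X]] by simp

lemma Z_family:
  assumes F: "refin n U F"
  shows "csum (Z n) F = (\<Sum>k. ennreal (r ^ k) * vol (\<Union>V\<in>F. edge k n V))"
proof -
  note f = refinD[OF F]
  have d: "disjoint_family_on (edge k n) F" for k
    unfolding disjoint_family_on_def
  proof (intro ballI impI)
    fix V W assume "V \<in> F" "W \<in> F" "V \<noteq> W"
    then have "V \<inter> W = {}" by (rule disjointD[OF f(2)])
    then show "edge k n V \<inter> edge k n W = {}" using edge_subset by blast
  qed
  have "csum (Z n) F = (\<Sum>k. \<integral>\<^sup>+V. ennreal (r ^ k) * vol (edge k n V) \<partial>count_space F)"
    unfolding Z_def by (intro nn_integral_suminf) auto
  also have "\<dots> = (\<Sum>k. ennreal (r ^ k) * (\<integral>\<^sup>+V. vol (edge k n V) \<partial>count_space F))"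
    by (simp add: nn_integral_cmult)
  also have "\<dots> = (\<Sum>k. ennreal (r ^ k) * vol (\<Union>V\<in>F. edge k n V))"
    using edge_open[OF f(3)] by (subst emeasure_UN_countable) (auto intro: f(1) d)
  finally show ?thesis .
qed

text \<open>Makes the denominators in \<open>complexity\<close> positive; boundedness rules out an
  empty frontier.\<close>

lemma collar_pos:
  assumes "open I" "I \<noteq> {}" "bounded I" "0 < e"
  shows "0 < vol (collar e (I :: 'a set))"
proof (rule emeasure_open_pos)
  show "open (collar e I)" using assms by (intro open_collar)
  have "I \<noteq> UNIV" using assms(3) not_bounded_UNIV by blast
  then obtain q where q: "q \<in> frontier I" using frontier_not_empty[OF assms(2)] by blast
  then have "q \<in> closure I" by (simp add: frontier_def)
  then obtain y where y: "y \<in> I" "dist y q < e" using assms(4) closure_approachable by blast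
  then have "infdist y (frontier I) < e" using infdist_le[OF q, of y] by linarith
  then show "collar e I \<noteq> {}" using y q by (auto simp: collar_def)
qed

text \<open>An edge point of a new piece at scale \<open>k\<close> is, after \<open>T ^^ n\<close>,
  either in the collar of the old image at scale \<open>Suc k\<close> or in the part that
  \<open>complexity\<close> counts. The second part has relative size at most
  \<open>\<sigma>\<close> in the image, hence at most \<open>K * \<sigma>\<close> in
  \<open>U\<close>. Since the index has moved up by one, the sum gains a factor
  \<open>1 / r\<close>.\<close>

lemma growth_step:
  assumes pc: "piece n U"
  shows "\<exists>F. refin (n + n\<^sub>0) U F \<and>
    csum (Z (n + n\<^sub>0)) F \<le> ennreal ((1 + K * \<sigma>) / r) * Z n U"
proof -
  have c: "cyl n U" and ne: "U \<noteq> {}" and diam: "diameter ((T ^^ n) ` U) \<le> \<delta>" using pc by (auto simp: piece_def)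
  define I where "I = (T ^^ n) ` U"
  define CS where "CS = {C \<in> IP n\<^sub>0. emeasure lebesgue (I \<inter> C) > 0}"
  define G where "G C = U \<inter> (T ^^ n) -` C" for C
  define F where "F = G ` CS"
  have oI: "open I" and IX: "I \<subseteq> X" and bI: "bounded I" and neI: "I \<noteq> {}"
    using cyl_open_image[OF c] cyl_image_X[OF c] image_bounded[OF c] ne by (auto simp: I_def)
  have cC: "cyl n\<^sub>0 C" "open C" if "C \<in> CS" for C
    using that IP_cyl cyl_open by (auto simp: CS_def)
  have disjC: "C \<inter> C' = {}" if "C \<in> CS" "C' \<in> CS" "C \<noteq> C'" for C C'
    using that IP_disjoint[of C n\<^sub>0 C'] by (auto simp: CS_def)
  have cntC: "countable CS" unfolding CS_def using IP_countable by (rule countable_subset[rotated]) auto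
  have neC: "I \<inter> C \<noteq> {}" if "C \<in> CS" for C using that by (auto simp: CS_def)
  have imG: "(T ^^ n) ` G C = I \<inter> C" for C by (auto simp: G_def I_def)
  have cG: "cyl (n + n\<^sub>0) (G C)" if "C \<in> CS" for C
  proof (rule cyl_add)
    show "cyl n (G C)" unfolding G_def using cC[OF that] by (intro cyl_subset[OF c] pull_open[OF c]) auto
    show "cyl n\<^sub>0 ((T ^^ n) ` G C)" unfolding imG using cC[OF that] oI by (intro cyl_subset[OF cC(1)[OF that]]) auto
  qed
  have ref: "refin (n + n\<^sub>0) U F"
    unfolding refin_def
  proof (intro conjI ballI)
    show "countable F" unfolding F_def using cntC by simp
    show "disjoint F"
    proof (rule disjointI)
      fix a b assume "a \<in> F" "b \<in> F" "a \<noteq> b"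
      then obtain C C' where C: "C \<in> CS" "C' \<in> CS" "a = G C" "b = G C'" "C \<noteq> C'" by (auto simp: F_def)
      then show "a \<inter> b = {}" using disjC[of C C'] by (auto simp: G_def)
    qed
    fix V assume "V \<in> F"
    then obtain C where C: "C \<in> CS" "V = G C" by (auto simp: F_def)
    show "cyl (n + n\<^sub>0) V" using cG C by simp
    show "V \<noteq> {}" using neC[OF C(1)] C(2) imG[of C] by auto
    show "V \<subseteq> U" using C by (auto simp: G_def)
  next
    have "U - \<Union>F \<subseteq> U \<inter> (T ^^ n) -` (X - \<Union>(IP n\<^sub>0))"
    proof
      fix x assume x: "x \<in> U - \<Union>F"
      have "(T ^^ n) x \<notin> \<Union>(IP n\<^sub>0)"
      proof
        assume "(T ^^ n) x \<in> \<Union>(IP n\<^sub>0)"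
        then obtain C where C: "C \<in> IP n\<^sub>0" "(T ^^ n) x \<in> C" by blast
        have oC: "open C" using cyl_open[OF IP_cyl[OF C(1)]] .
        have "I \<inter> C \<noteq> {}" using x C by (auto simp: I_def)
        then have "C \<in> CS"
          using emeasure_open_pos[of "I \<inter> C"] oI oC C by (simp add: CS_def emeasure_lebesgue_borel open_Int)
        moreover have "x \<in> G C" using x C by (simp add: G_def)
        ultimately show False using x by (auto simp: F_def)
      qed
      then show "x \<in> U \<inter> (T ^^ n) -` (X - \<Union>(IP n\<^sub>0))" using x IX by (auto simp: I_def)
    qed
    moreover have bX: "X - \<Union>(IP n\<^sub>0) \<in> sets borel" using open_X IP_open_Union by (rule borel_Diff_open)
    ultimately have "vol (U - \<Union>F) \<le> vol (U \<inter> (T ^^ n) -` (X - \<Union>(IP n\<^sub>0)))"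
      using pull_borel[OF c bX] by (intro emeasure_mono) auto
    also have "\<dots> = 0" by (rule pull_null[OF c bX IP_cover])
    finally show "vol (U - \<Union>F) = 0" by simp
  qed
  have step: "vol (\<Union>V\<in>F. edge k (n + n\<^sub>0) V) \<le> ennreal (1 + K * \<sigma>) * vol (edge (Suc k) n U)" for k
  proof -
    define A where "A C = {y \<in> I \<inter> C. (T ^^ n\<^sub>0) y \<in> collar (scale k) ((T ^^ n\<^sub>0) ` (I \<inter> C))}" for C
    define E where "E = collar (scale (Suc k)) I"
    have oE: "open E" unfolding E_def using oI by (rule open_collar)
    have EI: "E \<subseteq> I" by (auto simp: E_def collar_def)
    have edgeE: "edge (Suc k) n U = U \<inter> (T ^^ n) -` E" by (simp add: edge_def E_def I_def)
    have E0: "0 < vol E" unfolding E_def using oI neI bI scale_pos by (rule collar_pos)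
    have Efin: "vol E < \<infinity>" using EI IX by (intro finite_sub_X) auto
    have oA: "open (A C)" if "C \<in> CS" for C
    proof -
      have cIC: "cyl n\<^sub>0 (I \<inter> C)" using cC[OF that] oI by (intro cyl_subset[OF cC(1)[OF that]]) auto
      have "A C = (I \<inter> C) \<inter> (T ^^ n\<^sub>0) -` collar (scale k) ((T ^^ n\<^sub>0) ` (I \<inter> C))" by (auto simp: A_def)
      then show ?thesis using pull_open[OF cIC open_collar[OF cyl_open_image[OF cIC]]] by simp
    qed
    \<comment> \<open>The set in the definition of \<open>complexity\<close> is rewritten without
      the inverse branch, which is taken on all of \<open>C\<close> rather than on
      \<open>I \<inter> C\<close>.\<close>
    have A_eq: "inv_into C (T ^^ n\<^sub>0) ` collar (scale k) ((T ^^ n\<^sub>0) ` (I \<inter> C)) = A C" if "C \<in> CS" for C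
    proof -
      have inj: "inj_on (T ^^ n\<^sub>0) C" using cyl_inj[OF cC(1)[OF that]] .
      have inv: "inv_into C (T ^^ n\<^sub>0) ((T ^^ n\<^sub>0) y) = y" if "y \<in> A C" for y
        using inv_into_f_f[OF inj, of y] that by (simp add: A_def)
      have "collar (scale k) ((T ^^ n\<^sub>0) ` (I \<inter> C)) = (T ^^ n\<^sub>0) ` A C"
        unfolding A_def collar_def by blast
      then have "inv_into C (T ^^ n\<^sub>0) ` collar (scale k) ((T ^^ n\<^sub>0) ` (I \<inter> C)) = (\<lambda>y. inv_into C (T ^^ n\<^sub>0) ((T ^^ n\<^sub>0) y)) ` A C"
        by (simp add: image_image)
      also have "\<dots> = (\<lambda>y. y) ` A C" by (rule image_cong[OF refl inv])
      finally show ?thesis by simp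
    qed
    have AE: "A C - E \<in> sets borel" "A C - E \<subseteq> I" if "C \<in> CS" for C
      using borel_Diff_open[OF oA[OF that] oE] by (auto simp: A_def)
    let ?e = "vol (U \<inter> (T ^^ n) -` E)"
    let ?N = "\<Union>C\<in>CS. U \<inter> (T ^^ n) -` (A C - E)"
    have Eb: "U \<inter> (T ^^ n) -` E \<in> sets lborel" using pull_open[OF c oE] by simp
    have Ab: "U \<inter> (T ^^ n) -` (A C - E) \<in> sets lborel" if "C \<in> CS" for C
      using pull_borel[OF c AE(1)[OF that]] by simp
    have Nb: "?N \<in> sets lborel" using Ab cntC by (intro sets.countable_UN') auto
    have "(\<Union>V\<in>F. edge k (n + n\<^sub>0) V) \<subseteq> (U \<inter> (T ^^ n) -` E) \<union> ?N"
    proof clarify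
      fix x V assume x: "x \<in> edge k (n + n\<^sub>0) V" and V: "V \<in> F" and nN: "x \<notin> ?N"
      obtain C where C: "C \<in> CS" "V = G C" using V by (auto simp: F_def)
      have TT: "T ^^ (n + n\<^sub>0) = T ^^ n\<^sub>0 \<circ> T ^^ n" by (metis add.commute funpow_add)
      have "(T ^^ (n + n\<^sub>0)) ` G C = (T ^^ n\<^sub>0) ` (I \<inter> C)" unfolding TT image_comp[symmetric] imG ..
      then have xG: "x \<in> G C" "(T ^^ n\<^sub>0) ((T ^^ n) x) \<in> collar (scale k) ((T ^^ n\<^sub>0) ` (I \<inter> C))"
        using x by (simp_all add: edge_def C TT)
      then have "(T ^^ n) x \<in> A C" "x \<in> U" by (auto simp: A_def G_def I_def)
      then show "x \<in> U \<inter> (T ^^ n) -` E" using nN C by auto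
    qed
    then have "vol (\<Union>V\<in>F. edge k (n + n\<^sub>0) V) \<le> vol ((U \<inter> (T ^^ n) -` E) \<union> ?N)"
      using Eb Nb by (intro emeasure_mono) auto
    also have "\<dots> \<le> ?e + vol ?N" using Eb Nb by (rule emeasure_subadditive)
    also have "vol ?N = (\<integral>\<^sup>+C. vol (U \<inter> (T ^^ n) -` (A C - E)) \<partial>count_space CS)"
    proof (intro emeasure_UN_countable cntC Ab)
      show "disjoint_family_on (\<lambda>C. U \<inter> (T ^^ n) -` (A C - E)) CS"
        unfolding disjoint_family_on_def using disjC by (auto simp: A_def)
    qed
    also have "\<dots> \<le> (\<integral>\<^sup>+C. (ennreal K * ?e) * (vol (A C - E) / vol E) \<partial>count_space CS)"
    proof (intro nn_integral_mono)
      fix C assume "C \<in> space (count_space CS)"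
      then have C: "C \<in> CS" by simp
      let ?a = "vol (U \<inter> (T ^^ n) -` (A C - E))"
      \<comment> \<open>Distortion is applied against \<open>E\<close> itself, so that exactly the
        quotient from \<open>complexity\<close> appears.\<close>
      have dd: "?a * vol E \<le> ennreal K * vol (A C - E) * ?e"
        using distortion_emeasure[OF c diam delta(2) AE(1)[OF C] _ borel_open[OF oE]] AE(2)[OF C] EI by (simp add: I_def)
      have "?a = (?a * vol E) / vol E"
        using E0 Efin by (simp add: ennreal_mult_divide_eq)
      also have "\<dots> \<le> (ennreal K * vol (A C - E) * ?e) / vol E"
        using dd by (rule divide_right_mono_ennreal)
      also have "\<dots> = (ennreal K * ?e) * (vol (A C - E) / vol E)"
        by (simp add: ennreal_times_divide ac_simps)
      finally show "?a \<le> (ennreal K * ?e) * (vol (A C - E) / vol E)" .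
    qed
    also have "\<dots> = (ennreal K * ?e) * (\<integral>\<^sup>+C. vol (A C - E) / vol E \<partial>count_space CS)"
      by (rule nn_integral_cmult) simp
    also have "\<dots> \<le> (ennreal K * ?e) * ennreal \<sigma>"
    proof (rule mult_left_mono)
      have "(\<integral>\<^sup>+C. vol (A C - E) / vol E \<partial>count_space CS)
         \<le> (\<Sum>\<^sub>\<infinity>C\<in>CS. vol (A C - E) / vol E)"
        using cntC by (rule nn_integral_count_space_le_infsum)
      also have "\<dots> = complexity X T P \<Lambda> n\<^sub>0 I (scale k)"
        unfolding complexity_def CS_def[symmetric]
      proof (rule infsum_cong)
        fix C assume C: "C \<in> CS"
        show "vol (A C - E) / vol E =
          emeasure lebesgue (inv_into C (T ^^ n\<^sub>0) ` collar (scale k) ((T ^^ n\<^sub>0) ` (I \<inter> C)) - collar (\<Lambda> ^ n\<^sub>0 * scale k) I)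
          / emeasure lebesgue (collar (\<Lambda> ^ n\<^sub>0 * scale k) I)"
          unfolding A_eq[OF C] scale_Suc[symmetric] E_def[symmetric]
          using AE(1)[OF C] oE by simp
      qed
      also have "\<dots> \<le> ennreal \<sigma>"
        using complexity oI neI IX diam delta scale_pos[of k] scale_le[of k] eps
        unfolding controlled_complexity_def I_def[symmetric] by auto
      finally show "(\<integral>\<^sup>+C. vol (A C - E) / vol E \<partial>count_space CS) \<le> ennreal \<sigma>" .
    qed simp
    also have "?e + (ennreal K * ?e) * ennreal \<sigma> = ennreal (1 + K * \<sigma>) * ?e"
    proof -
      have *: "ennreal (1 + K * \<sigma>) = 1 + ennreal K * ennreal \<sigma>"
        using sigma by (simp add: ennreal_mult ennreal_plus)
      show ?thesis unfolding * distrib_right mult_1_left by (simp only: ac_simps)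
    qed
    finally show ?thesis unfolding edgeE by (simp add: add_left_mono)
  qed
  have nonneg: "0 \<le> 1 + K * \<sigma>" using sigma by simp
  have "csum (Z (n + n\<^sub>0)) F = (\<Sum>k. ennreal (r ^ k) * vol (\<Union>V\<in>F. edge k (n + n\<^sub>0) V))"
    by (rule Z_family[OF ref])
  also have "\<dots> \<le> (\<Sum>k. ennreal (r ^ k) * (ennreal (1 + K * \<sigma>) * vol (edge (Suc k) n U)))"
    by (intro suminf_le mult_left_mono step) auto
  also have "\<dots> = (\<Sum>k. ennreal ((1 + K * \<sigma>) / r) * (ennreal (r ^ Suc k) * vol (edge (Suc k) n U)))"
  proof -
    have "ennreal (r ^ k) * ennreal (1 + K * \<sigma>) = ennreal ((1 + K * \<sigma>) / r) * ennreal (r ^ Suc k)" for k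
      using r1 nonneg by (simp add: ennreal_mult[symmetric] del: power_Suc ennreal_plus) (simp add: mult.commute)
    then show ?thesis by (simp only: mult.assoc[symmetric])
  qed
  also have "\<dots> = ennreal ((1 + K * \<sigma>) / r) * (\<Sum>k. ennreal (r ^ Suc k) * vol (edge (Suc k) n U))"
    by (rule ennreal_suminf_cmult)
  \<comment> \<open>The shifted series is the one for \<open>Z n U\<close> without its term at scale
    0.\<close>
  also have "\<dots> \<le> ennreal ((1 + K * \<sigma>) / r) * Z n U"
    unfolding Z_def by (intro mult_left_mono suminf_Suc_le[of "\<lambda>k. ennreal (r ^ k) * vol (edge k n U)"]) simp
  finally show ?thesis using ref by blast
qed

end

section \<open>Cutting images to small diameter\<close>

lemma emeasure_hyperplane:
  assumes "b \<in> Basis"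
  shows "vol {y :: 'a::euclidean_space. y \<bullet> b = c} = 0" and "{y :: 'a. y \<bullet> b = c} \<in> sets borel"
proof -
  show 1: "{y :: 'a. y \<bullet> b = c} \<in> sets borel" by measurable
  have "negligible {y :: 'a. b \<bullet> y = c}" using assms by (intro negligible_hyperplane) auto
  then have "{y :: 'a. y \<bullet> b = c} \<in> null_sets lebesgue"
    by (simp add: negligible_iff_null_sets inner_commute)
  then show "vol {y :: 'a. y \<bullet> b = c} = 0"
    using emeasure_lebesgue_borel[OF 1] by (simp add: null_sets_def)
qed

context growth
begin

text \<open>A fixed finite number of coordinate hyperplanes suffices because \<open>X\<close> is
  bounded. Each is translated within a slab of width \<open>d\<close> to a level whose collars carry
  little mass of \<open>U\<close>; the averaging takes place on \<open>U\<close>, so the cost per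
  hyperplane is a constant times \<open>vol U\<close>, whatever \<open>n\<close> and
  \<open>U\<close> are.\<close>

lemma cut_to_small_diameter:
  "\<exists>C\<ge>0. \<forall>n U. cyl n U \<and> U \<noteq> {} \<longrightarrow> (\<exists>F. refin n U F \<and> (\<forall>V\<in>F. piece n V) \<and>
     csum (Z n) F \<le> Z n U + ennreal C * vol U)"
proof -
  obtain M where M: "0 < M" "\<And>x. x \<in> X \<Longrightarrow> norm x \<le> M" using bounded_X bounded_pos by metis
  \<comment> \<open>Consecutive levels for one coordinate are at most \<open>2 * d\<close> apart,
    and summing over the coordinates bounds the diameter by \<open>\<delta>\<close>.\<close>
  define d where "d = \<delta> / (2 * real DIM('a))"
  have d: "0 < d" using delta by (simp add: d_def)
  define m where "m = \<lceil>M / d\<rceil> + 1"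
  define L where "L = (Basis :: 'a set) \<times> {- m..m}"
  have finL: "finite L" by (simp add: L_def)
  define B where "B = 2 * \<epsilon> / (1 - r * \<Lambda> ^ n\<^sub>0)"
  have B: "0 \<le> B" using eps rate by (simp add: B_def)
  have Bsum: "(\<Sum>k. ennreal (r ^ k) * ennreal (2 * scale k)) \<le> ennreal B"
    using scale_sum[of 2] by (simp add: B_def)
  define \<kappa> where "\<kappa> = (B + 1) / d"
  have \<kappa>: "0 \<le> \<kappa>" using B d by (simp add: \<kappa>_def)
  show ?thesis
  proof (intro exI[of _ "real (card L) * \<kappa>"] conjI allI impI)
    show "0 \<le> real (card L) * \<kappa>" using \<kappa> by simp
    fix n U assume "cyl n U \<and> U \<noteq> {}"
    then have c: "cyl n U" and ne: "U \<noteq> {}" by auto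
    define I where "I = (T ^^ n) ` U"
    have oU: "open U" and oI: "open I" and IX: "I \<subseteq> X"
      using cyl_open[OF c] cyl_open_image[OF c] cyl_image_X[OF c] by (auto simp: I_def)
    \<comment> \<open>Extension by zero off \<open>U\<close> turns the coordinates of
      \<open>T ^^ n\<close>, continuous only on \<open>U\<close>, into Borel functions on the whole
      space.\<close>
    define f where "f b x = (indicator U x *\<^sub>R (T ^^ n) x) \<bullet> b" for b x
    have fU: "f b x = (T ^^ n) x \<bullet> b" if "x \<in> U" for b x using that by (simp add: f_def)
    have fm: "f b \<in> borel_measurable borel" for b
      unfolding f_def using oU cyl_continuous[OF c]
      by (intro borel_measurable_inner borel_measurable_continuous_on_indicator) auto
    have Ufin: "vol U < \<infinity>" by (rule finite_sub_X[OF cyl_X[OF c]])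
    have "\<forall>p\<in>L. \<exists>s. s \<in> {of_int (snd p) * d..of_int (snd p) * d + d} \<and>
      (\<Sum>k. ennreal (r ^ k) * vol {x \<in> U. \<bar>f (fst p) x - s\<bar> < scale k}) \<le> ennreal \<kappa> * vol U"
    proof
      fix p assume "p \<in> L"
      show "\<exists>s. s \<in> {of_int (snd p) * d..of_int (snd p) * d + d} \<and>
      (\<Sum>k. ennreal (r ^ k) * vol {x \<in> U. \<bar>f (fst p) x - s\<bar> < scale k}) \<le> ennreal \<kappa> * vol U"
        using ex_level_small_mass[OF fm borel_open[OF oU] Ufin d less_imp_le[OF scale_pos] B Bsum]
        unfolding \<kappa>_def Bex_def .
    qed
    from bchoice[OF this] obtain s where s: "\<And>p. p \<in> L \<Longrightarrow> s p \<in> {of_int (snd p) * d..of_int (snd p) * d + d}"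
      "\<And>p. p \<in> L \<Longrightarrow> (\<Sum>k. ennreal (r ^ k) * vol {x \<in> U. \<bar>f (fst p) x - s p\<bar> < scale k}) \<le> ennreal \<kappa> * vol U"
      by blast
    define J where "J A = {y \<in> I. \<forall>p\<in>L. if p \<in> A then s p < y \<bullet> fst p else y \<bullet> fst p < s p}" for A
    note J = frontier_cell[OF oI finL, of _ s, folded J_def]
    define G where "G A = U \<inter> (T ^^ n) -` J A" for A
    define F where "F = G ` Pow L - {{}}"
    have GU: "G A \<subseteq> U" for A by (auto simp: G_def)
    have JI: "J A \<subseteq> I" for A by (auto simp: J_def)
    have imG: "(T ^^ n) ` G A = J A" for A unfolding G_def by (rule pull_image) (use JI in \<open>simp add: I_def\<close>)
    have cG: "cyl n (G A)" for A
      by (rule cyl_subset[OF c]) (use pull_open[OF c J(2)] in \<open>auto simp: G_def\<close>)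
    have ref: "refin n U F"
      unfolding refin_def
    proof (intro conjI ballI)
      show "countable F" unfolding F_def using finL by (simp add: countable_finite)
      show "disjoint F"
      proof (rule disjointI)
        fix a b assume ab: "a \<in> F" "b \<in> F" "a \<noteq> b"
        then obtain A A' where A: "A \<subseteq> L" "A' \<subseteq> L" "a = G A" "b = G A'" by (auto simp: F_def)
        then have "A \<noteq> A'" using ab by blast
        then obtain p where p: "p \<in> L" "(p \<in> A) \<noteq> (p \<in> A')" using A by blast
        have False if "x \<in> a" "x \<in> b" for x
        proof -
          let ?y = "(T ^^ n) x"
          have "?y \<in> J A" "?y \<in> J A'" using that A by (auto simp: G_def)
          then have "if p \<in> A then s p < ?y \<bullet> fst p else ?y \<bullet> fst p < s p"
            "if p \<in> A' then s p < ?y \<bullet> fst p else ?y \<bullet> fst p < s p" using p(1) unfolding J_def by blast+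
          then show False using p(2) by (auto split: if_splits)
        qed
        then show "a \<inter> b = {}" by blast
      qed
      fix V assume "V \<in> F"
      then obtain A where A: "V = G A" "V \<noteq> {}" by (auto simp: F_def)
      then show "cyl n V" "V \<noteq> {}" "V \<subseteq> U" using cG GU by auto
    next
      let ?N = "\<Union>p\<in>L. U \<inter> (T ^^ n) -` {y. y \<bullet> fst p = s p}"
      have pB: "fst p \<in> Basis" if "p \<in> L" for p using that by (auto simp: L_def)
      have sub: "U - \<Union>F \<subseteq> ?N"
      proof
        fix x assume x: "x \<in> U - \<Union>F"
        \<comment> \<open>The sign pattern of \<open>x\<close>; its cell contains \<open>x\<close>
          unless the image lies on one of the hyperplanes.\<close>
        let ?A = "{p \<in> L. s p < (T ^^ n) x \<bullet> fst p}"
        have "G ?A = {} \<or> G ?A \<in> F" by (auto simp: F_def)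
        then have "x \<notin> G ?A" using x by blast
        then have "(T ^^ n) x \<notin> J ?A" using x by (simp add: G_def)
        then obtain p where "p \<in> L" "\<not> (if p \<in> ?A then s p < (T ^^ n) x \<bullet> fst p else (T ^^ n) x \<bullet> fst p < s p)"
          using x unfolding J_def I_def by blast
        then have "p \<in> L" "(T ^^ n) x \<bullet> fst p = s p" by (auto split: if_splits)
        then show "x \<in> ?N" using x by blast
      qed
      have "?N \<in> null_sets lborel"
      proof (intro null_sets_UN' null_setsI)
        fix p assume p: "p \<in> L"
        show "vol (U \<inter> (T ^^ n) -` {y. y \<bullet> fst p = s p}) = 0"
          by (rule pull_null[OF c emeasure_hyperplane(2)[OF pB[OF p]] emeasure_hyperplane(1)[OF pB[OF p]]])
        show "U \<inter> (T ^^ n) -` {y. y \<bullet> fst p = s p} \<in> sets lborel"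
          using pull_borel[OF c emeasure_hyperplane(2)[OF pB[OF p]]] by simp
      qed (use finL in \<open>simp add: countable_finite\<close>)
      then have "vol (U - \<Union>F) \<le> 0"
        using emeasure_mono[OF sub, of lborel] by (auto simp: null_sets_def)
      then show "vol (U - \<Union>F) = 0" by simp
    qed
    have pieces: "piece n V" if V: "V \<in> F" for V
    proof -
      obtain A where A: "V = G A" "V \<noteq> {}" using V by (auto simp: F_def)
      have gap: "\<bar>y \<bullet> b - y' \<bullet> b\<bar> \<le> 2 * d" if y: "y \<in> J A" "y' \<in> J A" "b \<in> Basis" for y y' b
      proof -
        have le: "y' \<bullet> b - y \<bullet> b \<le> 2 * d" if y: "y \<in> J A" "y' \<in> J A" for y y'
        proof (rule ccontr)
          assume gt: "\<not> ?thesis"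
          \<comment> \<open>The first slab of index \<open>i\<close> starting at or above
            \<open>y\<close>; if the gap exceeds \<open>2 * d\<close> it ends before
            \<open>y'\<close>, so its level separates the two points, which cannot then share a
            cell.\<close>
          define i where "i = \<lceil>y \<bullet> b / d\<rceil>"
          have yd: "y \<bullet> b \<le> of_int i * d" using d by (simp add: i_def pos_divide_le_eq[symmetric])
          have "of_int i < y \<bullet> b / d + 1" unfolding i_def by linarith
          then have "(of_int i + 1) * d < (y \<bullet> b / d + 2) * d" using d by (intro mult_strict_right_mono) auto
          also have "\<dots> = y \<bullet> b + 2 * d" using d by (simp add: distrib_right)
          finally have i2: "of_int i * d + d < y' \<bullet> b" using gt by (simp add: distrib_right)
          have "norm y \<le> M" using y JI IX M(2) by blast
          then have "\<bar>y \<bullet> b\<bar> \<le> M" using Basis_le_norm[OF \<open>b \<in> Basis\<close>, of y] by linarith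
          then have "\<bar>y \<bullet> b / d\<bar> \<le> M / d" using d by (simp add: abs_divide divide_right_mono)
          then have "- m \<le> i" "i \<le> m" unfolding i_def m_def by linarith+
          then have "(b, i) \<in> L" unfolding L_def using \<open>b \<in> Basis\<close> by simp
          then have "s (b, i) \<in> {of_int i * d..of_int i * d + d}"
            and "if (b, i) \<in> A then s (b, i) < y \<bullet> b else y \<bullet> b < s (b, i)"
              "if (b, i) \<in> A then s (b, i) < y' \<bullet> b else y' \<bullet> b < s (b, i)"
            using s(1)[of "(b, i)"] y unfolding J_def by force+
          then show False using yd i2 by (auto split: if_splits)
        qed
        show ?thesis using le[OF y(1,2)] le[OF y(2,1)] by linarith
      qed
      have dist: "norm (y - y') \<le> \<delta>" if y: "y \<in> J A" "y' \<in> J A" for y y'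
      proof -
        have "norm (y - y') \<le> (\<Sum>b\<in>Basis. \<bar>(y - y') \<bullet> b\<bar>)" by (rule norm_le_l1)
        also have "\<dots> \<le> (\<Sum>b\<in>(Basis :: 'a set). 2 * d)"
          using gap[OF y] by (intro sum_mono) (simp add: inner_diff_left)
        also have "\<dots> = \<delta>" by (simp add: d_def)
        finally show ?thesis .
      qed
      have "diameter (J A) \<le> \<delta>"
        using delta(1) dist by (intro diameter_le) auto
      then show ?thesis using cG[of A] A imG[of A] by (simp add: piece_def)
    qed
    \<comment> \<open>Nearness to a hyperplane in the image is, on \<open>U\<close>, the condition
      on \<open>f\<close> for which the levels were chosen.\<close>
    have edge: "(\<Union>V\<in>F. edge k n V) \<subseteq> edge k n U \<union> (\<Union>p\<in>L. {x \<in> U. \<bar>f (fst p) x - s p\<bar> < scale k})" for k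
    proof clarify
      fix x V assume V: "V \<in> F" and x: "x \<in> edge k n V" and nx: "x \<notin> (\<Union>p\<in>L. {x \<in> U. \<bar>f (fst p) x - s p\<bar> < scale k})"
      obtain A where A: "V = G A" using V by (auto simp: F_def)
      have xU: "x \<in> U" using x A GU edge_subset by blast
      have "(T ^^ n) x \<in> collar (scale k) (J A)" using x unfolding edge_def A imG by simp
      from collar_subset[OF JI J(1) this] show "x \<in> edge k n U"
      proof
        assume "(T ^^ n) x \<in> collar (scale k) I"
        then show ?thesis using xU by (simp add: edge_def I_def)
      next
        assume "\<exists>q\<in>{q. \<exists>p\<in>L. q \<bullet> fst p = s p}. dist ((T ^^ n) x) q < scale k"
        then obtain q p where q: "p \<in> L" "q \<bullet> fst p = s p" "dist ((T ^^ n) x) q < scale k" by auto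
        have "\<bar>((T ^^ n) x - q) \<bullet> fst p\<bar> \<le> norm ((T ^^ n) x - q)"
          using q by (intro Basis_le_norm) (auto simp: L_def)
        then have "\<bar>f (fst p) x - s p\<bar> < scale k"
          using q by (simp add: fU[OF xU] inner_diff_left dist_norm)
        then show ?thesis using nx q xU by blast
      qed
    qed
    have lm: "{x \<in> U. \<bar>f b x - t\<bar> < e} \<in> sets lborel" for b t e
    proof -
      note [measurable] = fm
      have [measurable]: "U \<in> sets borel" using oU by simp
      show ?thesis by measurable
    qed
    have "csum (Z n) F = (\<Sum>k. ennreal (r ^ k) * vol (\<Union>V\<in>F. edge k n V))"
      by (rule Z_family[OF ref])
    also have "\<dots> \<le> (\<Sum>k. ennreal (r ^ k) * vol (edge k n U) +
        (\<Sum>p\<in>L. ennreal (r ^ k) * vol {x \<in> U. \<bar>f (fst p) x - s p\<bar> < scale k}))"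
    proof (intro suminf_le)
      fix k
      let ?N = "\<lambda>p. {x \<in> U. \<bar>f (fst p) x - s p\<bar> < scale k}"
      have e1: "edge k n U \<in> sets lborel" using edge_open[OF c] by simp
      have e2: "(\<Union>p\<in>L. ?N p) \<in> sets lborel" using lm finL by (intro sets.finite_UN) auto
      have "vol (\<Union>V\<in>F. edge k n V) \<le> vol (edge k n U \<union> (\<Union>p\<in>L. ?N p))"
        by (intro emeasure_mono edge sets.Un e1 e2)
      also have "\<dots> \<le> vol (edge k n U) + vol (\<Union>p\<in>L. ?N p)"
        by (rule emeasure_subadditive[OF e1 e2])
      also have "\<dots> \<le> vol (edge k n U) + (\<Sum>p\<in>L. vol (?N p))"
        using lm finL by (intro add_left_mono emeasure_subadditive_finite) auto
      finally show "ennreal (r ^ k) * vol (\<Union>V\<in>F. edge k n V) \<le>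
        ennreal (r ^ k) * vol (edge k n U) + (\<Sum>p\<in>L. ennreal (r ^ k) * vol (?N p))"
        unfolding sum_distrib_left[symmetric] distrib_left[symmetric] by (rule mult_left_mono) simp
    qed auto
    also have "\<dots> = Z n U + (\<Sum>k. \<Sum>p\<in>L. ennreal (r ^ k) * vol {x \<in> U. \<bar>f (fst p) x - s p\<bar> < scale k})"
      unfolding Z_def by (intro suminf_add[symmetric]) auto
    also have "(\<Sum>k. \<Sum>p\<in>L. ennreal (r ^ k) * vol {x \<in> U. \<bar>f (fst p) x - s p\<bar> < scale k})
      = (\<Sum>p\<in>L. \<Sum>k. ennreal (r ^ k) * vol {x \<in> U. \<bar>f (fst p) x - s p\<bar> < scale k})"
      by (rule suminf_sum) auto
    also have "\<dots> \<le> (\<Sum>p\<in>L. ennreal \<kappa> * vol U)"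
      by (intro sum_mono s(2))
    also have "\<dots> = ennreal (real (card L) * \<kappa>) * vol U"
      using \<kappa> by (simp add: ennreal_mult mult.assoc flip: ennreal_of_nat_eq_real_of_nat)
    finally have "csum (Z n) F \<le> Z n U + ennreal (real (card L) * \<kappa>) * vol U"
      by (simp add: add_left_mono)
    then show "\<exists>F. refin n U F \<and> (\<forall>V\<in>F. piece n V) \<and>
       csum (Z n) F \<le> Z n U + ennreal (real (card L) * \<kappa>) * vol U"
      using ref pieces by blast
  qed
qed

text \<open>An inequality of Lasota-Yorke type, with \<open>Z\<close> as the strong and volume as
  the weak quantity.\<close>

definition grows :: "nat \<Rightarrow> real \<Rightarrow> real \<Rightarrow> bool" where
  "grows s A C \<longleftrightarrow> (\<forall>n U. piece n U \<longrightarrow> (\<exists>F. refin (n + s) U F \<and> (\<forall>V\<in>F. piece (n + s) V) \<and>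
     csum (Z (n + s)) F \<le> ennreal A * Z n U + ennreal C * vol U))"

lemma growsD: "grows s A C \<Longrightarrow> piece n U \<Longrightarrow> \<exists>F. refin (n + s) U F \<and> (\<forall>V\<in>F. piece (n + s) V) \<and>
     csum (Z (n + s)) F \<le> ennreal A * Z n U + ennreal C * vol U"
  unfolding grows_def by blast

lemma piece_cyl: "piece n U \<Longrightarrow> cyl n U" and piece_ne: "piece n U \<Longrightarrow> U \<noteq> {}"
  by (auto simp: piece_def)

lemma grows_add:
  assumes 1: "grows s A C" and 2: "grows t B E" and nn: "0 \<le> A" "0 \<le> B" "0 \<le> C" "0 \<le> E"
  shows "grows (s + t) (B * A) (B * C + E)"
  unfolding grows_def
proof (intro allI impI)
  fix n U assume pc: "piece n U"
  have oU: "open U" by (rule cyl_open[OF piece_cyl[OF pc]])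
  obtain F where F: "refin (n + s) U F" "\<forall>V\<in>F. piece (n + s) V"
    "csum (Z (n + s)) F \<le> ennreal A * Z n U + ennreal C * vol U"
    using growsD[OF 1 pc] by blast
  have "\<forall>V\<in>F. \<exists>G. refin (n + s + t) V G \<and> (\<forall>W\<in>G. piece (n + s + t) W) \<and>
     csum (Z (n + s + t)) G \<le> ennreal B * Z (n + s) V + ennreal E * vol V"
    using growsD[OF 2] F(2) by blast
  from bchoice[OF this] obtain G where G: "\<And>V. V \<in> F \<Longrightarrow> refin (n + s + t) V (G V)"
    "\<And>V W. V \<in> F \<Longrightarrow> W \<in> G V \<Longrightarrow> piece (n + s + t) W"
    "\<And>V. V \<in> F \<Longrightarrow> csum (Z (n + s + t)) (G V) \<le> ennreal B * Z (n + s) V + ennreal E * vol V"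
    by blast
  have "csum (Z (n + s + t)) (\<Union>V\<in>F. G V) \<le>
    ennreal B * (csum (Z (n + s)) F) + ennreal E * vol U"
    by (rule sum_bind_le[OF F(1) G(1) oU G(3)])
  also have "\<dots> \<le> ennreal B * (ennreal A * Z n U + ennreal C * vol U) + ennreal E * vol U"
    by (intro add_right_mono mult_left_mono F(3)) simp
  also have "\<dots> = ennreal (B * A) * Z n U + ennreal (B * C + E) * vol U"
    using nn by (simp add: ennreal_mult ennreal_plus distrib_left distrib_right mult.assoc add.assoc)
  finally have "csum (Z (n + s + t)) (\<Union>V\<in>F. G V) \<le> \<dots>" .
  then show "\<exists>F. refin (n + (s + t)) U F \<and> (\<forall>V\<in>F. piece (n + (s + t)) V) \<and>
     (\<integral>\<^sup>+V. Z (n + (s + t)) V \<partial>count_space F) \<le> ennreal (B * A) * Z n U + ennreal (B * C + E) * vol U"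
    using refin_bind[OF oU F(1) G(1)] G(2) unfolding add.assoc[symmetric]
    by (intro exI[of _ "\<Union>V\<in>F. G V"]) simp
qed

definition "\<theta> = (1 + K * \<sigma>) / r"

lemma theta: "0 < \<theta>" "\<theta> < 1"
proof -
  have "0 \<le> K * \<sigma>" using sigma by simp
  then show "0 < \<theta>" "\<theta> < 1" using r1 rate by (auto simp: \<theta>_def)
qed

text \<open>Branching contracts \<open>Z\<close> but may leave large images; cutting restores the
  diameter bound at the price of the volume term.\<close>

lemma grows_step: "\<exists>C\<ge>0. grows n\<^sub>0 \<theta> C"
proof -
  obtain C where C: "C \<ge> 0" "\<And>n U. cyl n U \<Longrightarrow> U \<noteq> {} \<Longrightarrow> (\<exists>F. refin n U F \<and> (\<forall>V\<in>F. piece n V) \<and>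
     csum (Z n) F \<le> Z n U + ennreal C * vol U)"
    using cut_to_small_diameter by blast
  have "grows n\<^sub>0 \<theta> C"
    unfolding grows_def
  proof (intro allI impI)
    fix n U assume pc: "piece n U"
    have oU: "open U" by (rule cyl_open[OF piece_cyl[OF pc]])
    obtain F where F: "refin (n + n\<^sub>0) U F" "csum (Z (n + n\<^sub>0)) F \<le> ennreal \<theta> * Z n U"
      using growth_step[OF pc] unfolding \<theta>_def by blast
    have "\<forall>V\<in>F. \<exists>G. refin (n + n\<^sub>0) V G \<and> (\<forall>W\<in>G. piece (n + n\<^sub>0) W) \<and>
       csum (Z (n + n\<^sub>0)) G \<le> Z (n + n\<^sub>0) V + ennreal C * vol V"
      using C(2) refinD(3,5)[OF F(1)] by simp
    from bchoice[OF this] obtain G where G: "\<And>V. V \<in> F \<Longrightarrow> refin (n + n\<^sub>0) V (G V)"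
      "\<And>V W. V \<in> F \<Longrightarrow> W \<in> G V \<Longrightarrow> piece (n + n\<^sub>0) W"
      "\<And>V. V \<in> F \<Longrightarrow> csum (Z (n + n\<^sub>0)) (G V) \<le> 1 * Z (n + n\<^sub>0) V + ennreal C * vol V"
      by auto
    have "csum (Z (n + n\<^sub>0)) (\<Union>V\<in>F. G V) \<le>
      1 * (csum (Z (n + n\<^sub>0)) F) + ennreal C * vol U"
      by (rule sum_bind_le[OF F(1) G(1) oU G(3)])
    also have "\<dots> \<le> ennreal \<theta> * Z n U + ennreal C * vol U"
      using F(2) by (simp add: add_right_mono)
    finally show "\<exists>F. refin (n + n\<^sub>0) U F \<and> (\<forall>V\<in>F. piece (n + n\<^sub>0) V) \<and>
       csum (Z (n + n\<^sub>0)) F \<le> ennreal \<theta> * Z n U + ennreal C * vol U"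
      using refin_bind[OF oU F(1) G(1)] G(2) by blast
  qed
  then show ?thesis using C(1) by blast
qed

text \<open>The error constants obey \<open>x \<mapsto> \<theta> * x + c\<close>, and
  \<open>C\<close> is chosen so that this map does not exceed it. Uniformity in \<open>N\<close> is
  essential, since \<open>N\<close> is fixed only after constants that depend on
  \<open>C\<close>.\<close>

lemma grows_iterate: "\<exists>C\<ge>1. \<forall>N. grows (N * n\<^sub>0) (\<theta> ^ N) C"
proof -
  obtain c where c: "0 \<le> c" "grows n\<^sub>0 \<theta> c" using grows_step by blast
  define C where "C = (c + 1) / (1 - \<theta>)"
  have C1: "1 \<le> C" using c theta by (simp add: C_def)
  have "C * (1 - \<theta>) = c + 1" using theta by (simp add: C_def)
  then have C: "\<theta> * C + c \<le> C" by (simp add: algebra_simps)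
  have "grows (N * n\<^sub>0) (\<theta> ^ N) C" for N
  proof (induction N)
    case 0
    have "\<exists>F. refin n U F \<and> (\<forall>V\<in>F. piece n V) \<and> csum (Z n) F \<le> 1 * Z n U + ennreal C * vol U"
      if pc: "piece n U" for n U
    proof (intro exI[of _ "{U}"] conjI)
      show "refin n U {U}" by (rule refin_self[OF piece_cyl[OF pc] piece_ne[OF pc]])
      show "csum (Z n) {U} \<le> 1 * Z n U + ennreal C * vol U"
        by (simp add: nn_integral_count_space_finite)
    qed (use pc in simp)
    then show ?case by (simp add: grows_def)
  next
    case (Suc N)
    have "grows (N * n\<^sub>0 + n\<^sub>0) (\<theta> * \<theta> ^ N) (\<theta> * C + c)"
      using theta c C1 by (intro grows_add[OF Suc c(2)]) auto
    then have g: "grows (Suc N * n\<^sub>0) (\<theta> ^ Suc N) (\<theta> * C + c)" by (simp add: add.commute)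
    have mono: "ennreal (\<theta> * C + c) * y \<le> ennreal C * y" for y
      using C by (intro mult_right_mono ennreal_leI) auto
    show ?case
      unfolding grows_def
    proof (intro allI impI)
      fix n U assume pc: "piece n U"
      show "\<exists>F. refin (n + Suc N * n\<^sub>0) U F \<and> (\<forall>V\<in>F. piece (n + Suc N * n\<^sub>0) V) \<and>
        csum (Z (n + Suc N * n\<^sub>0)) F \<le> ennreal (\<theta> ^ Suc N) * Z n U + ennreal C * vol U"
        using growsD[OF g pc] by (meson add_left_mono mono order_trans)
    qed
  qed
  then show ?thesis using C1 by blast
qed

end

section \<open>Ergodicity and the choice of the base\<close>

context piecewise_expanding
begin

lemma cyl_image:
  assumes "cyl (m + k) V"
  shows "cyl k ((T ^^ m) ` V)"
proof -
  have c: "cyl m V" using assms unfolding cyl_def by auto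
  have "\<exists>B\<in>P. (T ^^ i) ` (T ^^ m) ` V \<subseteq> B" if "i < k" for i
  proof -
    have "(T ^^ i) ` (T ^^ m) ` V = (T ^^ (i + m)) ` V" by (simp add: funpow_add image_comp)
    then show ?thesis using assms that unfolding cyl_def by simp
  qed
  then show ?thesis using cyl_open_image[OF c] cyl_image_X[OF c] unfolding cyl_def by blast
qed

text \<open>Only points reached along branches count, as \<open>T\<close> is arbitrary off
  \<open>\<Union>P\<close>; this also makes the set open. Positive \<open>n\<close> ensures that
  return times exceed the current time.\<close>

definition reach :: "'a set \<Rightarrow> 'a set" where
  "reach B = {y. \<exists>n V. 0 < n \<and> cyl n V \<and> V \<subseteq> B \<and> y \<in> (T ^^ n) ` V}"

lemma reachI: "0 < n \<Longrightarrow> cyl n V \<Longrightarrow> V \<subseteq> B \<Longrightarrow> y \<in> (T ^^ n) ` V \<Longrightarrow> y \<in> reach B"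
  unfolding reach_def by blast

lemma reachE:
  assumes "y \<in> reach B"
  obtains n V where "0 < n" "cyl n V" "V \<subseteq> B" "y \<in> (T ^^ n) ` V"
  using assms unfolding reach_def by blast

lemma open_reach: "open (reach B)"
proof -
  have "reach B = \<Union>{(T ^^ n) ` V | n V. 0 < n \<and> cyl n V \<and> V \<subseteq> B}" unfolding reach_def by blast
  then show ?thesis using cyl_open_image by (auto intro!: open_Union)
qed

lemma funpow_add_apply: "(T ^^ (m + n)) x = (T ^^ n) ((T ^^ m) x)"
  by (subst add.commute) (simp add: funpow_add)

lemma cyl_pull:
  assumes "cyl m U" "cyl n V"
  shows "cyl (m + n) (U \<inter> (T ^^ m) -` V)"
proof (rule cyl_add)
  have o: "open (U \<inter> (T ^^ m) -` V)" by (rule pull_open[OF assms(1) cyl_open[OF assms(2)]])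
  show c: "cyl m (U \<inter> (T ^^ m) -` V)" by (rule cyl_subset[OF assms(1) o]) auto
  show "cyl n ((T ^^ m) ` (U \<inter> (T ^^ m) -` V))"
    by (rule cyl_subset[OF assms(2) cyl_open_image[OF c]]) auto
qed

lemma reach_forward:
  assumes "y \<in> reach B" "cyl k W" "y \<in> W"
  shows "(T ^^ k) y \<in> reach B"
  using assms(1)
proof (rule reachE)
  fix n V assume V: "0 < n" "cyl n V" "V \<subseteq> B" "y \<in> (T ^^ n) ` V"
  then obtain v where v: "v \<in> V" "y = (T ^^ n) v" by blast
  show ?thesis
  proof (rule reachI)
    show "0 < n + k" using V by simp
    show "cyl (n + k) (V \<inter> (T ^^ n) -` W)" by (rule cyl_pull[OF V(2) assms(2)])
    show "V \<inter> (T ^^ n) -` W \<subseteq> B" using V by blast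
    have "v \<in> V \<inter> (T ^^ n) -` W" using v assms(3) by simp
    then show "(T ^^ k) y \<in> (T ^^ (n + k)) ` (V \<inter> (T ^^ n) -` W)"
      using funpow_add_apply[of n k v] v(2) by (metis imageI)
  qed
qed

lemma cyl_P: "B \<in> P \<Longrightarrow> cyl (Suc 0) B"
  using branch[of B] by (auto simp: cyl_def)

lemma meets_P:
  assumes "open B" "B \<noteq> {}" "B \<subseteq> X"
  shows "\<exists>O'\<in>P. B \<inter> O' \<noteq> {}"
proof (rule ccontr)
  assume "\<not> ?thesis"
  then have "B \<subseteq> X - \<Union>P" using assms by blast
  then have "vol B \<le> vol (X - \<Union>P)"
    using P_Union_borel by (intro emeasure_mono) auto
  then show False using P_cover emeasure_open_pos[OF assms(1,2)] by simp
qed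

text \<open>\<open>reach B\<close> is only forward invariant. The set \<open>A\<close> of points
  whose orbit enters it along a branch is invariant modulo 0 in both directions, open and nonempty,
  so ergodicity makes its complement null.\<close>

lemma reach_eventually_full:
  assumes erg: "ergodic X T" and B: "open B" "B \<noteq> {}" "B \<subseteq> X"
  shows "\<exists>A. open A \<and> vol (X - A) = 0 \<and>
    (\<forall>x\<in>A. \<exists>n V. cyl n V \<and> x \<in> V \<and> (T ^^ n) x \<in> reach B)"
proof -
  define A where "A = {x. \<exists>n V. cyl n V \<and> x \<in> V \<and> (T ^^ n) x \<in> reach B}"
  have AI: "x \<in> A" if "cyl n V" "x \<in> V" "(T ^^ n) x \<in> reach B" for x n V
    using that unfolding A_def by blast
  have A: "A = \<Union>{V \<inter> (T ^^ n) -` reach B | n V. cyl n V}" unfolding A_def by blast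
  have oA: "open A" unfolding A using pull_open[OF _ open_reach] by (auto intro!: open_Union)
  have AX: "A \<subseteq> X" unfolding A using cyl_X by blast
  have cX: "cyl 0 X" by (rule cyl_0[OF open_X]) simp
  have ne: "A \<noteq> {}"
  proof -
    obtain O' where O': "O' \<in> P" "B \<inter> O' \<noteq> {}" using meets_P[OF B] by blast
    have c: "cyl (Suc 0) (B \<inter> O')"
      using B(1) branch(1)[OF O'(1)] by (intro cyl_subset[OF cyl_P[OF O'(1)]]) auto
    obtain v where v: "v \<in> B \<inter> O'" using O'(2) by blast
    have "(T ^^ Suc 0) v \<in> reach B" by (rule reachI[OF _ c]) (use v in auto)
    then have "v \<in> A" by (rule AI[OF c v])
    then show ?thesis by blast
  qed
  \<comment> \<open>Backward invariance: the branch at \<open>T x\<close> is prolonged by the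
    partition element containing \<open>x\<close>.\<close>
  have "T -` A \<inter> X - A \<subseteq> X - \<Union>P"
  proof
    fix x assume x: "x \<in> T -` A \<inter> X - A"
    have "x \<notin> \<Union>P"
    proof
      assume "x \<in> \<Union>P"
      then obtain O' where O': "O' \<in> P" "x \<in> O'" by blast
      obtain n V where V: "cyl n V" "T x \<in> V" "(T ^^ n) (T x) \<in> reach B" using x unfolding A_def by blast
      have "x \<in> A"
      proof (rule AI)
        show "cyl (Suc 0 + n) (O' \<inter> (T ^^ Suc 0) -` V)" by (rule cyl_pull[OF cyl_P[OF O'(1)] V(1)])
        show "x \<in> O' \<inter> (T ^^ Suc 0) -` V" using O' V by simp
        show "(T ^^ (Suc 0 + n)) x \<in> reach B" using V(3) funpow_add_apply[of "Suc 0" n x] by simp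
      qed
      then show False using x by blast
    qed
    then show "x \<in> X - \<Union>P" using x by blast
  qed
  \<comment> \<open>Forward invariance: the first step of the branch at \<open>x\<close> is dropped;
    if there is none, \<open>reach_forward\<close> applies.\<close>
  moreover have "A - (T -` A \<inter> X) \<subseteq> X - \<Union>P"
  proof
    fix x assume x: "x \<in> A - (T -` A \<inter> X)"
    then have xX: "x \<in> X" and TxA: "T x \<notin> A" using AX by auto
    have "x \<notin> \<Union>P"
    proof
      assume "x \<in> \<Union>P"
      then obtain O' where O': "O' \<in> P" "x \<in> O'" by blast
      then have TX: "T x \<in> X" using branch(3)[OF O'(1)] by blast
      obtain n V where V: "cyl n V" "x \<in> V" "(T ^^ n) x \<in> reach B" using x unfolding A_def by blast
      show False
      proof (cases n)
        case 0
        have "(T ^^ Suc 0) x \<in> reach B" by (rule reach_forward[OF _ cyl_P[OF O'(1)] O'(2)]) (use V 0 in simp)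
        then have "T x \<in> A" using TX by (intro AI[OF cX]) auto
        then show False using TxA by contradiction
      next
        case (Suc m)
        have "cyl m ((T ^^ Suc 0) ` V)" using cyl_image[of "Suc 0" m V] V(1) Suc by simp
        moreover have "T x \<in> (T ^^ Suc 0) ` V" using V(2) by simp
        moreover have "(T ^^ m) (T x) \<in> reach B" using V(3) Suc funpow_add_apply[of "Suc 0" m x] by simp
        ultimately have "T x \<in> A" by (rule AI)
        then show False using TxA by contradiction
      qed
    qed
    then show "x \<in> X - \<Union>P" using xX by blast
  qed
  ultimately have "(T -` A \<inter> X - A) \<union> (A - (T -` A \<inter> X)) \<subseteq> X - \<Union>P" by blast
  moreover have "X - \<Union>P \<in> null_sets lebesgue" using partition_P by (simp add: open_partition_def)
  ultimately have "eq_mod0 (T -` A \<inter> X) A" unfolding eq_mod0_def by (rule null_sets_completion_subset)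
  moreover have "A \<in> sets lebesgue" using oA by simp
  ultimately have "emeasure lebesgue A = 0 \<or> emeasure lebesgue (X - A) = 0"
    using erg AX unfolding ergodic_def by blast
  moreover have "emeasure lebesgue A \<noteq> 0"
    using emeasure_open_pos[OF oA ne] oA by (simp add: emeasure_lebesgue_borel)
  ultimately have "vol (X - A) = 0"
    using emeasure_lebesgue_borel[OF borel_Diff_open[OF open_X oA]] by simp
  then show ?thesis using oA unfolding A_def by blast
qed

text \<open>The sets \<open>reach B\<close> themselves need not have full measure, but almost every orbit eventually
  enters each of them and then stays there.\<close>

lemma common_target:
  assumes erg: "ergodic X T" and X: "X \<noteq> {}"
    and fin: "finite \<B>" and B: "\<And>B. B \<in> \<B> \<Longrightarrow> open B \<and> B \<noteq> {} \<and> B \<subseteq> X"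
  shows "\<exists>z\<in>X. \<forall>B\<in>\<B>. z \<in> reach B"
proof -
  have "\<forall>B\<in>\<B>. \<exists>A. open A \<and> vol (X - A) = 0 \<and>
    (\<forall>x\<in>A. \<exists>n V. cyl n V \<and> x \<in> V \<and> (T ^^ n) x \<in> reach B)"
    using reach_eventually_full[OF erg] B by blast
  from bchoice[OF this] obtain A where A: "\<And>B. B \<in> \<B> \<Longrightarrow> open (A B)"
    "\<And>B. B \<in> \<B> \<Longrightarrow> vol (X - A B) = 0"
    "\<And>B x. B \<in> \<B> \<Longrightarrow> x \<in> A B \<Longrightarrow> \<exists>n V. cyl n V \<and> x \<in> V \<and> (T ^^ n) x \<in> reach B" by blast
  let ?N = "(\<Union>B\<in>\<B>. X - A B) \<union> (\<Union>n. X - \<Union>(IP n))"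
  have "?N \<in> null_sets lborel"
  proof (intro null_sets.Un null_sets_UN null_sets_UN' null_setsI)
    show "countable \<B>" using fin by (rule countable_finite)
    show "vol (X - A B) = 0" "X - A B \<in> sets lborel" if "B \<in> \<B>" for B
      using A(1,2)[OF that] borel_Diff_open[OF open_X] by auto
    show "vol (X - \<Union>(IP n)) = 0" "X - \<Union>(IP n) \<in> sets lborel" for n
      using IP_cover borel_Diff_open[OF open_X IP_open_Union] by auto
  qed
  moreover have "X \<notin> null_sets lborel" using emeasure_open_pos[OF open_X X] by auto
  ultimately have "\<not> X \<subseteq> ?N" using null_sets_subset[of ?N lborel X] open_X by auto
  then obtain x where xN: "x \<in> X" "x \<notin> ?N" unfolding subset_iff by meson
  have x: "x \<in> X" "\<And>B. B \<in> \<B> \<Longrightarrow> x \<in> A B" "\<And>n. x \<in> \<Union>(IP n)"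
    using xN by simp_all
  have "\<forall>B\<in>\<B>. \<exists>n. (T ^^ n) x \<in> reach B" using A(3) x(2) by blast
  from bchoice[OF this] obtain n where n: "\<And>B. B \<in> \<B> \<Longrightarrow> (T ^^ n B) x \<in> reach B" by blast
  \<comment> \<open>Past the latest entrance time the orbit is in all the sets
    \<open>reach B\<close> at once.\<close>
  define N where "N = Max (insert 0 (n ` \<B>))"
  have nN: "n B \<le> N" if "B \<in> \<B>" for B unfolding N_def using fin that by (intro Max_ge) auto
  obtain C where C: "C \<in> IP N" "x \<in> C" using x(3) by blast
  show ?thesis
  proof (intro bexI ballI)
    show "(T ^^ N) x \<in> X" using cyl_image_X[OF IP_cyl[OF C(1)]] C(2) by blast
    fix B assume B: "B \<in> \<B>"
    have N: "n B + (N - n B) = N" using nN[OF B] by simp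
    have "cyl (N - n B) ((T ^^ n B) ` C)" by (rule cyl_image) (use N IP_cyl[OF C(1)] in simp)
    from reach_forward[OF n[OF B] this] C(2) have "(T ^^ (N - n B)) ((T ^^ n B) x) \<in> reach B" by blast
    then show "(T ^^ N) x \<in> reach B" using funpow_add_apply[of "n B" "N - n B" x] N by simp
  qed
qed

text \<open>For finitely many \<open>B\<close> the images containing the common target intersect in
  an open set.\<close>

lemma common_ball:
  assumes erg: "ergodic X T" and X: "X \<noteq> {}"
    and fin: "finite \<B>" and B: "\<And>B. B \<in> \<B> \<Longrightarrow> open B \<and> B \<noteq> {} \<and> B \<subseteq> X" and \<rho>: "0 < \<rho>"
  shows "\<exists>z R. 0 < R \<and> R \<le> \<rho> \<and> cball z R \<subseteq> X \<and>
    (\<forall>B\<in>\<B>. \<exists>n V. 0 < n \<and> cyl n V \<and> V \<subseteq> B \<and> cball z R \<subseteq> (T ^^ n) ` V)"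
proof -
  obtain z where z: "z \<in> X" "\<And>B. B \<in> \<B> \<Longrightarrow> z \<in> reach B" using common_target[OF erg X fin B] by blast
  have "\<forall>B\<in>\<B>. \<exists>p. 0 < fst p \<and> cyl (fst p) (snd p) \<and> snd p \<subseteq> B \<and> z \<in> (T ^^ fst p) ` snd p"
    using z(2) unfolding reach_def by simp
  from bchoice[OF this] obtain p where p: "\<And>B. B \<in> \<B> \<Longrightarrow> 0 < fst (p B)"
    "\<And>B. B \<in> \<B> \<Longrightarrow> cyl (fst (p B)) (snd (p B))" "\<And>B. B \<in> \<B> \<Longrightarrow> snd (p B) \<subseteq> B"
    "\<And>B. B \<in> \<B> \<Longrightarrow> z \<in> (T ^^ fst (p B)) ` snd (p B)" by blast
  let ?S = "X \<inter> (\<Inter>B\<in>\<B>. (T ^^ fst (p B)) ` snd (p B))"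
  have "open ?S" using open_X cyl_open_image[OF p(2)] fin by (intro open_Int open_INT) auto
  moreover have "z \<in> ?S" using z p(4) by blast
  ultimately obtain e where e: "0 < e" "cball z e \<subseteq> ?S" by (meson open_contains_cball)
  define R where "R = min e \<rho>"
  have "0 < R" "R \<le> \<rho>" using e \<rho> by (auto simp: R_def)
  moreover have sub: "cball z R \<subseteq> ?S" using e(2) subset_cball[of R e z] by (auto simp: R_def)
  moreover have "\<forall>B\<in>\<B>. \<exists>n V. 0 < n \<and> cyl n V \<and> V \<subseteq> B \<and> cball z R \<subseteq> (T ^^ n) ` V"
    using p(1-3) sub by blast
  ultimately show ?thesis by blast
qed

section \<open>The boundary of a preimage of the common ball\<close>

lemma inverse_lipschitz:
  assumes c: "cyl n V" and xy: "x \<in> (T ^^ n) ` V" "y \<in> (T ^^ n) ` V" "dist x y \<le> \<epsilon>\<^sub>1"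
  shows "dist (inv_into V (T ^^ n) x) (inv_into V (T ^^ n) y) \<le> \<Lambda> ^ n * dist x y"
  using cyl_contraction[OF c inv_into_into[OF xy(1)] inv_into_into[OF xy(2)]] xy
  by (simp add: f_inv_into_f)

text \<open>Since the closed ball lies in the image of \<open>V\<close>, the closure of
  \<open>V'\<close> stays in the compact image of the closed ball under the inverse branch, and
  points coming from the open ball are interior. The bound on \<open>2 * R\<close> makes the local
  contraction valid on the whole ball.\<close>

lemma frontier_preimage_ball:
  assumes c: "cyl n V" and R: "0 < R" "2 * R \<le> \<epsilon>\<^sub>1" and sub: "cball z R \<subseteq> (T ^^ n) ` V"
  defines "V' \<equiv> V \<inter> (T ^^ n) -` ball z R"
  shows "frontier V' \<subseteq> inv_into V (T ^^ n) ` sphere z R"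
    and "\<And>x y. x \<in> cball z R \<Longrightarrow> y \<in> cball z R \<Longrightarrow>
      dist (inv_into V (T ^^ n) x) (inv_into V (T ^^ n) y) \<le> dist x y"
proof -
  let ?h = "inv_into V (T ^^ n)"
  show lip: "dist (?h x) (?h y) \<le> dist x y" if xy: "x \<in> cball z R" "y \<in> cball z R" for x y
  proof -
    have "dist x y \<le> \<epsilon>\<^sub>1" using xy R dist_triangle[of x y z] by (simp add: dist_commute)
    then have "dist (?h x) (?h y) \<le> \<Lambda> ^ n * dist x y"
      using xy sub by (intro inverse_lipschitz[OF c]) auto
    also have "\<dots> \<le> dist x y" using constants by (simp add: mult_left_le_one_le power_le_one)
    finally show ?thesis .
  qed
  have "continuous_on (cball z R) ?h" using lip by (rule nonexpansive_continuous_on)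
  then have "compact (?h ` cball z R)" by (rule compact_continuous_image[OF _ compact_cball])
  then have cl: "closed (?h ` cball z R)" by (rule compact_imp_closed)
  have "V' \<subseteq> ?h ` cball z R"
  proof
    fix x assume x: "x \<in> V'"
    then have "?h ((T ^^ n) x) = x" unfolding V'_def using cyl_inj[OF c] by (simp add: inv_into_f_f)
    moreover have "(T ^^ n) x \<in> cball z R" using x by (auto simp: V'_def)
    ultimately show "x \<in> ?h ` cball z R" by (metis imageI)
  qed
  then have cV: "closure V' \<subseteq> ?h ` cball z R" using cl by (rule closure_minimal)
  have oV: "open V'" unfolding V'_def by (rule pull_open[OF c]) simp
  show "frontier V' \<subseteq> ?h ` sphere z R"
  proof
    fix x assume x: "x \<in> frontier V'"
    then have "x \<in> closure V'" "x \<notin> V'" using oV by (auto simp: frontier_def interior_open)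
    then obtain y where y: "y \<in> cball z R" "x = ?h y" using cV by blast
    have "y \<notin> ball z R"
    proof
      assume yb: "y \<in> ball z R"
      have yV: "y \<in> (T ^^ n) ` V" using y sub by blast
      have "x \<in> V'" unfolding V'_def y(2) using inv_into_into[OF yV] f_inv_into_f[OF yV] yb by simp
      then show False using \<open>x \<notin> V'\<close> by contradiction
    qed
    then have "y \<in> sphere z R" using y by auto
    then show "x \<in> ?h ` sphere z R" using y(2) by blast
  qed
qed

end

section \<open>Returns to the base\<close>

context growth
begin

lemma scale_tendsto: "scale \<longlonglongrightarrow> 0"
  unfolding scale_def using lam by (intro tendsto_mult_right_zero LIMSEQ_realpow_zero) auto

text \<open>Inside an image containing \<open>B\<close> the fixed set \<open>V'\<close> returns
  after \<open>j\<close> further steps. Distortion gives its preimage a definite fraction of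
  \<open>U\<close>, and the only new boundary is \<open>frontier V'\<close>, whose neighbourhoods
  grow linearly. So \<open>c\<close> and \<open>Q\<close> do not depend on \<open>n\<close> and
  \<open>U\<close>.\<close>

lemma return_one:
  assumes B: "open B" "B \<noteq> {}" "B \<subseteq> X" and V: "cyl j V" "V \<subseteq> B"
    and R: "0 < R" "2 * R \<le> \<epsilon>\<^sub>1" "cball z R \<subseteq> (T ^^ j) ` V"
  shows "\<exists>c Q. 0 < c \<and> c \<le> 1 \<and> 0 \<le> Q \<and> (\<forall>n U. piece n U \<and> B \<subseteq> (T ^^ n) ` U \<longrightarrow>
    (\<exists>W U'. open W \<and> W \<subseteq> U \<and> cyl (n + j) W \<and> (T ^^ (n + j)) ` W = ball z R \<and>
      cyl n U' \<and> U' \<subseteq> U \<and> W \<inter> U' = {} \<and> vol (U - U' - W) = 0 \<and>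
      vol U' \<le> ennreal (1 - c) * vol U \<and>
      Z n U' \<le> Z n U + ennreal Q * vol U))"
proof -
  define V' where "V' = V \<inter> (T ^^ j) -` ball z R"
  let ?h = "inv_into V (T ^^ j)"
  note fr = frontier_preimage_ball[OF V(1) R(1,2,3), folded V'_def]
  have oV': "open V'" unfolding V'_def by (rule pull_open[OF V(1)]) simp
  have V'B: "V' \<subseteq> B" using V(2) by (auto simp: V'_def)
  have V'X: "V' \<subseteq> X" using V'B B(3) by blast
  have ballV: "ball z R \<subseteq> (T ^^ j) ` V" using R(3) ball_subset_cball by blast
  have imV': "(T ^^ j) ` V' = ball z R" unfolding V'_def by (rule pull_image[OF ballV])
  have neV': "V' \<noteq> {}" using imV' R(1) by (metis image_empty centre_in_ball empty_iff)
  have "V' \<noteq> UNIV" using bounded_subset[OF bounded_X V'X] not_bounded_UNIV by blast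
  then have neF: "frontier V' \<noteq> {}" using frontier_not_empty[OF neV'] by blast
  have cV': "cyl j V'" by (rule cyl_subset[OF V(1) oV']) (simp add: V'_def)
  define N where "N k = {y. infdist y (frontier V') < scale k}" for k
  have oN: "open (N k)" for k unfolding N_def by (rule open_infdist_less)
  obtain C0 where C0: "0 \<le> C0" "\<And>e. 0 < e \<Longrightarrow> e \<le> \<epsilon> \<Longrightarrow> vol {y. infdist y (sphere z R) < e} \<le> ennreal (C0 * e)"
    using sphere_nbhd_linear[OF R(1) eps(1), of z] by blast
  define C1 where "C1 = 4 ^ DIM('a) * C0"
  have C1: "0 \<le> C1" using C0 by (simp add: C1_def)
  have nb: "vol (N k) \<le> ennreal (C1 * scale k)" for k
  proof -
    have ne: "sphere z R \<noteq> {}" using R(1) by simp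
    have "N k \<subseteq> {y. infdist y (?h ` sphere z R) < scale k}"
      using infdist_mono[OF fr(1) neF] unfolding N_def by (auto intro: le_less_trans)
    then have "vol (N k) \<le> vol {y. infdist y (?h ` sphere z R) < scale k}"
      by (rule emeasure_mono) (simp add: borel_open[OF open_infdist_less])
    also have "\<dots> \<le> ennreal (4 ^ DIM('a) * (C0 * scale k))"
    proof (rule lipschitz_image_nbhd[OF compact_sphere ne scale_pos])
      show "0 \<le> C0 * scale k" using C0(1) scale_pos[of k] by simp
      show "vol {y. infdist y (sphere z R) < scale k} \<le> ennreal (C0 * scale k)"
        by (rule C0(2)[OF scale_pos scale_le])
      show "dist (?h x) (?h y) \<le> dist x y" if "x \<in> sphere z R" "y \<in> sphere z R" for x y
        by (rule fr(2)) (use that in auto)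
    qed
    finally show ?thesis by (simp add: C1_def mult.assoc)
  qed
  have frnull: "vol (frontier V') = 0"
  proof -
    have "frontier V' \<subseteq> N k" for k using scale_pos[of k] by (auto simp: N_def)
    then have "vol (frontier V') \<le> vol (N k)" for k
      using oN by (intro emeasure_mono) auto
    then have le: "vol (frontier V') \<le> ennreal (C1 * scale k)" for k using nb order_trans by blast
    have "(\<lambda>k. ennreal (C1 * scale k)) \<longlonglongrightarrow> ennreal 0"
      by (intro tendsto_ennrealI tendsto_mult_right_zero scale_tendsto)
    from LIMSEQ_le_const[OF this, of "vol (frontier V')"] le show ?thesis by simp
  qed
  have BX: "0 < vol B" "vol B < \<infinity>"
    using emeasure_open_pos[OF B(1,2)] finite_sub_X[OF B(3)] .
  obtain \<beta> where \<beta>: "vol B = ennreal \<beta>" "0 < \<beta>" using BX by (cases "vol B") auto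
  obtain v where v: "vol V' = ennreal v" "0 < v"
    using emeasure_open_pos[OF oV' neV'] finite_sub_X[OF V'X] by (cases "vol V'") auto
  obtain x where x: "vol X = ennreal x" "0 \<le> x"
    using X_finite by (cases "vol X") auto
  have "vol V' \<le> vol X" using V'X open_X by (intro emeasure_mono) auto
  then have vx: "v \<le> x" using v x by simp
  have K1: "1 \<le> K" using D_inf by simp
  \<comment> \<open>From distortion between \<open>V'\<close> and the whole image, whose volume is
    at most \<open>x = vol X\<close>.\<close>
  define c where "c = v / (K * x)"
  \<comment> \<open>From distortion between a neighbourhood of \<open>frontier V'\<close> and the
    whole image, whose volume is at least \<open>\<beta> = vol B\<close>; \<open>Q\<close> is the
    weighted sum over all scales.\<close>
  define q where "q = K * C1 / \<beta>"
  define Q where "Q = q * \<epsilon> / (1 - r * \<Lambda> ^ n\<^sub>0)"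
  have Kx: "0 < K * x" using vx v by simp
  have c01: "0 < c" "c \<le> 1"
  proof -
    show "0 < c" using v Kx by (simp add: c_def)
    have "1 * v \<le> K * x" using vx v K1 by (intro mult_mono) auto
    then show "c \<le> 1" using Kx by (simp add: c_def)
  qed
  have q: "0 \<le> q" using C1 \<beta> by (simp add: q_def)
  have Q: "0 \<le> Q" using q eps rate by (simp add: Q_def)
  have "\<exists>W U'. open W \<and> W \<subseteq> U \<and> cyl (n + j) W \<and> (T ^^ (n + j)) ` W = ball z R \<and>
      cyl n U' \<and> U' \<subseteq> U \<and> W \<inter> U' = {} \<and> vol (U - U' - W) = 0 \<and>
      vol U' \<le> ennreal (1 - c) * vol U \<and>
      Z n U' \<le> Z n U + ennreal Q * vol U"
    if pc: "piece n U" and BI: "B \<subseteq> (T ^^ n) ` U" for n U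
  proof -
    have cU: "cyl n U" and diam: "diameter ((T ^^ n) ` U) \<le> \<delta>" using pc by (auto simp: piece_def)
    define I where "I = (T ^^ n) ` U"
    have oI: "open I" and IX: "I \<subseteq> X" and oU: "open U"
      using cyl_open_image[OF cU] cyl_image_X[OF cU] cyl_open[OF cU] by (auto simp: I_def)
    have V'I: "V' \<subseteq> I" using V'B BI by (auto simp: I_def)
    define W where "W = U \<inter> (T ^^ n) -` V'"
    \<comment> \<open>Removing the closure keeps the remainder open; what is lost lies over the null
      set \<open>frontier V'\<close>.\<close>
    define U' where "U' = U \<inter> (T ^^ n) -` (- closure V')"
    have oW: "open W" unfolding W_def by (rule pull_open[OF cU oV'])
    have oU': "open U'" unfolding U'_def by (rule pull_open[OF cU open_Compl[OF closed_closure]])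
    have cU': "cyl n U'" by (rule cyl_subset[OF cU oU']) (simp add: U'_def)
    have WU: "W \<subseteq> U" "U' \<subseteq> U" by (auto simp: W_def U'_def)
    have disj: "W \<inter> U' = {}" using closure_subset[of V'] by (auto simp: W_def U'_def)
    have cW: "cyl (n + j) W" unfolding W_def by (rule cyl_pull[OF cU cV'])
    have imW: "(T ^^ (n + j)) ` W = ball z R"
    proof -
      have "(T ^^ (n + j)) ` W = (T ^^ j) ` (T ^^ n) ` W"
        unfolding image_image by (rule image_cong[OF refl funpow_add_apply])
      also have "(T ^^ n) ` W = V'" unfolding W_def by (rule pull_image) (use V'I in \<open>simp add: I_def\<close>)
      finally show ?thesis using imV' by simp
    qed
    have imU': "(T ^^ n) ` U' = I \<inter> - closure V'" by (auto simp: U'_def I_def)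
    have null: "vol (U - U' - W) = 0"
    proof -
      have "U - U' - W = U \<inter> (T ^^ n) -` frontier V'"
        using oV' by (auto simp: U'_def W_def frontier_def interior_open)
      then show ?thesis using pull_null[OF cU _ frnull] by simp
    qed
    obtain u where u: "vol U = ennreal u" "0 \<le> u"
      using finite_sub_X[OF cyl_X[OF cU]] by (cases "vol U") auto
    obtain w where w: "vol W = ennreal w" "0 \<le> w"
      using finite_sub_X[OF cyl_X[OF cW]] by (cases "vol W") auto
    obtain u' where u': "vol U' = ennreal u'" "0 \<le> u'"
      using finite_sub_X[OF cyl_X[OF cU']] by (cases "vol U'") auto
    have UI: "U \<inter> (T ^^ n) -` I = U" by (auto simp: I_def)
    have mass: "u' \<le> (1 - c) * u"
    proof -
      have "ennreal u * ennreal v \<le> ennreal K * vol I * ennreal w"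
        using distortion_emeasure[OF cU diam delta(2) borel_open[OF oI] _ borel_open[OF oV']] V'I UI
        unfolding W_def[symmetric] I_def[symmetric] w v by (simp add: u)
      also have "\<dots> \<le> ennreal K * ennreal x * ennreal w"
        unfolding x(1)[symmetric] using IX open_X by (intro mult_right_mono mult_left_mono emeasure_mono) auto
      finally have "ennreal (u * v) \<le> ennreal (K * x * w)"
        using u v x w by (simp add: ennreal_mult)
      then have "u * v \<le> K * x * w" using x w by (simp add: ennreal_le_iff)
      then have "c * u \<le> w" using Kx by (simp add: c_def pos_divide_le_eq mult.commute mult.left_commute)
      moreover have "ennreal (u' + w) \<le> ennreal u"
      proof -
        have "ennreal (u' + w) = vol U' + vol W" using u' w by (simp add: ennreal_plus)
        also have "\<dots> = vol (U' \<union> W)"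
          using disj oW oU' by (intro plus_emeasure) auto
        also have "\<dots> \<le> vol U" using WU oU by (intro emeasure_mono) auto
        finally show ?thesis using u by simp
      qed
      then have "u' + w \<le> u" using u by (simp add: ennreal_le_iff)
      ultimately show ?thesis by (simp add: left_diff_distrib)
    qed
    have edge: "vol (edge k n U') \<le> vol (edge k n U) + ennreal (q * u * scale k)" for k
    proof -
      let ?A = "U \<inter> (T ^^ n) -` (N k \<inter> I)"
      have Ab: "?A \<in> sets lborel" using pull_open[OF cU open_Int[OF oN oI]] by simp
      have "edge k n U' \<subseteq> edge k n U \<union> ?A"
      proof
        fix y assume y: "y \<in> edge k n U'"
        then have yU: "y \<in> U" using edge_subset WU by blast
        then have yI: "(T ^^ n) y \<in> I" by (simp add: I_def)
        have yc: "(T ^^ n) y \<in> collar (scale k) (I \<inter> - closure V')" using y unfolding edge_def imU' by simp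
        have "frontier (I \<inter> - closure V') \<subseteq> frontier I \<union> frontier (- closure V')" by (rule frontier_Int_subset)
        also have "\<dots> \<subseteq> frontier I \<union> frontier V'"
          unfolding frontier_complement using interior_mono[OF closure_subset[of V']] by (auto simp: frontier_def)
        finally have "(T ^^ n) y \<in> collar (scale k) I \<or> (\<exists>p\<in>frontier V'. dist ((T ^^ n) y) p < scale k)"
          by (intro collar_subset[OF _ _ yc]) auto
        then show "y \<in> edge k n U \<union> ?A"
        proof
          assume "(T ^^ n) y \<in> collar (scale k) I"
          then show ?thesis using yU by (simp add: edge_def I_def)
        next
          assume "\<exists>p\<in>frontier V'. dist ((T ^^ n) y) p < scale k"
          then have "(T ^^ n) y \<in> N k" unfolding N_def using infdist_le le_less_trans by blast
          then show ?thesis using yU yI by simp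
        qed
      qed
      then have "vol (edge k n U') \<le> vol (edge k n U \<union> ?A)"
        using Ab edge_open[OF cU] by (intro emeasure_mono) auto
      also have "\<dots> \<le> vol (edge k n U) + vol ?A"
        using Ab edge_open[OF cU] by (intro emeasure_subadditive) auto
      also have "vol ?A \<le> ennreal (q * u * scale k)"
      proof -
        obtain a where a: "vol ?A = ennreal a" "0 \<le> a"
          using finite_sub_X[of ?A] cyl_X[OF cU] by (cases "vol ?A") auto
        have "ennreal a * ennreal \<beta> \<le> ennreal a * vol I"
          unfolding \<beta>(1)[symmetric] using BI oI by (intro mult_left_mono emeasure_mono) (auto simp: I_def)
        also have "\<dots> \<le> ennreal K * vol (N k \<inter> I) * ennreal u"
          using distortion_emeasure[OF cU diam delta(2) borel_open[OF open_Int[OF oN[of k] oI]] _ borel_open[OF oI]] UI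
          unfolding I_def[symmetric] a by (simp add: u)
        also have "\<dots> \<le> ennreal K * ennreal (C1 * scale k) * ennreal u"
        proof (intro mult_right_mono mult_left_mono)
          have "vol (N k \<inter> I) \<le> vol (N k)" using oN by (intro emeasure_mono) auto
          then show "vol (N k \<inter> I) \<le> ennreal (C1 * scale k)" using nb order_trans by blast
        qed auto
        finally have "ennreal (a * \<beta>) \<le> ennreal (K * (C1 * scale k) * u)"
          using a \<beta> u C1 scale_pos[of k] by (simp add: ennreal_mult less_imp_le)
        then have "a * \<beta> \<le> K * (C1 * scale k) * u"
          using C1 scale_pos[of k] u by (simp add: ennreal_le_iff less_imp_le)
        then have "a \<le> q * u * scale k" using \<beta> by (simp add: q_def pos_le_divide_eq ac_simps)
        then show ?thesis unfolding a(1) by (rule ennreal_leI)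
      qed
      finally show ?thesis by (simp add: add_left_mono)
    qed
    have "Z n U' \<le> (\<Sum>k. ennreal (r ^ k) * vol (edge k n U) + ennreal (r ^ k) * ennreal (q * u * scale k))"
      unfolding Z_def distrib_left[symmetric] by (intro suminf_le mult_left_mono edge) auto
    also have "\<dots> = Z n U + (\<Sum>k. ennreal (r ^ k) * ennreal (q * u * scale k))"
      unfolding Z_def by (intro suminf_add[symmetric]) auto
    also have "(\<Sum>k. ennreal (r ^ k) * ennreal (q * u * scale k)) = ennreal (q * u * \<epsilon> / (1 - r * \<Lambda> ^ n\<^sub>0))"
      using q u by (intro scale_sum) simp
    also have "q * u * \<epsilon> / (1 - r * \<Lambda> ^ n\<^sub>0) = Q * u" by (simp add: Q_def)
    also have "ennreal (Q * u) = ennreal Q * vol U" using Q u by (simp add: ennreal_mult)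
    finally have Zb: "Z n U' \<le> Z n U + ennreal Q * vol U" .
    have "vol U' \<le> ennreal (1 - c) * vol U"
      unfolding u(1) u'(1) using mass c01 u by (simp add: ennreal_mult[symmetric] ennreal_leI)
    then show ?thesis using oW WU cW imW cU' disj null Zb by blast
  qed
  then show ?thesis using c01 Q by blast
qed

text \<open>A ball is connected: if it meets \<open>I\<close> without being contained in it, it
  meets the frontier.\<close>

lemma ball_subset_or_collar:
  assumes I: "open I" "y \<in> I" "bounded I" and ny: "y \<notin> collar e I"
  shows "ball y e \<subseteq> (I :: 'a set)"
proof (rule ccontr)
  assume n: "\<not> ?thesis"
  then have e: "0 < e" by (metis ball_empty empty_subsetI not_less)
  have "ball y e \<inter> frontier I \<noteq> {}"
  proof (rule connected_Int_frontier)
    have "y \<in> ball y e \<inter> I" using I(2) e by simp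
    then show "ball y e \<inter> I \<noteq> {}" by blast
  qed (use n in auto)
  then obtain q where q: "q \<in> frontier I" "dist y q < e" by auto
  then have "infdist y (frontier I) < e" using infdist_le[OF q(1), of y] by linarith
  then show False using ny I(2) q(1) by (auto simp: collar_def)
qed

text \<open>The base itself is an admissible start with finite functional, because its boundary is a
  sphere.\<close>

lemma initial_ball:
  assumes "0 < R" "2 * R \<le> \<delta>" "cball z R \<subseteq> X"
  shows "piece 0 (ball z R)" "Z 0 (ball z R) < \<infinity>"
proof -
  have c: "cyl 0 (ball z R)" using assms ball_subset_cball[of z R] by (intro cyl_0) auto
  then show "piece 0 (ball z R)" using assms by (simp add: piece_def)
  obtain C0 where C0: "0 \<le> C0" "\<And>e. 0 < e \<Longrightarrow> e \<le> \<epsilon> \<Longrightarrow> vol {y. infdist y (sphere z R) < e} \<le> ennreal (C0 * e)"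
    using sphere_nbhd_linear[OF assms(1) eps(1), of z] by blast
  have "Z 0 (ball z R) \<le> (\<Sum>k. ennreal (r ^ k) * ennreal (C0 * scale k))"
    unfolding Z_def
  proof (intro suminf_le mult_left_mono)
    fix k
    have "edge k 0 (ball z R) \<subseteq> {y. infdist y (sphere z R) < scale k}"
      using assms(1) by (auto simp: edge_def collar_def frontier_ball)
    then have "vol (edge k 0 (ball z R)) \<le> vol {y. infdist y (sphere z R) < scale k}"
      by (rule emeasure_mono) (simp add: borel_open[OF open_infdist_less])
    also have "\<dots> \<le> ennreal (C0 * scale k)" by (rule C0(2)[OF scale_pos scale_le])
    finally show "vol (edge k 0 (ball z R)) \<le> ennreal (C0 * scale k)" .
  qed auto
  also have "\<dots> = ennreal (C0 * \<epsilon> / (1 - r * \<Lambda> ^ n\<^sub>0))" by (rule scale_sum[OF C0(1)])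
  finally show "Z 0 (ball z R) < \<infinity>" by (simp add: le_less_trans)
qed

end

text \<open>One stage: \<open>W\<close> returns at time \<open>m\<close>, and \<open>F\<close> is
  the unreturned rest, cut into pieces \<open>s\<close> steps later. \<open>W\<close> may be empty,
  in which case \<open>m\<close> has no meaning beyond its bounds.\<close>

abbreviation splits :: "(nat \<Rightarrow> 'a set \<Rightarrow> bool) \<Rightarrow> (nat \<Rightarrow> 'a set \<Rightarrow> bool) \<Rightarrow>
    (nat \<Rightarrow> 'a set \<Rightarrow> ennreal) \<Rightarrow> nat \<Rightarrow> nat \<Rightarrow> real \<Rightarrow> nat \<Rightarrow> 'a::euclidean_space set \<Rightarrow>
    'a set set \<Rightarrow> 'a set \<Rightarrow> nat \<Rightarrow> bool"
  where "splits piece ret \<Phi> s J \<kappa> n U F W m \<equiv> countable F \<and> disjoint F \<and>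
    (\<forall>V\<in>F. piece (n + s) V \<and> V \<subseteq> U) \<and> open W \<and> W \<subseteq> U \<and> W \<inter> \<Union>F = {} \<and>
    (W \<noteq> {} \<longrightarrow> ret m W) \<and> n < m \<and> m \<le> n + J \<and> vol (U - \<Union>F - W) = 0 \<and>
    csum (\<Phi> (n + s)) F \<le> ennreal \<kappa> * \<Phi> n U"

text \<open>Generation \<open>k\<close> lives at time \<open>k * s\<close> and has mass at most
  \<open>\<kappa> ^ k * \<Phi> 0 Y\<close>. Outside it almost every point belongs to a return set
  chosen in some generation \<open>l < k\<close>, with return time at most \<open>l * s + J\<close>.
  Hence the mass bound turns into an exponential tail.\<close>

lemma stopping_partition:
  fixes piece ret :: "nat \<Rightarrow> 'a::euclidean_space set \<Rightarrow> bool" and \<Phi> :: "nat \<Rightarrow> 'a set \<Rightarrow> ennreal"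
  assumes step: "\<And>n U. piece n U \<Longrightarrow> \<exists>F W m. splits piece ret \<Phi> s J \<kappa> n U F W m"
    and piece: "\<And>n U. piece n U \<Longrightarrow> open U \<and> U \<noteq> {} \<and> vol U \<le> \<Phi> n U"
    and s: "0 < s" and \<kappa>: "0 < \<kappa>" "\<kappa> < 1" and Y: "piece 0 Y" "\<Phi> 0 Y < \<infinity>"
  shows "\<exists>R \<tau>. countable R \<and> disjoint R \<and>
    (\<forall>W\<in>R. open W \<and> W \<noteq> {} \<and> W \<subseteq> Y \<and> (\<exists>m>0. ret m W \<and> (\<forall>x\<in>W. \<tau> x = m))) \<and>
    vol (Y - \<Union>R) = 0 \<and> (\<forall>x. 0 < \<tau> x) \<and>
    (\<exists>\<kappa>' C :: real. 0 < \<kappa>' \<and> \<kappa>' < 1 \<and> (\<forall>n. emeasure lebesgue {x \<in> Y. n < \<tau> x} \<le> ennreal (C * \<kappa>' ^ n)))"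
proof -
  have "\<forall>x. \<exists>p. piece (fst x) (snd x) \<longrightarrow> splits piece ret \<Phi> s J \<kappa> (fst x) (snd x) (fst p) (fst (snd p)) (snd (snd p))"
    using step by simp
  from choice[OF this] obtain c where c: "\<And>x. piece (fst x) (snd x) \<Longrightarrow> splits piece ret \<Phi> s J \<kappa> (fst x) (snd x) (fst (c x)) (fst (snd (c x))) (snd (snd (c x)))"
    by blast
  define st where "st k U = fst (c (k * s, U))" for k U
  define rt where "rt k U = fst (snd (c (k * s, U)))" for k U
  define tm where "tm k U = snd (snd (c (k * s, U)))" for k U
  have P: "countable (st k U)" "disjoint (st k U)" "\<And>V. V \<in> st k U \<Longrightarrow> piece (Suc k * s) V"
     "\<And>V. V \<in> st k U \<Longrightarrow> V \<subseteq> U" "open (rt k U)" "rt k U \<subseteq> U" "rt k U \<inter> \<Union>(st k U) = {}"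
     "rt k U \<noteq> {} \<Longrightarrow> ret (tm k U) (rt k U)" "k * s < tm k U" "tm k U \<le> k * s + J"
     "vol (U - \<Union>(st k U) - rt k U) = 0"
     "csum (\<Phi> (Suc k * s)) (st k U) \<le> ennreal \<kappa> * \<Phi> (k * s) U"
    if "piece (k * s) U" for k U
    using c[of "(k * s, U)"] that unfolding st_def rt_def tm_def by (simp_all add: add.commute)
  define F where "F = rec_nat {Y} (\<lambda>k A. \<Union>U\<in>A. st k U)"
  have F0: "F 0 = {Y}" and FS: "F (Suc k) = (\<Union>U\<in>F k. st k U)" for k by (simp_all add: F_def)
  have inv: "countable (F k) \<and> disjoint (F k) \<and> (\<forall>U\<in>F k. piece (k * s) U) \<and>
    csum (\<Phi> (k * s)) (F k) \<le> ennreal (\<kappa> ^ k) * \<Phi> 0 Y" for k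
  proof (induction k)
    case 0
    then show ?case using Y by (simp add: F0 nn_integral_count_space_finite)
  next
    case (Suc k)
    then have pk: "\<And>U. U \<in> F k \<Longrightarrow> piece (k * s) U" and cnt: "countable (F k)" and dj: "disjoint (F k)" by auto
    have "countable (F (Suc k))" unfolding FS using cnt P(1) pk by (intro countable_UN) auto
    moreover have "disjoint (F (Suc k))"
    proof (rule disjointI)
      fix W W' assume "W \<in> F (Suc k)" "W' \<in> F (Suc k)" and ne: "W \<noteq> W'"
      then obtain U U' where U: "U \<in> F k" "W \<in> st k U" "U' \<in> F k" "W' \<in> st k U'" unfolding FS by blast
      show "W \<inter> W' = {}"
      proof (cases "U = U'")
        case True
        then show ?thesis using disjointD[OF P(2)[OF pk[OF U(1)]] U(2)] U(4) ne by blast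
      next
        case False
        then show ?thesis
          using disjointD[OF dj U(1,3)] P(4)[OF pk[OF U(1)] U(2)] P(4)[OF pk[OF U(3)] U(4)] by blast
      qed
    qed
    moreover have "\<forall>U\<in>F (Suc k). piece (Suc k * s) U" unfolding FS using P(3) pk by blast
    moreover have "csum (\<Phi> (Suc k * s)) (F (Suc k)) \<le> ennreal (\<kappa> ^ Suc k) * \<Phi> 0 Y"
    proof -
      have df: "disjoint_family_on (st k) (F k)"
        unfolding disjoint_family_on_def
      proof (intro ballI impI)
        fix U U' assume U: "U \<in> F k" "U' \<in> F k" "U \<noteq> U'"
        have "U \<inter> U' = {}" by (rule disjointD[OF dj U])
        \<comment> \<open>Nonemptiness matters here: an empty piece could belong to two of the
          families.\<close>
        moreover have "W \<noteq> {} \<and> W \<subseteq> U" if "W \<in> st k U" for W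
          using P(4)[OF pk[OF U(1)] that] piece[OF P(3)[OF pk[OF U(1)] that]] by simp
        moreover have "W \<subseteq> U'" if "W \<in> st k U'" for W using P(4)[OF pk[OF U(2)] that] .
        ultimately show "st k U \<inter> st k U' = {}" by blast
      qed
      have "csum (\<Phi> (Suc k * s)) (F (Suc k)) =
          (\<integral>\<^sup>+U. (csum (\<Phi> (Suc k * s)) (st k U)) \<partial>count_space (F k))"
        unfolding FS by (rule nn_integral_count_space_UN[OF cnt df])
      also have "\<dots> \<le> (\<integral>\<^sup>+U. ennreal \<kappa> * \<Phi> (k * s) U \<partial>count_space (F k))"
        using P(12) pk by (intro nn_integral_mono) simp
      also have "\<dots> = ennreal \<kappa> * (csum (\<Phi> (k * s)) (F k))" by (rule nn_integral_cmult) simp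
      also have "\<dots> \<le> ennreal \<kappa> * (ennreal (\<kappa> ^ k) * \<Phi> 0 Y)" using Suc by (intro mult_left_mono) auto
      also have "\<dots> = ennreal (\<kappa> ^ Suc k) * \<Phi> 0 Y" using \<kappa> by (simp add: ennreal_mult mult.assoc)
      finally show ?thesis .
    qed
    ultimately show ?case by blast
  qed
  have pk: "piece (k * s) U" if "U \<in> F k" for k U using inv that by blast
  have cnt: "countable (F k)" and dj: "disjoint (F k)" for k using inv by auto
  have oF: "open U" if "U \<in> F k" for k U using piece[OF pk[OF that]] by simp
  have uF: "open (\<Union>(F k))" for k using oF by (rule open_Union[OF ballI])
  have anti: "\<Union>(F l) \<subseteq> \<Union>(F k)" if "k \<le> l" for k l
  proof (rule lift_Suc_antimono_le[OF _ that, of "\<lambda>k. \<Union>(F k)"])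
    fix k
    show "\<Union>(F (Suc k)) \<subseteq> \<Union>(F k)" unfolding FS using P(4) pk by blast
  qed
  have FY: "\<Union>(F k) \<subseteq> Y" for k using anti[of 0 k] by (simp add: F0)
  have mF: "vol (\<Union>(F k)) \<le> ennreal (\<kappa> ^ k) * \<Phi> 0 Y" for k
  proof -
    have "disjoint_family_on (\<lambda>V. V) (F k)" using dj[of k] by (auto simp: disjoint_family_on_def disjoint_def)
    then have "vol (\<Union>V\<in>F k. V) = csum vol (F k)"
      using oF by (intro emeasure_UN_countable cnt) auto
    also have "\<dots> \<le> csum (\<Phi> (k * s)) (F k)"
      using piece pk by (intro nn_integral_mono) simp
    also have "\<dots> \<le> ennreal (\<kappa> ^ k) * \<Phi> 0 Y" using inv by blast
    finally show ?thesis by simp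
  qed
  have uniq: "k = l \<and> U = U'" if U: "U \<in> F k" "x \<in> rt k U" "U' \<in> F l" "x \<in> rt l U'" for k l U U' x
  proof -
    \<comment> \<open>A set returning in generation \<open>k\<close> is disjoint from all pieces of
      generation \<open>Suc k\<close>, hence from everything chosen later.\<close>
    have less: False if U: "U \<in> F k" "x \<in> rt k U" "U' \<in> F l" "x \<in> rt l U'" and kl: "k < l" for k l U U'
    proof -
      have "x \<in> \<Union>(F l)" using U(3) P(6)[OF pk[OF U(3)]] U(4) by blast
      then have "x \<in> \<Union>(F (Suc k))" using anti[of "Suc k" l] kl by auto
      then obtain U'' V where V: "U'' \<in> F k" "V \<in> st k U''" "x \<in> V" unfolding FS by blast
      have "x \<in> U''" using P(4)[OF pk[OF V(1)] V(2)] V(3) by blast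
      moreover have "x \<in> U" using P(6)[OF pk[OF U(1)]] U(2) by blast
      ultimately have "U'' = U" using disjointD[OF dj V(1) U(1)] by blast
      then show False using P(7)[OF pk[OF U(1)]] V U(2) by blast
    qed
    have kl: "k = l" using less[OF U] less[OF U(3,4) U(1,2)] by (metis linorder_neqE_nat)
    have "x \<in> U" "x \<in> U'" using P(6)[OF pk[OF U(1)]] P(6)[OF pk[OF U(3)]] U by blast+
    then have "U = U'" using disjointD[OF dj, of U k U'] U(1,3) kl by blast
    then show ?thesis using kl by simp
  qed
  define R where "R = (\<Union>k. rt k ` F k) - {{}}"
  define \<rho> where "\<rho> x m \<longleftrightarrow> (\<exists>k U. U \<in> F k \<and> x \<in> rt k U \<and> m = tm k U)" for x m
  \<comment> \<open>On the null set of points that never return the value is 1, so that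
    \<open>\<tau>\<close> is positive everywhere.\<close>
  define \<tau> where "\<tau> x = (if \<exists>m. \<rho> x m then SOME m. \<rho> x m else 1)" for x
  have \<tau>: "\<tau> x = tm k U" if "U \<in> F k" "x \<in> rt k U" for x k U
  proof -
    have 1: "\<rho> x (tm k U)" using that unfolding \<rho>_def by blast
    then have "\<rho> x (SOME m. \<rho> x m)" by (rule someI)
    then obtain l U' where "U' \<in> F l" "x \<in> rt l U'" "(SOME m. \<rho> x m) = tm l U'" unfolding \<rho>_def by blast
    then have "(SOME m. \<rho> x m) = tm k U" using uniq[OF that] by metis
    then show ?thesis unfolding \<tau>_def using 1 by auto
  qed
  have \<tau>1: "\<tau> x = 1" if "\<And>k U. U \<in> F k \<Longrightarrow> x \<notin> rt k U" for x
    using that unfolding \<tau>_def \<rho>_def by auto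
  have oR: "open W" if "W \<in> R" for W using that P(5) pk unfolding R_def by blast
  have uR: "open (\<Union>R)" using oR by (rule open_Union[OF ballI])
  have R1: "countable R" unfolding R_def using cnt by (intro countable_Diff countable_UN) auto
  have R2: "disjoint R"
  proof (rule disjointI, rule ccontr)
    fix W W' assume W: "W \<in> R" "W' \<in> R" "W \<noteq> W'" "W \<inter> W' \<noteq> {}"
    then obtain x k U l U' where "x \<in> W" "x \<in> W'" "U \<in> F k" "W = rt k U" "U' \<in> F l" "W' = rt l U'"
      unfolding R_def by blast
    then show False using uniq[of U k x U' l] W(3) by simp
  qed
  have R3: "open W \<and> W \<noteq> {} \<and> W \<subseteq> Y \<and> (\<exists>m>0. ret m W \<and> (\<forall>x\<in>W. \<tau> x = m))" if W: "W \<in> R" for W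
  proof -
    obtain k U where U: "U \<in> F k" "W = rt k U" "W \<noteq> {}" using W unfolding R_def by blast
    note p = pk[OF U(1)]
    have "W \<subseteq> Y" using P(6)[OF p] U FY[of k] by blast
    moreover have "0 < tm k U" using P(9)[OF p] by simp
    moreover have "ret (tm k U) W" using P(8)[OF p] U by simp
    moreover have "\<forall>x\<in>W. \<tau> x = tm k U" using \<tau>[OF U(1)] U(2) by simp
    ultimately show ?thesis using oR[OF W] U(3) by blast
  qed
  define Nl where "Nl k = (\<Union>l<k. \<Union>U\<in>F l. U - \<Union>(st l U) - rt l U)" for k
  have Nl: "Nl k \<in> null_sets lborel" for k
    unfolding Nl_def
  proof (intro null_sets_UN' cnt null_setsI)
    fix l U assume U: "U \<in> F l"
    show "vol (U - \<Union>(st l U) - rt l U) = 0" by (rule P(11)[OF pk[OF U]])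
    have "open (\<Union>(st l U))" using piece P(3)[OF pk[OF U]] by blast
    then show "U - \<Union>(st l U) - rt l U \<in> sets lborel"
      using oF[OF U] P(5)[OF pk[OF U]] by simp
  qed simp
  have cover: "Y \<subseteq> \<Union>(F k) \<union> Nl k \<union> (\<Union>l<k. \<Union>U\<in>F l. rt l U)" for k
  proof (induction k)
    case 0
    then show ?case by (simp add: F0)
  next
    case (Suc k)
    have gen: "Y \<subseteq> B \<union> (N' \<union> N) \<union> (S' \<union> S)" if "Y \<subseteq> A \<union> N \<union> S" "A \<subseteq> B \<union> N' \<union> S'" for A B N N' S S'
      using that by blast
    have e1: "\<Union>(F k) \<subseteq> \<Union>(F (Suc k)) \<union> (\<Union>U\<in>F k. U - \<Union>(st k U) - rt k U) \<union> (\<Union>U\<in>F k. rt k U)"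
      unfolding FS by blast
    have e2: "Nl (Suc k) = (\<Union>U\<in>F k. U - \<Union>(st k U) - rt k U) \<union> Nl k"
      unfolding Nl_def by (simp add: lessThan_Suc)
    have e3: "(\<Union>l<Suc k. \<Union>U\<in>F l. rt l U) = (\<Union>U\<in>F k. rt k U) \<union> (\<Union>l<k. \<Union>U\<in>F l. rt l U)"
      by (simp add: lessThan_Suc)
    show ?case unfolding e2 e3 by (rule gen[OF Suc e1])
  qed
  have mFN: "vol (\<Union>(F k) \<union> Nl k) \<le> ennreal (\<kappa> ^ k) * \<Phi> 0 Y" for k
  proof -
    have "vol (\<Union>(F k) \<union> Nl k) = vol (\<Union>(F k))"
      using Nl uF by (intro emeasure_Un_null_set) auto
    then show ?thesis using mF by simp
  qed
  obtain \<phi> where \<phi>: "\<Phi> 0 Y = ennreal \<phi>" "0 \<le> \<phi>" using Y(2) by (cases "\<Phi> 0 Y") auto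
  have mFN': "vol (\<Union>(F k) \<union> Nl k) \<le> ennreal (\<kappa> ^ k * \<phi>)" for k
    using mFN[of k] \<phi> \<kappa> by (simp add: ennreal_mult)
  have oY: "open Y" using piece[OF Y(1)] by simp
  have bFN: "\<Union>(F k) \<union> Nl k \<in> sets borel" for k
  proof -
    have "Nl k \<in> sets borel" using null_setsD2[OF Nl[of k]] by simp
    then show ?thesis using uF by (intro sets.Un) auto
  qed
  have R4: "vol (Y - \<Union>R) = 0"
  proof -
    have le: "vol (Y - \<Union>R) \<le> ennreal (\<kappa> ^ k * \<phi>)" for k
    proof -
      have "rt l U \<subseteq> \<Union>R" if "U \<in> F l" for l U
      proof
        fix x assume x: "x \<in> rt l U"
        have "rt l U \<in> (\<Union>k. rt k ` F k)" using that by blast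
        then have "rt l U \<in> R" using x unfolding R_def by blast
        then show "x \<in> \<Union>R" using x by (rule UnionI)
      qed
      then have "(\<Union>l<k. \<Union>U\<in>F l. rt l U) \<subseteq> \<Union>R" by blast
      moreover have "Y - C \<subseteq> A \<union> B" if "S \<subseteq> C" "Y \<subseteq> A \<union> B \<union> S" for A B C S
        using that by blast
      ultimately have "Y - \<Union>R \<subseteq> \<Union>(F k) \<union> Nl k" using cover[of k] by simp
      then have "vol (Y - \<Union>R) \<le> vol (\<Union>(F k) \<union> Nl k)"
        by (rule emeasure_mono) (use bFN[of k] in simp)
      then show ?thesis by (rule order_trans[OF _ mFN'])
    qed
    have "(\<lambda>k. ennreal (\<kappa> ^ k * \<phi>)) \<longlonglongrightarrow> ennreal 0"
      using \<kappa> by (intro tendsto_ennrealI tendsto_mult_left_zero LIMSEQ_realpow_zero) auto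
    from LIMSEQ_le_const[OF this, of "vol (Y - \<Union>R)"] le show ?thesis by simp
  qed
  have R5: "0 < \<tau> x" for x
  proof (cases "\<exists>k U. U \<in> F k \<and> x \<in> rt k U")
    case True
    then obtain k U where U: "U \<in> F k" "x \<in> rt k U" by blast
    show ?thesis using \<tau>[OF U] P(9)[OF pk[OF U(1)]] by simp
  next
    case False
    then show ?thesis using \<tau>1[of x] by auto
  qed
  \<comment> \<open>A generation lasts \<open>s\<close> units of time, so the rate per unit is the
    \<open>s\<close>-th root.\<close>
  define \<kappa>' where "\<kappa>' = root s \<kappa>"
  have \<kappa>': "0 < \<kappa>'" "\<kappa>' < 1" "\<kappa>' ^ s = \<kappa>"
    using s \<kappa> by (auto simp: \<kappa>'_def real_root_gt_zero real_root_lt_1_iff real_root_pow_pos2)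
  have tail: "emeasure lebesgue {x \<in> Y. n < \<tau> x} \<le> ennreal (\<phi> / (\<kappa> * \<kappa>' ^ J) * \<kappa>' ^ n)" for n
  proof -
    \<comment> \<open>The last generation before which every return time is at most
      \<open>n\<close>. For \<open>n < J\<close> truncated subtraction gives 0, and the claim is the
      trivial bound by the whole of \<open>Y\<close>.\<close>
    define k where "k = (n - J) div s"
    have sub: "{x \<in> Y. n < \<tau> x} \<subseteq> \<Union>(F k) \<union> Nl k"
    proof clarify
      fix x assume x: "x \<in> Y" "n < \<tau> x" and nN: "x \<notin> Nl k"
      have "x \<notin> (\<Union>l<k. \<Union>U\<in>F l. rt l U)"
      proof
        assume "x \<in> (\<Union>l<k. \<Union>U\<in>F l. rt l U)"
        then obtain l U where l: "l < k" "U \<in> F l" "x \<in> rt l U" by blast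
        have "\<tau> x \<le> l * s + J" using \<tau>[OF l(2,3)] P(10)[OF pk[OF l(2)]] by simp
        moreover have "l * s \<le> k * s" using l(1) by simp
        moreover have "k * s \<le> n - J" unfolding k_def by (rule div_times_less_eq_dividend)
        moreover have "J \<le> n" using l(1) unfolding k_def by (cases "J \<le> n") auto
        ultimately show False using x(2) by linarith
      qed
      moreover have "x \<in> \<Union>(F k) \<union> Nl k \<union> (\<Union>l<k. \<Union>U\<in>F l. rt l U)" using cover[of k] x(1) by (rule subsetD)
      ultimately show "x \<in> \<Union>(F k)" using nN by (simp only: Un_iff) simp
    qed
    have "emeasure lebesgue {x \<in> Y. n < \<tau> x} \<le> emeasure lebesgue (\<Union>(F k) \<union> Nl k)"
      by (rule emeasure_mono[OF sub]) (use bFN[of k] in simp)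
    also have "\<dots> = vol (\<Union>(F k) \<union> Nl k)" by (rule emeasure_lebesgue_borel[OF bFN])
    also have "\<dots> \<le> ennreal (\<kappa> ^ k * \<phi>)" by (rule mFN')
    also have "\<dots> \<le> ennreal (\<phi> / (\<kappa> * \<kappa>' ^ J) * \<kappa>' ^ n)"
    proof (rule ennreal_leI)
      \<comment> \<open>Rounding down loses less than one generation; this and the delay
        \<open>J\<close> produce the denominator \<open>\<kappa> * \<kappa>' ^ J\<close>.\<close>
      have "n - J < Suc k * s"
        unfolding k_def using s by (metis dividend_less_div_times add.commute mult_Suc)
      then have "n \<le> s * Suc k + J" by (simp add: mult.commute)
      then have "\<kappa>' ^ (s * Suc k + J) \<le> \<kappa>' ^ n" using \<kappa>' by (intro power_decreasing) auto
      then have "\<kappa> ^ Suc k * \<kappa>' ^ J \<le> \<kappa>' ^ n" by (simp only: power_add power_mult \<kappa>'(3))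
      then have "\<kappa> ^ k * (\<kappa> * \<kappa>' ^ J) \<le> \<kappa>' ^ n" by (simp add: ac_simps)
      then have "\<kappa> ^ k \<le> \<kappa>' ^ n / (\<kappa> * \<kappa>' ^ J)" using \<kappa> \<kappa>' by (simp add: pos_le_divide_eq)
      then have "\<kappa> ^ k * \<phi> \<le> \<kappa>' ^ n / (\<kappa> * \<kappa>' ^ J) * \<phi>" using \<phi>(2) by (rule mult_right_mono)
      then show "\<kappa> ^ k * \<phi> \<le> \<phi> / (\<kappa> * \<kappa>' ^ J) * \<kappa>' ^ n" by (simp add: ac_simps)
    qed
    finally show ?thesis .
  qed
  show ?thesis
    by (rule exI[of _ R], rule exI[of _ \<tau>], intro conjI R1 R2 R4 ballI R3 allI R5 exI[of _ \<kappa>']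
      exI[of _ "\<phi> / (\<kappa> * \<kappa>' ^ J)"] \<kappa>'(1,2) tail)
qed

section \<open>One stage of the return process\<close>

context growth
begin

lemma term_le_Z: "ennreal (r ^ k) * vol (edge k n U) \<le> Z n U"
  unfolding Z_def using sum_le_suminf[of "\<lambda>k. ennreal (r ^ k) * vol (edge k n U)" "{k}"] by simp

text \<open>The alternatives in the proof are that \<open>T\<^sup>nU\<close> contains a ball of the net \<open>\<B>\<close> or that every point
  of \<open>T\<^sup>nU\<close> is \<open>\<eta>\<close>-close to its boundary; in the second case \<open>Z n U \<ge> r\<^sup>L m(U)\<close>.\<close>

lemma return_stage:
  assumes erg: "ergodic X T" and X: "X \<noteq> {}"
  shows "\<exists>z R s J \<kappa> a. 0 < R \<and> 2 * R \<le> \<delta> \<and> cball z R \<subseteq> X \<and> 0 < s \<and> 0 < \<kappa> \<and> \<kappa> < 1 \<and> 0 \<le> a \<and>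
    (\<forall>n U. piece n U \<longrightarrow> (\<exists>F W m. splits piece (\<lambda>m W. cyl m W \<and> (T ^^ m) ` W = ball z R)
      (\<lambda>n U. vol U + ennreal a * Z n U) s J \<kappa> n U F W m))"
proof -
  obtain C where C: "1 \<le> C" "\<And>N. grows (N * n\<^sub>0) (\<theta> ^ N) C" using grows_iterate by blast
  \<comment> \<open>Chosen so that for thin images \<open>Z\<close> dominates \<open>4 * C\<close>
    times the volume, which then pays for the error term \<open>C * vol U\<close>.\<close>
  obtain L where L: "4 * C < r ^ L" using real_arch_pow[OF r1] by blast
  define \<eta> where "\<eta> = scale L"
  have \<eta>: "0 < \<eta>" unfolding \<eta>_def by (rule scale_pos)
  have "compact (closure X)" using bounded_X by simp
  then obtain N where N: "finite N" "closure X \<subseteq> (\<Union>p\<in>N. ball p (\<eta> / 2))"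
    unfolding compact_eq_totally_bounded using \<eta> by (meson half_gt_zero)
  \<comment> \<open>Radius \<open>\<eta> / 2\<close> makes every ball of radius
    \<open>\<eta>\<close> centred in \<open>X\<close> contain a ball of the net.\<close>
  define \<B> where "\<B> = {B \<in> (\<lambda>p. ball p (\<eta> / 2)) ` N. B \<subseteq> X}"
  have fin: "finite \<B>" unfolding \<B>_def using N(1) by simp
  have B: "open B \<and> B \<noteq> {} \<and> B \<subseteq> X" if "B \<in> \<B>" for B using that \<eta> unfolding \<B>_def by auto
  define \<rho> where "\<rho> = \<delta> / 2"
  have \<rho>: "0 < \<rho>" using delta by (simp add: \<rho>_def)
  obtain z R where zR: "0 < R" "R \<le> \<rho>" "cball z R \<subseteq> X"
    "\<forall>B\<in>\<B>. \<exists>n V. 0 < n \<and> cyl n V \<and> V \<subseteq> B \<and> cball z R \<subseteq> (T ^^ n) ` V"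
    using common_ball[OF erg X fin B \<rho>] by blast
  have R2: "2 * R \<le> \<delta>" "2 * R \<le> \<epsilon>\<^sub>1" using zR(2) delta by (auto simp: \<rho>_def)
  define Ret where "Ret c Q j n U \<longleftrightarrow> (\<exists>W U'. open W \<and> W \<subseteq> U \<and> cyl (n + j) W \<and> (T ^^ (n + j)) ` W = ball z R \<and>
      cyl n U' \<and> U' \<subseteq> U \<and> W \<inter> U' = {} \<and> vol (U - U' - W) = 0 \<and>
      vol U' \<le> ennreal (1 - c) * vol U \<and>
      Z n U' \<le> Z n U + ennreal Q * vol U)" for c Q :: real and j n U
  have "\<forall>B\<in>\<B>. \<exists>p :: real \<times> real \<times> nat. 0 < fst p \<and> fst p \<le> 1 \<and> 0 \<le> fst (snd p) \<and> 0 < snd (snd p) \<and>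
    (\<forall>n U. piece n U \<and> B \<subseteq> (T ^^ n) ` U \<longrightarrow> Ret (fst p) (fst (snd p)) (snd (snd p)) n U)"
  proof
    fix B0 assume B0: "B0 \<in> \<B>"
    then obtain j V where V: "0 < j" "cyl j V" "V \<subseteq> B0" "cball z R \<subseteq> (T ^^ j) ` V" using zR(4) by blast
    have B0': "open B0" "B0 \<noteq> {}" "B0 \<subseteq> X" using B[OF B0] by simp_all
    from return_one[OF B0' V(2,3) zR(1) R2(2) V(4), folded Ret_def]
    obtain c Q where cQ: "0 < c" "c \<le> 1" "0 \<le> Q" "\<forall>n U. piece n U \<and> B0 \<subseteq> (T ^^ n) ` U \<longrightarrow> Ret c Q j n U"
      by (elim exE conjE)
    show "\<exists>p :: real \<times> real \<times> nat. 0 < fst p \<and> fst p \<le> 1 \<and> 0 \<le> fst (snd p) \<and> 0 < snd (snd p) \<and>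
    (\<forall>n U. piece n U \<and> B0 \<subseteq> (T ^^ n) ` U \<longrightarrow> Ret (fst p) (fst (snd p)) (snd (snd p)) n U)"
      using cQ V(1) by (intro exI[of _ "(c, Q, j)"]) simp
  qed
  from bchoice[OF this] obtain p where p: "\<And>B. B \<in> \<B> \<Longrightarrow> 0 < fst (p B)" "\<And>B. B \<in> \<B> \<Longrightarrow> fst (p B) \<le> 1"
    "\<And>B. B \<in> \<B> \<Longrightarrow> 0 \<le> fst (snd (p B))" "\<And>B. B \<in> \<B> \<Longrightarrow> 0 < snd (snd (p B))"
    "\<And>B n U. B \<in> \<B> \<Longrightarrow> piece n U \<Longrightarrow> B \<subseteq> (T ^^ n) ` U \<Longrightarrow> Ret (fst (p B)) (fst (snd (p B))) (snd (snd (p B))) n U"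
    by blast
  \<comment> \<open>The inserted values 1 and 0 keep the extrema defined when \<open>\<B>\<close> is
    empty.\<close>
  define c where "c = Min (insert 1 ((\<lambda>B. fst (p B)) ` \<B>))"
  define Q where "Q = Max (insert 0 ((\<lambda>B. fst (snd (p B))) ` \<B>))"
  define J where "J = Max (insert 1 ((\<lambda>B. snd (snd (p B))) ` \<B>))"
  have c: "0 < c" "c \<le> 1" "\<And>B. B \<in> \<B> \<Longrightarrow> c \<le> fst (p B)"
    unfolding c_def using fin p(1) by (auto simp: Min_gr_iff)
  have Q: "0 \<le> Q" "\<And>B. B \<in> \<B> \<Longrightarrow> fst (snd (p B)) \<le> Q" unfolding Q_def using fin by auto
  have J: "1 \<le> J" "\<And>B. B \<in> \<B> \<Longrightarrow> snd (snd (p B)) \<le> J" unfolding J_def using fin by auto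
  \<comment> \<open>The volume error of one stage, weighted by \<open>a\<close>, is then a quarter
    of the returned fraction.\<close>
  define a where "a = c / (4 * C)"
  have a: "0 < a" "a * C = c / 4" using c C by (auto simp: a_def)
  define \<kappa> where "\<kappa> = 1 - c / 4"
  have \<kappa>: "3 / 4 \<le> \<kappa>" "\<kappa> < 1" using c by (auto simp: \<kappa>_def)
  \<comment> \<open>The two bounds give \<open>t \<le> 1/4\<close> and keep the cost
    \<open>a * t * Q\<close> of the removed set below another quarter of \<open>c\<close>; with the
    loss \<open>c\<close> of mass, a net gain of at least \<open>c / 4\<close> remains.\<close>
  define y where "y = min (1/4) (c / (4 * (a * Q + 1)))"
  have aQ: "0 \<le> a * Q" using a Q by simp
  have y: "0 < y" using aQ c by (simp add: y_def)
  obtain M where M: "\<theta> ^ M < y" using real_arch_pow_inv[OF y theta(2)] by blast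
  define t where "t = \<theta> ^ M"
  have t: "0 < t" "t \<le> 1/4" using theta M by (auto simp: t_def y_def)
  have taQ: "a * (t * Q) \<le> c / 4"
  proof -
    have "t \<le> c / (4 * (a * Q + 1))" using M by (simp add: t_def y_def)
    then have "t * (4 * (a * Q + 1)) \<le> c" using aQ by (simp add: pos_le_divide_eq)
    then have "t * (a * Q + 1) \<le> c / 4" by (simp add: algebra_simps)
    then show ?thesis using t by (simp add: distrib_left ac_simps)
  qed
  define s where "s = M * n\<^sub>0"
  have "M \<noteq> 0" using t by (intro notI) (simp add: t_def)
  then have s: "0 < s" using n0 by (simp add: s_def)
  have gr: "grows s t C" unfolding s_def t_def by (rule C(2))
  have sum: "\<exists>F. refin (n + s) U F \<and> (\<forall>V\<in>F. piece (n + s) V) \<and>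
     csum (\<lambda>V. vol V + ennreal a * Z (n + s) V) F
      \<le> ennreal (1 + a * C) * vol U + ennreal (a * t) * Z n U" if pc: "piece n U" for n U
  proof -
    obtain F where F: "refin (n + s) U F" "\<forall>V\<in>F. piece (n + s) V"
      "csum (Z (n + s)) F \<le> ennreal t * Z n U + ennreal C * vol U"
      using growsD[OF gr pc] by blast
    have "csum (\<lambda>V. vol V + ennreal a * Z (n + s) V) F =
      csum vol F + ennreal a * (csum (Z (n + s)) F)"
      by (simp add: nn_integral_add nn_integral_cmult)
    also have "\<dots> \<le> vol U + ennreal a * (ennreal t * Z n U + ennreal C * vol U)"
      using sum_refin_le[OF refinD(1,2,4,6)[OF F(1)] cyl_open[OF piece_cyl[OF pc]]]
      by (intro add_mono mult_left_mono F(3)) auto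
    also have "\<dots> = ennreal (1 + a * C) * vol U + ennreal (a * t) * Z n U"
      using a t C by (simp add: ennreal_mult ennreal_plus distrib_left distrib_right mult.assoc ac_simps)
    finally show ?thesis using F by blast
  qed
  have main: "\<exists>F W m. splits piece (\<lambda>m W. cyl m W \<and> (T ^^ m) ` W = ball z R)
      (\<lambda>n U. vol U + ennreal a * Z n U) s J \<kappa> n U F W m" if pc: "piece n U" for n U
  proof (cases "\<exists>B\<in>\<B>. B \<subseteq> (T ^^ n) ` U")
    case True
    then obtain B0 where B0: "B0 \<in> \<B>" "B0 \<subseteq> (T ^^ n) ` U" by blast
    define j where "j = snd (snd (p B0))"
    obtain W U' where W: "open W" "W \<subseteq> U" "cyl (n + j) W" "(T ^^ (n + j)) ` W = ball z R"
      and U': "cyl n U'" "U' \<subseteq> U" "W \<inter> U' = {}" "vol (U - U' - W) = 0"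
      "vol U' \<le> ennreal (1 - fst (p B0)) * vol U"
      "Z n U' \<le> Z n U + ennreal (fst (snd (p B0))) * vol U"
      using p(5)[OF B0(1) pc B0(2)] unfolding Ret_def j_def by blast
    have j: "0 < j" "j \<le> J" using p(4)[OF B0(1)] J(2)[OF B0(1)] by (auto simp: j_def)
    have mU': "vol U' \<le> ennreal (1 - c) * vol U"
      by (rule order_trans[OF U'(5)]) (use c(3)[OF B0(1)] in \<open>intro mult_right_mono ennreal_leI, auto\<close>)
    have ZU': "Z n U' \<le> Z n U + ennreal Q * vol U"
      by (rule order_trans[OF U'(6)]) (use Q(2)[OF B0(1)] in \<open>intro add_left_mono mult_right_mono ennreal_leI, auto\<close>)
    show ?thesis
    proof (cases "U' = {}")
      case True
      \<comment> \<open>All of \<open>U\<close> returns, up to a null set, and no piece is left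
        over.\<close>
      then show ?thesis
        using W U' j by (intro exI[of _ "{}"] exI[of _ W] exI[of _ "n + j"]) (simp add: nn_integral_empty)
    next
      case False
      have "diameter ((T ^^ n) ` U') \<le> diameter ((T ^^ n) ` U)"
        by (rule diameter_subset[OF image_mono[OF U'(2)] image_bounded[OF piece_cyl[OF pc]]])
      then have pc': "piece n U'" using U'(1) False pc by (simp add: piece_def)
      obtain F where F: "refin (n + s) U' F" "\<forall>V\<in>F. piece (n + s) V"
       "csum (\<lambda>V. vol V + ennreal a * Z (n + s) V) F
        \<le> ennreal (1 + a * C) * vol U' + ennreal (a * t) * Z n U'" using sum[OF pc'] by blast
      note f = refinD[OF F(1)]
      have FU': "\<Union>F \<subseteq> U'" using f(6) by blast
      have null: "vol (U - \<Union>F - W) = 0"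
      proof -
        have o: "open U" "open U'" "open (\<Union>F)"
          using cyl_open[OF piece_cyl[OF pc]] cyl_open[OF U'(1)] f(4) by (auto intro: open_Union)
        have "U - \<Union>F - W \<subseteq> (U - U' - W) \<union> (U' - \<Union>F)" by blast
        then have "vol (U - \<Union>F - W) \<le> vol ((U - U' - W) \<union> (U' - \<Union>F))"
          using o W(1) by (intro emeasure_mono) auto
        also have "\<dots> \<le> vol (U - U' - W) + vol (U' - \<Union>F)"
          using o W(1) by (intro emeasure_subadditive) auto
        also have "\<dots> = 0" using U'(4) f(7) by simp
        finally show ?thesis by simp
      qed
      have "ennreal (1 + a * C) * vol U' + ennreal (a * t) * Z n U' \<le>
        ennreal (1 + a * C) * (ennreal (1 - c) * vol U) + ennreal (a * t) * (Z n U + ennreal Q * vol U)"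
        by (intro add_mono mult_left_mono mU' ZU') auto
      also have "\<dots> = ennreal ((1 + a * C) * (1 - c) + a * t * Q) * vol U + ennreal (a * t) * Z n U"
      proof -
        have nn: "0 \<le> 1 + a * C" "0 \<le> 1 - c" "0 \<le> a * t" "0 \<le> (1 + a * C) * (1 - c)" "0 \<le> a * t * Q"
          using a t C c Q by auto
        show ?thesis
          unfolding ennreal_plus[OF nn(4,5)] ennreal_mult[OF nn(1,2)] ennreal_mult[OF nn(3) Q(1)]
          by (simp only: distrib_left distrib_right ac_simps)
      qed
      also have "\<dots> \<le> ennreal \<kappa> * vol U + ennreal (\<kappa> * a) * Z n U"
      proof (intro add_mono mult_right_mono ennreal_leI)
        have "(1 + a * C) * (1 - c) \<le> 1 - c + c / 4"
        proof -
          have "c / 4 * (1 - c) \<le> c / 4" using c by (simp add: mult_left_le)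
          then show ?thesis unfolding a(2) by (simp add: distrib_right)
        qed
        then show "(1 + a * C) * (1 - c) + a * t * Q \<le> \<kappa>" using taQ c by (simp add: \<kappa>_def mult.assoc)
        have "t \<le> \<kappa>" using t \<kappa> by simp
        then show "a * t \<le> \<kappa> * a" using a by (simp add: mult.commute)
      qed auto
      also have "\<dots> = ennreal \<kappa> * (vol U + ennreal a * Z n U)"
        using a \<kappa> by (simp add: ennreal_mult distrib_left mult.assoc)
      finally have "csum (\<lambda>V. vol V + ennreal a * Z (n + s) V) F
        \<le> ennreal \<kappa> * (vol U + ennreal a * Z n U)" using F(3) order_trans by blast
      moreover have "\<forall>V\<in>F. piece (n + s) V \<and> V \<subseteq> U" using F(2) FU' U'(2) by blast
      moreover have "W \<inter> \<Union>F = {}" using FU' U'(3) by blast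
      moreover have "n < n + j" "n + j \<le> n + J" using j by auto
      ultimately show ?thesis using f(1,2) W null by blast
    qed
  next
    case False
    note cU = piece_cyl[OF pc]
    define I where "I = (T ^^ n) ` U"
    have "y \<in> collar \<eta> I" if y: "y \<in> I" for y
    proof (rule ccontr)
      assume n: "y \<notin> collar \<eta> I"
      have bI: "ball y \<eta> \<subseteq> I"
        unfolding I_def by (rule ball_subset_or_collar[OF cyl_open_image[OF cU] _ image_bounded[OF cU]])
          (use y n in \<open>simp_all add: I_def\<close>)
      have IX: "I \<subseteq> X" unfolding I_def by (rule cyl_image_X[OF cU])
      then have "y \<in> closure X" using y closure_subset by blast
      then obtain q where q: "q \<in> N" "y \<in> ball q (\<eta> / 2)" using N(2) by blast
      have "ball q (\<eta> / 2) \<subseteq> ball y \<eta>"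
      proof
        fix w assume "w \<in> ball q (\<eta> / 2)"
        then show "w \<in> ball y \<eta>" using q(2) dist_triangle[of y w q] by (simp add: dist_commute)
      qed
      then have "ball q (\<eta> / 2) \<subseteq> I" using bI by blast
      moreover have "ball q (\<eta> / 2) \<in> \<B>" unfolding \<B>_def using q(1) calculation IX by blast
      ultimately show False using False unfolding I_def by blast
    qed
    \<comment> \<open>Every point is an edge point at the scale \<open>\<eta>\<close>, so a single
      term of \<open>Z\<close> already contains the full volume.\<close>
    then have "edge L n U = U" unfolding edge_def \<eta>_def[symmetric] I_def[symmetric] by (auto simp: I_def)
    then have ZL: "ennreal (r ^ L) * vol U \<le> Z n U" using term_le_Z[of L n U] by simp
    obtain F where F: "refin (n + s) U F" "\<forall>V\<in>F. piece (n + s) V"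
       "csum (\<lambda>V. vol V + ennreal a * Z (n + s) V) F
        \<le> ennreal (1 + a * C) * vol U + ennreal (a * t) * Z n U" using sum[OF pc] by blast
    note f = refinD[OF F(1)]
    have "ennreal (1 + a * C) * vol U + ennreal (a * t) * Z n U
      \<le> ennreal \<kappa> * (vol U + ennreal a * Z n U)"
    proof (cases "Z n U = \<infinity>")
      case True
      then show ?thesis using a \<kappa> by (simp add: ennreal_mult_top)
    next
      case False
      then obtain \<zeta> where \<zeta>: "Z n U = ennreal \<zeta>" "0 \<le> \<zeta>" by (cases "Z n U") auto
      obtain u where u: "vol U = ennreal u" "0 \<le> u"
        using finite_sub_X[OF cyl_X[OF cU]] by (cases "vol U") auto
      have "ennreal (r ^ L * u) \<le> ennreal \<zeta>" using ZL \<zeta> u r1 by (simp add: ennreal_mult)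
      then have "r ^ L * u \<le> \<zeta>" using \<zeta> by (simp add: ennreal_le_iff)
      moreover have "4 * C * u \<le> r ^ L * u" using L u by (intro mult_right_mono) auto
      ultimately have "4 * C * u \<le> \<zeta>" by linarith
      then have "a * (4 * C * u) \<le> a * \<zeta>" using a by simp
      moreover have "a * (4 * C * u) = c * u" using a(2) by (simp add: algebra_simps)
      ultimately have 1: "c * u \<le> a * \<zeta>" by simp
      \<comment> \<open>Half of \<open>a * \<zeta>\<close> is saved, and
        \<open>a * \<zeta> \<ge> c * u\<close> makes this enough for the volume terms, which exceed
        their target by \<open>c / 2 * u\<close>.\<close>
      have "(\<kappa> - t) * (a * \<zeta>) \<ge> 1/2 * (a * \<zeta>)" using t \<kappa> a \<zeta> by (intro mult_right_mono) auto
      then have 2: "(1 + a * C) * u + a * t * \<zeta> \<le> \<kappa> * (u + a * \<zeta>)"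
        using 1 unfolding a(2) \<kappa>_def by (simp add: algebra_simps add_divide_distrib)
      have "ennreal (1 + a * C) * vol U + ennreal (a * t) * Z n U = ennreal ((1 + a * C) * u + a * t * \<zeta>)"
        unfolding \<zeta>(1) u(1) using a t C u \<zeta> by (simp add: ennreal_mult[symmetric] ennreal_plus[symmetric] del: ennreal_plus)
      also have "\<dots> \<le> ennreal (\<kappa> * (u + a * \<zeta>))" using 2 by (rule ennreal_leI)
      also have "\<dots> = ennreal \<kappa> * (vol U + ennreal a * Z n U)"
        unfolding \<zeta>(1) u(1) using a \<kappa> u \<zeta> by (simp add: ennreal_mult[symmetric] ennreal_plus[symmetric] del: ennreal_plus)
      finally show ?thesis .
    qed
    then have le: "csum (\<lambda>V. vol V + ennreal a * Z (n + s) V) F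
        \<le> ennreal \<kappa> * (vol U + ennreal a * Z n U)" using F(3) order_trans by blast
    have "\<forall>V\<in>F. piece (n + s) V \<and> V \<subseteq> U" using F(2) f(6) by blast
    \<comment> \<open>Nothing returns at this stage, so \<open>W\<close> is empty and
      \<open>Suc n\<close> is a dummy time.\<close>
    then show ?thesis using f(1,2,7) le J(1)
      by (intro exI[of _ F] exI[of _ "{}"] exI[of _ "Suc n"]) simp
  qed
  show ?thesis
    by (intro exI[of _ z] exI[of _ R] exI[of _ s] exI[of _ J] exI[of _ \<kappa>] exI[of _ a] conjI allI impI
      zR(1,3) R2(1) s main) (use a \<kappa> in auto)
qed

end

section \<open>The full-branched map\<close>

lemma pushforward_cong:
  assumes "\<And>x. x \<in> S \<Longrightarrow> f x = g x"
  shows "pushforward f S = pushforward g S"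
proof -
  have "f ` S = g ` S" using assms by (rule image_cong[OF refl])
  then show ?thesis unfolding pushforward_def using assms by (intro distr_cong) (auto simp: space_restrict_space)
qed

lemma is_jacobian_cong:
  assumes "\<And>x. x \<in> S \<Longrightarrow> f x = g x"
  shows "is_jacobian f S J \<longleftrightarrow> is_jacobian g S J"
proof -
  have "f ` S = g ` S" using assms by (rule image_cong[OF refl])
  moreover have "pushforward f S = pushforward g S" using assms by (rule pushforward_cong)
  ultimately show ?thesis unfolding is_jacobian_def by (simp only:)
qed

lemma nonsingular_homeo_on_cong:
  assumes "\<And>x. x \<in> S \<Longrightarrow> f x = g x"
  shows "nonsingular_homeo_on f S \<longleftrightarrow> nonsingular_homeo_on g S"
proof -
  have im: "f ` S = g ` S" using assms by (rule image_cong[OF refl])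
  have "homeomorphism S (g ` S) f h \<longleftrightarrow> homeomorphism S (g ` S) g h" for h
    using assms by (intro iffI; elim homeomorphism_cong) auto
  then have "(\<exists>h. homeomorphism S (g ` S) f h) \<longleftrightarrow> (\<exists>h. homeomorphism S (g ` S) g h)" by simp
  moreover have "pushforward f S = pushforward g S" using assms by (rule pushforward_cong)
  ultimately show ?thesis unfolding nonsingular_homeo_on_def im by (simp only:)
qed

lemma null_sets_lebesgueI: "A \<in> sets borel \<Longrightarrow> vol A = 0 \<Longrightarrow> A \<in> null_sets lebesgue"
  by (intro null_sets_completionI null_setsI) auto

context piecewise_expanding
begin

text \<open>Outside the base the original partition is kept, minus the closed ball, so that exactly
  the members of \<open>R\<close> lie in the base; the sphere is null. As the base has diameter at
  most \<open>\<epsilon>\<^sub>1\<close>, the local distortion bound of \<open>T ^^ m\<close> holds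
  for all pairs of its points.\<close>

lemma full_branched_refinement:
  fixes R :: "'a set set" and \<tau> :: "'a \<Rightarrow> nat"
  assumes \<rho>: "0 < \<rho>" "2 * \<rho> \<le> \<epsilon>\<^sub>1" "cball z \<rho> \<subseteq> X"
    and R: "countable R" "disjoint R" "\<And>W. W \<in> R \<Longrightarrow> open W \<and> W \<noteq> {} \<and> W \<subseteq> ball z \<rho>"
    and \<tau>: "\<And>W. W \<in> R \<Longrightarrow> \<exists>m>0. (cyl m W \<and> (T ^^ m) ` W = ball z \<rho>) \<and> (\<forall>x\<in>W. \<tau> x = m)"
    and null: "vol (ball z \<rho> - \<Union>R) = 0"
  defines "P'' \<equiv> R \<union> ((\<lambda>B. B - cball z \<rho>) ` P - {{}})"
  shows "open_refinement X P P''" "union_mod0 (ball z \<rho>) P''" "{a \<in> P''. a \<subseteq> ball z \<rho>} = R"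
    "gibbs_markov (ball z \<rho>) R (\<lambda>x. (T ^^ \<tau> x) x)" "full_branched (ball z \<rho>) R (\<lambda>x. (T ^^ \<tau> x) x)"
    "\<forall>a\<in>R. \<tau> constant_on a" "\<forall>a\<in>R. \<forall>x\<in>a. \<forall>i<\<tau> x. (T ^^ i) x \<in> \<Union>P"
proof -
  let ?Z = "ball z \<rho>" and ?G = "\<lambda>x. (T ^^ \<tau> x) x"
  have ZX: "?Z \<subseteq> X" using \<rho>(3) ball_subset_cball by blast
  have uR: "open (\<Union>R)" using R(3) by (auto intro!: open_Union)
  have RZ: "\<Union>R \<subseteq> ?Z" using R(3) by blast
  have G: "\<exists>m>0. cyl m W \<and> (T ^^ m) ` W = ?Z \<and> (\<forall>x\<in>W. \<tau> x = m) \<and> (\<forall>x\<in>W. ?G x = (T ^^ m) x)" if W: "W \<in> R" for W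
    using \<tau>[OF W] by auto
  have Gim: "?G ` W = ?Z" if W: "W \<in> R" for W
  proof -
    obtain m where m: "(T ^^ m) ` W = ?Z" "\<forall>x\<in>W. ?G x = (T ^^ m) x" using G[OF W] by blast
    have "?G ` W = (T ^^ m) ` W" by (rule image_cong[OF refl]) (use m(2) in blast)
    then show ?thesis using m(1) by simp
  qed
  show sub: "{a \<in> P''. a \<subseteq> ?Z} = R"
  proof
    show "{a \<in> P''. a \<subseteq> ?Z} \<subseteq> R"
    proof clarify
      fix a assume a: "a \<in> P''" "a \<subseteq> ?Z"
      show "a \<in> R"
      proof (rule ccontr)
        assume "a \<notin> R"
        then have "a \<noteq> {}" "a \<inter> cball z \<rho> = {}" using a(1) unfolding P''_def by auto
        then show False using a(2) ball_subset_cball[of z \<rho>] by blast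
      qed
    qed
    show "R \<subseteq> {a \<in> P''. a \<subseteq> ?Z}" using R(3) unfolding P''_def by blast
  qed
  have nullZ: "?Z - \<Union>R \<in> null_sets lebesgue"
    by (rule null_sets_lebesgueI[OF borel_Diff_open[OF open_ball uR] null])
  have mod0: "eq_mod0 ?Z (\<Union>R)"
  proof -
    have "(?Z - \<Union>R) \<union> (\<Union>R - ?Z) = ?Z - \<Union>R" using RZ by blast
    then show ?thesis unfolding eq_mod0_def using nullZ by simp
  qed
  show "union_mod0 ?Z P''"
    unfolding union_mod0_def by (rule exI[of _ R]) (use mod0 in \<open>simp add: P''_def\<close>)
  have part: "open_partition X P''"
    unfolding open_partition_def
  proof (intro conjI ballI)
    show "countable P''" unfolding P''_def using R(1) partition_P
      by (intro countable_Un countable_Diff countable_image) (auto simp: open_partition_def)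
    have PP: "open a" "a \<noteq> {}" "a \<subseteq> X" "a \<inter> ?Z = {}" if a: "a \<in> (\<lambda>B. B - cball z \<rho>) ` P - {{}}" for a
    proof -
      obtain B where B: "B \<in> P" "a = B - cball z \<rho>" "a \<noteq> {}" using a by blast
      show "open a" unfolding B(2) by (rule open_Diff[OF branch(1)[OF B(1)] closed_cball])
      show "a \<noteq> {}" by (rule B(3))
      show "a \<subseteq> X" using B(2) branch(2)[OF B(1)] by blast
      show "a \<inter> ?Z = {}" using B(2) ball_subset_cball[of z \<rho>] by blast
    qed
    have RR: "open a" "a \<noteq> {}" "a \<subseteq> X" "a \<subseteq> ?Z" if "a \<in> R" for a using R(3)[OF that] ZX by auto
    fix a assume "a \<in> P''"
    then have "a \<in> R \<or> a \<in> (\<lambda>B. B - cball z \<rho>) ` P - {{}}" unfolding P''_def by (rule UnE) simp_all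
    then show "open a" "a \<noteq> {}" "a \<subseteq> X" using RR(1-3) PP(1-3) by metis+
  next
    show "disjoint P''"
    proof (rule disjointI)
      fix a b assume ab: "a \<in> P''" "b \<in> P''" and ne: "a \<noteq> b"
      have out: "\<exists>B\<in>P. c = B - cball z \<rho>" if "c \<in> P''" "c \<notin> R" for c using that unfolding P''_def by blast
      have "c \<inter> d = {}" if "c \<in> R" "d \<in> P''" "d \<notin> R" for c d
        using R(3)[OF that(1)] out[OF that(2,3)] ball_subset_cball[of z \<rho>] by blast
      note mixed = this
      show "a \<inter> b = {}"
      proof (cases "a \<in> R")
        case True
        then show ?thesis using mixed[OF True ab(2)] disjointD[OF R(2) True _ ne] by blast
      next
        case aR: False
        show ?thesis
        proof (cases "b \<in> R")
          case True
          then show ?thesis using mixed[OF True ab(1) aR] by blast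
        next
          case False
          obtain B B' where BB: "B \<in> P" "a = B - cball z \<rho>" "B' \<in> P" "b = B' - cball z \<rho>"
            using out[OF ab(1) aR] out[OF ab(2) False] by blast
          show ?thesis
          proof (rule ccontr)
            assume "a \<inter> b \<noteq> {}"
            then obtain x where "x \<in> B" "x \<in> B'" using BB by blast
            then have "B = B'" by (rule P_disjoint[OF BB(1,3)])
            then show False using BB ne by simp
          qed
        qed
      qed
    qed
    have "sphere z \<rho> \<in> null_sets lebesgue"
      using negligible_sphere negligible_iff_null_sets by blast
    moreover have "X - \<Union>P \<in> null_sets lebesgue" using partition_P by (simp add: open_partition_def)
    ultimately have N: "(X - \<Union>P) \<union> sphere z \<rho> \<union> (?Z - \<Union>R) \<in> null_sets lebesgue"
      using nullZ by (intro null_sets.Un)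
    have "X - \<Union>P'' \<subseteq> (X - \<Union>P) \<union> sphere z \<rho> \<union> (?Z - \<Union>R)"
    proof
      fix x assume x: "x \<in> X - \<Union>P''"
      have xR: "x \<notin> \<Union>R" using x unfolding P''_def by blast
      show "x \<in> (X - \<Union>P) \<union> sphere z \<rho> \<union> (?Z - \<Union>R)"
      proof (cases "x \<in> cball z \<rho>")
        case True
        then show ?thesis using xR by auto
      next
        case False
        have "x \<notin> \<Union>P"
        proof
          assume "x \<in> \<Union>P"
          then obtain B where "B \<in> P" "x \<in> B" by blast
          then have "x \<in> B - cball z \<rho>" "B - cball z \<rho> \<in> P''" using False unfolding P''_def by auto
          then show False using x by blast
        qed
        then show ?thesis using x by blast
      qed
    qed
    then show "X - \<Union>P'' \<in> null_sets lebesgue" using N by (rule null_sets_completion_subset)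
  qed
  show "open_refinement X P P''"
    unfolding open_refinement_def
  proof (intro conjI part ballI)
    fix a assume "a \<in> P''"
    then consider "a \<in> R" | "\<exists>B\<in>P. a = B - cball z \<rho>" unfolding P''_def by blast
    then show "\<exists>B\<in>P. a \<subseteq> B"
    proof cases
      case 1
      obtain m where "0 < m" "cyl m a" using G[OF 1] by blast
      \<comment> \<open>A positive return time forces \<open>a\<close> into a single element of
        \<open>P\<close>.\<close>
      then have "\<exists>B\<in>P. (T ^^ 0) ` a \<subseteq> B" unfolding cyl_def by blast
      then show ?thesis by simp
    qed blast
  qed
  have inj: "inj_on ?G W" if W: "W \<in> R" for W
  proof -
    obtain m where m: "cyl m W" "\<forall>x\<in>W. ?G x = (T ^^ m) x" using G[OF W] by blast
    then show ?thesis using cyl_inj[OF m(1)] by (simp add: inj_on_def)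
  qed
  show "gibbs_markov ?Z R ?G"
    unfolding gibbs_markov_def
  proof (intro conjI ballI)
    show "open ?Z" by simp
    show "open_partition ?Z R" unfolding open_partition_def using R nullZ by blast
    show "\<exists>\<epsilon> \<Lambda>. uniform_expansion ?G R \<epsilon> \<Lambda>"
    proof (rule exI[of _ \<epsilon>\<^sub>1], rule exI[of _ \<Lambda>])
      have "dist (inv_into W ?G x) (inv_into W ?G y) \<le> \<Lambda> * dist x y"
        if W: "W \<in> R" and xy: "x \<in> ?G ` W" "y \<in> ?G ` W" "dist x y \<le> \<epsilon>\<^sub>1" for W x y
      proof -
        obtain m where m: "0 < m" "cyl m W" "\<forall>x\<in>W. ?G x = (T ^^ m) x" using G[OF W] by blast
        obtain u v where uv: "u \<in> W" "v \<in> W" "x = ?G u" "y = ?G v" using xy(1,2) by blast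
        then have xT: "x = (T ^^ m) u" "y = (T ^^ m) v" using m(3) by simp_all
        have "dist (inv_into W ?G x) (inv_into W ?G y) = dist u v"
          unfolding uv(3,4) using inv_into_f_f[OF inj[OF W] uv(1)] inv_into_f_f[OF inj[OF W] uv(2)] by simp
        also have "\<dots> \<le> \<Lambda> ^ m * dist x y" using cyl_contraction[OF m(2) uv(1,2)] xy(3) unfolding xT by simp
        \<comment> \<open>Return times are at least 1, so one application of the contraction factor
          is guaranteed on every branch.\<close>
        also have "\<dots> \<le> \<Lambda> ^ 1 * dist x y"
          using m(1) constants by (intro mult_right_mono power_decreasing) auto
        finally show ?thesis by simp
      qed
      then show "uniform_expansion ?G R \<epsilon>\<^sub>1 \<Lambda>" unfolding uniform_expansion_def using constants by simp
    qed
    show "\<exists>\<alpha> D. bounded_distortion ?G R \<alpha> D"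
    proof (rule exI[of _ \<alpha>], rule exI[of _ Dinf])
      have "\<exists>J. is_jacobian ?G W J \<and> (\<forall>x\<in>?G ` W. \<forall>y\<in>?G ` W. J x \<le> exp (Dinf * dist x y powr \<alpha>) * J y)"
        if W: "W \<in> R" for W
      proof -
        obtain m where m: "cyl m W" "(T ^^ m) ` W = ?Z" "\<forall>x\<in>W. ?G x = (T ^^ m) x" using G[OF W] by blast
        obtain J where J: "is_jacobian (T ^^ m) W J" "\<forall>x\<in>?Z. \<forall>y\<in>?Z.
          dist x y \<le> \<epsilon>\<^sub>1 \<longrightarrow> J x \<le> exp (Dinf * dist x y powr \<alpha>) * J y"
          using cyl_jacobian[OF m(1)] unfolding m(2) by (elim exE conjE)
        have "dist x y \<le> \<epsilon>\<^sub>1" if "x \<in> ?Z" "y \<in> ?Z" for x y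
          using that \<rho>(2) dist_triangle[of x y z] by (simp add: dist_commute)
        then have "\<forall>x\<in>?Z. \<forall>y\<in>?Z. J x \<le> exp (Dinf * dist x y powr \<alpha>) * J y" using J(2) by simp
        moreover have "is_jacobian ?G W J"
          using J(1) is_jacobian_cong[of W ?G "T ^^ m" J] m(3) by simp
        ultimately show ?thesis unfolding Gim[OF W] by (intro exI[of _ J] conjI)
      qed
      then show "bounded_distortion ?G R \<alpha> Dinf" unfolding bounded_distortion_def using constants D_inf by simp
    qed
    fix W assume W: "W \<in> R"
    obtain m where m: "cyl m W" "\<forall>x\<in>W. ?G x = (T ^^ m) x" using G[OF W] by blast
    show "nonsingular_homeo_on ?G W"
      using cyl_nonsingular[OF m(1)] nonsingular_homeo_on_cong[of W ?G "T ^^ m"] m(2) by simp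
    show "?G ` W \<subseteq> ?Z" using Gim[OF W] by simp
    show "union_mod0 (?G ` W) R" unfolding Gim[OF W] union_mod0_def using mod0 by blast
  qed
  show "full_branched ?Z R ?G" unfolding full_branched_def using Gim by blast
  show "\<forall>a\<in>R. \<tau> constant_on a"
  proof
    fix a assume "a \<in> R"
    then obtain m where "\<forall>x\<in>a. \<tau> x = m" using G by blast
    then show "\<tau> constant_on a" unfolding constant_on_def by blast
  qed
  show "\<forall>a\<in>R. \<forall>x\<in>a. \<forall>i<\<tau> x. (T ^^ i) x \<in> \<Union>P"
  proof (intro ballI allI impI)
    fix a x i assume a: "a \<in> R" "x \<in> a" "i < \<tau> x"
    obtain m where m: "cyl m a" "\<forall>x\<in>a. \<tau> x = m" using G[OF a(1)] by blast
    have "i < m" using m(2) a by simp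
    then obtain B where "B \<in> P" "(T ^^ i) ` a \<subseteq> B" using m(1) unfolding cyl_def by blast
    then show "(T ^^ i) x \<in> \<Union>P" using a(2) by blast
  qed
qed

text \<open>As \<open>\<delta>\<close> tends to 0 the distortion factor tends to 1, and the strict
  bound on \<open>\<sigma>\<close> leaves room for \<open>r\<close>.\<close>

lemma ex_growth_constants:
  assumes cc: "controlled_complexity X T P \<Lambda> n\<^sub>0 \<epsilon>\<^sub>2 \<sigma>"
  shows "\<exists>r \<delta> \<epsilon>. growth X T P \<epsilon>\<^sub>1 \<Lambda> \<alpha> D n\<^sub>0 \<epsilon>\<^sub>2 \<sigma> r \<delta> \<epsilon>"
proof -
  have c: "0 < \<epsilon>\<^sub>2" "0 \<le> \<sigma>" "\<sigma> < inverse (\<Lambda> ^ n\<^sub>0) - 1" using cc by (auto simp: controlled_complexity_def)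
  \<comment> \<open>For \<open>n\<^sub>0 = 0\<close> the complexity condition would require
    \<open>0 \<le> \<sigma> < 0\<close>.\<close>
  have n0: "0 < n\<^sub>0" using c(2,3) by (intro gr0I) simp
  have "((\<lambda>\<delta>. 1 + exp (Dinf * \<delta> powr \<alpha>) * \<sigma>) \<longlongrightarrow> 1 + exp (Dinf * 0) * \<sigma>) (at_right 0)"
  proof -
    have "((\<lambda>\<delta>::real. \<delta> powr \<alpha>) \<longlongrightarrow> 0) (at_right 0)"
      by (rule tendsto_zero_powrI[OF tendsto_ident_at tendsto_const])
        (use constants in \<open>auto simp: eventually_at_right_less eventually_at_filter\<close>)
    then show ?thesis by (intro tendsto_intros)
  qed
  then have "\<forall>\<^sub>F \<delta> in at_right 0. 1 + exp (Dinf * \<delta> powr \<alpha>) * \<sigma> < inverse (\<Lambda> ^ n\<^sub>0)"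
    by (rule order_tendstoD(2)) (use c in simp)
  moreover have "\<forall>\<^sub>F \<delta> in at_right 0. \<delta> \<in> {0<..<min \<epsilon>\<^sub>1 \<epsilon>\<^sub>2}"
    using constants(1) c(1) by (intro eventually_at_right_real) simp
  ultimately have "\<forall>\<^sub>F \<delta> in at_right 0. 1 + exp (Dinf * \<delta> powr \<alpha>) * \<sigma> < inverse (\<Lambda> ^ n\<^sub>0) \<and> \<delta> \<in> {0<..<min \<epsilon>\<^sub>1 \<epsilon>\<^sub>2}"
    by (rule eventually_conj)
  then obtain \<delta> where \<delta>: "1 + exp (Dinf * \<delta> powr \<alpha>) * \<sigma> < inverse (\<Lambda> ^ n\<^sub>0)" "\<delta> \<in> {0<..<min \<epsilon>\<^sub>1 \<epsilon>\<^sub>2}"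
    using eventually_happens'[OF trivial_limit_at_right_real] by blast
  obtain r where r: "1 + exp (Dinf * \<delta> powr \<alpha>) * \<sigma> < r" "r < inverse (\<Lambda> ^ n\<^sub>0)" using dense[OF \<delta>(1)] by blast
  have "0 < \<Lambda> ^ n\<^sub>0" using constants by simp
  then have "r * \<Lambda> ^ n\<^sub>0 < 1" using r(2) by (simp add: field_simps)
  then have "growth X T P \<epsilon>\<^sub>1 \<Lambda> \<alpha> D n\<^sub>0 \<epsilon>\<^sub>2 \<sigma> r \<delta> (\<epsilon>\<^sub>2 / 2)"
    using cc n0 \<delta>(2) c(1) r(1) by unfold_locales auto
  then show ?thesis by blast
qed

end

theorem corollary1:
  fixes X :: "'a::euclidean_space set"
    and T :: "'a \<Rightarrow> 'a"
    and P :: "'a set set"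
    and \<epsilon>\<^sub>1 \<Lambda> \<alpha> D \<epsilon>\<^sub>2 \<sigma> :: real
    and n\<^sub>0 :: nat
  assumes "open X" and "bounded X" and "X \<noteq> {}"
    and "(SUP \<epsilon>\<in>{0<..}. emeasure lebesgue (collar \<epsilon> X) / ennreal \<epsilon>) < \<infinity>"
    and "piecewise_invertible X T P"
    and "uniform_expansion T P \<epsilon>\<^sub>1 \<Lambda>"
    and "bounded_distortion T P \<alpha> D"
    and "controlled_complexity X T P \<Lambda> n\<^sub>0 \<epsilon>\<^sub>2 \<sigma>"
    and "ergodic X T"
  shows "\<exists>(Z :: 'a set) (P'' :: 'a set set) (\<tau> :: 'a \<Rightarrow> nat).
           open Z \<and> Z \<noteq> {} \<and> Z \<subseteq> X \<and>
           open_refinement X P P'' \<and> union_mod0 Z P'' \<and>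
           (\<forall>x\<in>Z. 0 < \<tau> x) \<and>
           (\<forall>a\<in>P''. a \<subseteq> Z \<longrightarrow> \<tau> constant_on a) \<and>
           \<comment> \<open>\<open>T ^^ \<tau>\<close> only uses values of \<open>T\<close> on the partition elements\<close>
           (\<forall>a\<in>P''. a \<subseteq> Z \<longrightarrow> (\<forall>x\<in>a. \<forall>i<\<tau> x. (T ^^ i) x \<in> \<Union>P)) \<and>
           gibbs_markov Z {a \<in> P''. a \<subseteq> Z} (\<lambda>x. (T ^^ \<tau> x) x) \<and>
           full_branched Z {a \<in> P''. a \<subseteq> Z} (\<lambda>x. (T ^^ \<tau> x) x) \<and>
           (\<exists>\<kappa> C :: real. 0 < \<kappa> \<and> \<kappa> < 1 \<and>
              (\<forall>n. emeasure lebesgue {x \<in> Z. n < \<tau> x} \<le> ennreal (C * \<kappa> ^ n)))"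
proof -
  interpret piecewise_expanding X T P \<epsilon>\<^sub>1 \<Lambda> \<alpha> D by unfold_locales (fact assms)+
  obtain r \<delta> \<epsilon> where "growth X T P \<epsilon>\<^sub>1 \<Lambda> \<alpha> D n\<^sub>0 \<epsilon>\<^sub>2 \<sigma> r \<delta> \<epsilon>" using ex_growth_constants[OF assms(8)] by blast
  then interpret growth X T P \<epsilon>\<^sub>1 \<Lambda> \<alpha> D n\<^sub>0 \<epsilon>\<^sub>2 \<sigma> r \<delta> \<epsilon> .
  from return_stage[OF assms(9,3)] obtain z R s J \<kappa> a where st: "0 < R" "2 * R \<le> \<delta>" "cball z R \<subseteq> X" "0 < s" "0 < \<kappa>" "\<kappa> < 1" "0 \<le> a"
    and step: "\<forall>n U. piece n U \<longrightarrow> (\<exists>F W m. splits piece (\<lambda>m W. cyl m W \<and> (T ^^ m) ` W = ball z R)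
      (\<lambda>n U. vol U + ennreal a * Z n U) s J \<kappa> n U F W m)"
    by (elim exE conjE)
  note init = initial_ball[OF st(1-3)]
  have \<Phi>: "open U \<and> U \<noteq> {} \<and> vol U \<le> vol U + ennreal a * Z n U" if "piece n U" for n U
    using cyl_open[OF piece_cyl[OF that]] piece_ne[OF that] by simp
  have fin: "vol (ball z R) + ennreal a * Z 0 (ball z R) < \<infinity>"
    using init(2) emeasure_bounded_finite[OF bounded_ball, of z R] by (simp add: ennreal_mult_less_top less_top)
  have "\<exists>Q \<tau>. countable Q \<and> disjoint Q \<and>
    (\<forall>W\<in>Q. open W \<and> W \<noteq> {} \<and> W \<subseteq> ball z R \<and> (\<exists>m>0. (cyl m W \<and> (T ^^ m) ` W = ball z R) \<and> (\<forall>x\<in>W. \<tau> x = m))) \<and>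
    vol (ball z R - \<Union>Q) = 0 \<and> (\<forall>x. 0 < \<tau> x) \<and>
    (\<exists>\<kappa>' C :: real. 0 < \<kappa>' \<and> \<kappa>' < 1 \<and> (\<forall>n. emeasure lebesgue {x \<in> ball z R. n < \<tau> x} \<le> ennreal (C * \<kappa>' ^ n)))"
    by (rule stopping_partition[where piece = piece and ret = "\<lambda>m W. cyl m W \<and> (T ^^ m) ` W = ball z R"
        and \<Phi> = "\<lambda>n U. vol U + ennreal a * Z n U", OF step[rule_format] \<Phi> st(4,5,6) init(1) fin])
  then obtain Q \<tau> where Q: "countable Q" "disjoint Q"
    "\<forall>W\<in>Q. open W \<and> W \<noteq> {} \<and> W \<subseteq> ball z R \<and> (\<exists>m>0. (cyl m W \<and> (T ^^ m) ` W = ball z R) \<and> (\<forall>x\<in>W. \<tau> x = m))"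
    "vol (ball z R - \<Union>Q) = 0" "\<forall>x. 0 < \<tau> x"
    and tail: "\<exists>\<kappa>' C :: real. 0 < \<kappa>' \<and> \<kappa>' < 1 \<and> (\<forall>n. emeasure lebesgue {x \<in> ball z R. n < \<tau> x} \<le> ennreal (C * \<kappa>' ^ n))"
    by (elim exE) (rule that; elim conjE; assumption)
  have R2: "2 * R \<le> \<epsilon>\<^sub>1" using st(2) delta(2) by simp
  have Q3: "open W \<and> W \<noteq> {} \<and> W \<subseteq> ball z R"
    "\<exists>m>0. (cyl m W \<and> (T ^^ m) ` W = ball z R) \<and> (\<forall>x\<in>W. \<tau> x = m)" if "W \<in> Q" for W
    using bspec[OF Q(3) that] by simp_all
  note fb = full_branched_refinement[OF st(1) R2 st(3) Q(1,2) Q3 Q(4)]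
  let ?P = "Q \<union> ((\<lambda>B. B - cball z R) ` P - {{}})"
  have eq: "{a \<in> ?P. a \<subseteq> ball z R} = Q" by (rule fb(3))
  then have mem: "a \<in> Q" if "a \<in> ?P" "a \<subseteq> ball z R" for a using that by blast
  have c6: "\<forall>a\<in>Q. \<tau> constant_on a" by (rule fb(6))
  have c7: "\<forall>a\<in>Q. \<forall>x\<in>a. \<forall>i<\<tau> x. (T ^^ i) x \<in> \<Union>P" by (rule fb(7))
  have ZX: "ball z R \<subseteq> X" using st(3) ball_subset_cball by blast
  show ?thesis
  proof (intro exI[of _ "ball z R"] exI[of _ ?P] exI[of _ \<tau>] conjI)
    show "open (ball z R)" "ball z R \<noteq> {}" "ball z R \<subseteq> X" using st(1) ZX by simp_all
    show "open_refinement X P ?P" by (rule fb(1))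
    show "union_mod0 (ball z R) ?P" by (rule fb(2))
    show "\<forall>x\<in>ball z R. 0 < \<tau> x" using Q(5) by simp
    show "\<forall>a\<in>?P. a \<subseteq> ball z R \<longrightarrow> \<tau> constant_on a"
      by (intro ballI impI) (rule bspec[OF c6 mem])
    show "\<forall>a\<in>?P. a \<subseteq> ball z R \<longrightarrow> (\<forall>x\<in>a. \<forall>i<\<tau> x. (T ^^ i) x \<in> \<Union>P)"
      by (rule ballI, rule impI, rule bspec[OF c7 mem])
    show "gibbs_markov (ball z R) {a \<in> ?P. a \<subseteq> ball z R} (\<lambda>x. (T ^^ \<tau> x) x)"
      unfolding eq by (rule fb(4))
    show "full_branched (ball z R) {a \<in> ?P. a \<subseteq> ball z R} (\<lambda>x. (T ^^ \<tau> x) x)"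
      unfolding eq by (rule fb(5))
    show "\<exists>\<kappa> C :: real. 0 < \<kappa> \<and> \<kappa> < 1 \<and>
       (\<forall>n. emeasure lebesgue {x \<in> ball z R. n < \<tau> x} \<le> ennreal (C * \<kappa> ^ n))" by (rule tail)
  qed
qed

end
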